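(* Let $q=2^r$. (a) For odd $n\ge1$ and $j=0,\dots,N^-(n,q)$, where $N^-(n,q)=|DC^-(n,q)|$, the number $C_j^-(n,q)$ of codewords of weight $j$ in $C(DC^-(n,q))$ is $$C_j^-(n,q)=\sum\binom{q^{-1}A^-(n,q)(B^-(n,q)+1)}{\nu_0}\prod_{\beta\in\mathbb{F}_q^*,\ tr(\beta^{-1})=0}\binom{q^{-1}A^-(n,q)(B^-(n,q)+q+1)}{\nu_\beta}\prod_{\beta\in\mathbb{F}_q^*,\ tr(\beta^{-1})=1}\binom{q^{-1}A^-(n,q)(B^-(n,q)-q+1)}{\nu_\beta},$$ the sum being over all families of nonnegative integers $\{\nu_\beta\}_{\beta\in\mathbb{F}_q}$ with $\sum_\beta\nu_\beta=j$ and $\sum_\beta\nu_\beta\beta=0$. (b) For even $n\ge2$, $q\ge4$, and $j=0,\dots,N^+(n,q)$, where $N^+(n,q)=|DC^+(n,q)|$, the number $C_j^+(n,q)$ of codewords of weight $j$ in $C(DC^+(n,q))$ is $$C_j^+(n,q)=\sum\binom{q^{-1}A^+(n,q)(B^+(n,q)+q^3-q^2-1)}{\nu_0}\prod_{\substack{\tau\in\mathbb{Z},\ |\tau|<2\sqrt q\\ \tau\equiv-1\ (\mathrm{mod}\ 4)}}\ \prod_{\beta\in\mathbb{F}_q^*,\ K(\lambda;\beta^{-1})=\tau}\binom{q^{-1}A^+(n,q)(B^+(n,q)+q\tau-q^2-1)}{\nu_\beta},$$ the sum being over all families of nonnegative integers $\{\nu_\beta\}_{\beta\in\mathbb{F}_q}$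 with $\sum_\beta\nu_\beta=j$ and $\sum_\beta\nu_\beta\beta=0$.
   Context: $q=2^r$; $tr:\mathbb{F}_q\to\mathbb{F}_2$, $tr(x)=x+x^2+\dots+x^{2^{r-1}}$; $\lambda(x)=(-1)^{tr(x)}$; $\mathrm{Tr}$ is the matrix trace. $Sp(2n,q)=\{w\in GL(2n,\mathbb{F}_q):{}^twJw=J\}$, $J=\begin{pmatrix}0&1_n\\1_n&0\end{pmatrix}$. $P=P(2n,q)$ is the subgroup of all $\begin{pmatrix}A&0\\0&{}^tA^{-1}\end{pmatrix}\begin{pmatrix}1_n&B\\0&1_n\end{pmatrix}$, $A\in GL(n,\mathbb{F}_q)$, $B$ symmetric. $\sigma_s=\begin{pmatrix}0&0&1_s&0\\0&1_{n-s}&0&0\\1_s&0&0&0\\0&0&0&1_{n-s}\end{pmatrix}$ (block sizes $s,n-s,s,n-s$). $DC^-(n,q)=P\sigma_{n-1}P$ ($n$ odd), $DC^+(n,q)=P\sigma_{n-2}P$ ($n$ even). For $D=DC^\mp(n,q)$, $N=|D|$, fix an ordering $g_1,\dots,g_N$ of $D$ and let $C(D)=\{u\in\mathbb{F}_2^N:\sum_j u_j\,\mathrm{Tr}\,g_j=0\text{ in }\mathbb{F}_q\}$. $\left[\begin{smallmatrix}n\\ s\end{smallmatrix}\right]_q=\prod_{j=0}^{s-1}\frac{q^{n-j}-1}{q^{s-j}-1}$. $A^-(n,q)=q^{\frac14(5n^2-1)}\left[\begin{smallmatrix}n\\1\end{smallmatrix}\right]_q\prod_{j=1}^{(n-1)/2}(q^{2j-1}-1)$,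 $B^-(n,q)=q^{\frac14(n-1)^2}(q^n-1)\prod_{j=1}^{(n-1)/2}(q^{2j}-1)$, $A^+(n,q)=q^{\frac14(5n^2-2n)}\left[\begin{smallmatrix}n\\2\end{smallmatrix}\right]_q\prod_{j=1}^{(n-2)/2}(q^{2j-1}-1)$, $B^+(n,q)=q^{\frac14(n-2)^2}(q^n-1)(q^{n-1}-1)\prod_{j=1}^{(n-2)/2}(q^{2j}-1)$ (empty products $=1$). $K(\lambda;a)=\sum_{\alpha\in\mathbb{F}_q^*}\lambda(\alpha+a\alpha^{-1})$. Convention: $\binom ba=0$ if $a>b$ or $a<0$. *)

theory Defs
  imports
    Complex_Main
    "HOL-Library.Z2"
    "HOL-Number_Theory.Cong"
    "Jordan_Normal_Form.Matrix"
begin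

text \<open>
  The field of order \<open>q = 2 ^ r\<close> is an arbitrary type of sort \<open>{field, finite}\<close> with
  \<open>2 ^ r\<close> elements. Matrices over it are those of \<^typ>\<open>'a mat\<close>, so that the size
  \<open>n\<close> is an ordinary natural number. The prime field, as the alphabet of binary codes, is
  \<^typ>\<open>bit\<close>.
\<close>

section \<open>Characters and Kloosterman sums\<close>

text \<open>The absolute trace, with values in the prime field \<open>{0, 1}\<close> inside \<^typ>\<open>'a\<close>.\<close>

definition tr :: "nat \<Rightarrow> 'a::field \<Rightarrow> 'a" where
  "tr r x = (\<Sum>i<r. x ^ (2 ^ i))"

definition add_char :: "nat \<Rightarrow> 'a::field \<Rightarrow> int" where
  "add_char r x = (if tr r x = 0 then 1 else -1)"

definition kloosterman :: "nat \<Rightarrow> 'a::{field,finite} \<Rightarrow> int" where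
  "kloosterman r a = (\<Sum>\<alpha> \<in> UNIV - {0}. add_char r (\<alpha> + a * inverse \<alpha>))"

section \<open>Symplectic groups and double cosets\<close>

definition mat_tr :: "'a::comm_monoid_add mat \<Rightarrow> 'a" where
  "mat_tr M = (\<Sum>i<dim_row M. M $$ (i, i))"

definition GL :: "nat \<Rightarrow> 'a::field mat set" where
  "GL m = {A \<in> carrier_mat m m. invertible_mat A}"

definition J_mat :: "nat \<Rightarrow> 'a::field mat" where
  "J_mat n = four_block_mat (0\<^sub>m n n) (1\<^sub>m n) (1\<^sub>m n) (0\<^sub>m n n)"

text \<open>Since \<^const>\<open>J_mat\<close> has no sign, this is the symplectic group only in characteristic two.\<close>

definition Sp :: "nat \<Rightarrow> 'a::field mat set" where
  "Sp n = {w \<in> GL (2 * n). transpose_mat w * J_mat n * w = J_mat n}"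

definition parabolic :: "nat \<Rightarrow> 'a::field mat set" where
  "parabolic n =
    {four_block_mat A (0\<^sub>m n n) (0\<^sub>m n n) (transpose_mat A') *
     four_block_mat (1\<^sub>m n) B (0\<^sub>m n n) (1\<^sub>m n) | A A' B.
       A \<in> GL n \<and> A' \<in> carrier_mat n n \<and> inverts_mat A A' \<and> inverts_mat A' A \<and>
       B \<in> carrier_mat n n \<and> transpose_mat B = B}"

text \<open>Only meaningful for \<open>s \<le> n\<close>.\<close>

definition sigma :: "nat \<Rightarrow> nat \<Rightarrow> 'a::field mat" where
  "sigma n s =
    four_block_mat
      (four_block_mat (0\<^sub>m s s) (0\<^sub>m s (n - s)) (0\<^sub>m (n - s) s) (1\<^sub>m (n - s)))
      (four_block_mat (1\<^sub>m s) (0\<^sub>m s (n - s)) (0\<^sub>m (n - s) s) (0\<^sub>m (n - s) (n - s)))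
      (four_block_mat (1\<^sub>m s) (0\<^sub>m s (n - s)) (0\<^sub>m (n - s) s) (0\<^sub>m (n - s) (n - s)))
      (four_block_mat (0\<^sub>m s s) (0\<^sub>m s (n - s)) (0\<^sub>m (n - s) s) (1\<^sub>m (n - s)))"

definition double_coset :: "nat \<Rightarrow> nat \<Rightarrow> 'a::field mat set" where
  "double_coset n s = {x * sigma n s * y | x y. x \<in> parabolic n \<and> y \<in> parabolic n}"

definition DC_minus :: "nat \<Rightarrow> 'a::field mat set" where
  "DC_minus n = double_coset n (n - 1)"

definition DC_plus :: "nat \<Rightarrow> 'a::field mat set" where
  "DC_plus n = double_coset n (n - 2)"

lemma parabolic_subset_Sp:
  assumes char2: "(2 :: 'a::field) = 0"
  shows "(parabolic n :: 'a mat set) \<subseteq> Sp n"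
proof
  fix w :: "'a mat"
  assume "w \<in> parabolic n"
  then obtain A A' B where w: "w =
      four_block_mat A (0\<^sub>m n n) (0\<^sub>m n n) (transpose_mat A') *
      four_block_mat (1\<^sub>m n) B (0\<^sub>m n n) (1\<^sub>m n)"
    and A: "A \<in> carrier_mat n n" and A': "A' \<in> carrier_mat n n"
    and inv: "inverts_mat A A'" "inverts_mat A' A"
    and B: "B \<in> carrier_mat n n" and sym: "transpose_mat B = B"
    by (auto simp: parabolic_def GL_def)
  note blocks = mult_four_block_mat[of _ n n _ n _ n _ _ n _ n]
  note assoc = assoc_mult_mat[of _ n n _ n _ n]
  have AA': "A * A' = 1\<^sub>m n" "A' * A = 1\<^sub>m n"
    using inv A A' by (auto simp: inverts_mat_def)
  have tAA': "transpose_mat A' * transpose_mat A = 1\<^sub>m n"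
      "transpose_mat A * transpose_mat A' = 1\<^sub>m n"
    using AA' transpose_mult[OF A A'] transpose_mult[OF A' A] transpose_one by metis+
  have BB: "B + B = 0\<^sub>m n n"
  proof (rule eq_matI)
    fix i j
    assume "i < dim_row (0\<^sub>m n n :: 'a mat)" "j < dim_col (0\<^sub>m n n :: 'a mat)"
    moreover have "x + x = 0" for x :: 'a
      using char2 by (metis mult_2 mult_zero_left)
    ultimately show "(B + B) $$ (i, j) = 0\<^sub>m n n $$ (i, j)"
      using B by auto
  qed (use B in auto)
  have tA: "transpose_mat A \<in> carrier_mat n n" "transpose_mat A' \<in> carrier_mat n n"
    using A A' by auto
  have w': "w = four_block_mat A (A * B) (0\<^sub>m n n) (transpose_mat A')"
    unfolding w using A B tA by (simp add: blocks)
  let ?v = "four_block_mat A' (B * transpose_mat A) (0\<^sub>m n n) (transpose_mat A)"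
  have wc: "w \<in> carrier_mat (n + n) (n + n)"
    unfolding w' using A tA by (intro four_block_carrier_mat) auto
  have vc: "?v \<in> carrier_mat (n + n) (n + n)"
    using A' tA by (intro four_block_carrier_mat) auto
  have one: "four_block_mat (1\<^sub>m n) (0\<^sub>m n n) (0\<^sub>m n n) (1\<^sub>m n) = (1\<^sub>m (n + n) :: 'a mat)"
    by (rule eq_matI) auto
  have e1: "A * (B * transpose_mat A) + A * B * transpose_mat A = 0\<^sub>m n n"
  proof -
    have "A * (B * transpose_mat A) + A * B * transpose_mat A = A * ((B + B) * transpose_mat A)"
      using A B tA
      by (simp add: assoc add_mult_distrib_mat[of _ n n _ _ n] mult_add_distrib_mat[of _ n n _ n])
    then show ?thesis
      using A tA by (simp add: BB)
  qed
  have e2: "A' * (A * B) + B * transpose_mat A * transpose_mat A' = 0\<^sub>m n n"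
  proof -
    have "A' * (A * B) = (A' * A) * B"
      using A A' B by (simp add: assoc)
    then show ?thesis
      using B tA BB by (simp add: assoc AA' tAA')
  qed
  have wv: "w * ?v = 1\<^sub>m (n + n)"
    unfolding w' using A A' B tA AA' tAA' e1 one by (simp add: blocks)
  have vw: "?v * w = 1\<^sub>m (n + n)"
    unfolding w' using A A' B tA AA' tAA' e2 one by (simp add: blocks)
  have GL: "w \<in> GL (2 * n)"
    using wc vc wv vw unfolding GL_def invertible_mat_def inverts_mat_def
    by (auto simp: mult_2 intro!: exI[of _ ?v])
  have tw: "transpose_mat w =
      four_block_mat (transpose_mat A) (0\<^sub>m n n) (B * transpose_mat A) A'"
    unfolding w' using A A' B tA sym
    by (subst transpose_four_block_mat[of _ n n _ n _ n]) (auto simp: transpose_mult[of _ n n _ n])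
  have "transpose_mat w * J_mat n * w = J_mat n"
    unfolding tw J_mat_def unfolding w' using A A' B tA AA' tAA' e2
    by (simp add: blocks)
  with GL show "w \<in> Sp n"
    by (simp add: Sp_def)
qed

section \<open>Binary codes attached to sequences of matrices\<close>

definition trace_code :: "nat \<Rightarrow> (nat \<Rightarrow> 'a::field mat) \<Rightarrow> bit vec set" where
  "trace_code N g =
    {u \<in> carrier_vec N. (\<Sum>j<N. if u $ j = 1 then mat_tr (g j) else 0) = 0}"

definition weight :: "bit vec \<Rightarrow> nat" where
  "weight u = card {j. j < dim_vec u \<and> u $ j \<noteq> 0}"

definition num_codewords :: "nat \<Rightarrow> (nat \<Rightarrow> 'a::field mat) \<Rightarrow> nat \<Rightarrow> nat" where
  "num_codewords N g j = card {u \<in> trace_code N g. weight u = j}"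

section \<open>The numerical quantities\<close>

text \<open>
  Upper arguments are real numbers, so no division or subtraction is truncated; the binomial
  coefficient vanishes whenever the lower argument exceeds the upper one.
\<close>

definition binom :: "real \<Rightarrow> nat \<Rightarrow> real" where
  "binom b a = (if real a > b then 0 else b gchoose a)"

definition q_binom :: "nat \<Rightarrow> nat \<Rightarrow> nat \<Rightarrow> real" where
  "q_binom q n s = (\<Prod>j<s. (real q ^ (n - j) - 1) / (real q ^ (s - j) - 1))"

text \<open>
  The divisions in the exponents and in the bounds of the products are exact for odd \<open>n\<close>
  (superscript minus), respectively for even \<open>n \<ge> 2\<close> (superscript plus).
\<close>

definition A_minus :: "nat \<Rightarrow> nat \<Rightarrow> real" where
  "A_minus n q = real q ^ ((5 * n ^ 2 - 1) div 4) * q_binom q n 1 *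
    (\<Prod>j = 1..(n - 1) div 2. real q ^ (2 * j - 1) - 1)"

definition B_minus :: "nat \<Rightarrow> nat \<Rightarrow> real" where
  "B_minus n q = real q ^ ((n - 1) ^ 2 div 4) * (real q ^ n - 1) *
    (\<Prod>j = 1..(n - 1) div 2. real q ^ (2 * j) - 1)"

definition A_plus :: "nat \<Rightarrow> nat \<Rightarrow> real" where
  "A_plus n q = real q ^ ((5 * n ^ 2 - 2 * n) div 4) * q_binom q n 2 *
    (\<Prod>j = 1..(n - 2) div 2. real q ^ (2 * j - 1) - 1)"

definition B_plus :: "nat \<Rightarrow> nat \<Rightarrow> real" where
  "B_plus n q = real q ^ ((n - 2) ^ 2 div 4) * (real q ^ n - 1) * (real q ^ (n - 1) - 1) *
    (\<Prod>j = 1..(n - 2) div 2. real q ^ (2 * j) - 1)"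

definition families :: "nat \<Rightarrow> ('a::{field,finite} \<Rightarrow> nat) set" where
  "families j =
    {\<nu>. (\<Sum>\<beta>\<in>UNIV. \<nu> \<beta>) = j \<and> (\<Sum>\<beta>\<in>UNIV. of_nat (\<nu> \<beta>) * \<beta>) = 0}"

end

theory Submission
  imports Defs
    "HOL-Computational_Algebra.Polynomial"
    "Jordan_Normal_Form.Determinant"
begin

text \<open>
  A codeword is a set of group elements whose traces sum to zero, so the weight distribution only
  depends on how often each \<open>\<beta>\<close> occurs as a trace on \<open>P \<sigma> P\<close>. Up to the order of a stabilizer this is
  the number of \<open>p \<in> P\<close> with \<open>Tr (p \<sigma>) = \<beta>\<close>. For fixed \<open>A\<close> the trace of \<open>p \<sigma>\<close> is affine in the symmetric
  matrix \<open>B\<close>, hence uniformly distributed, unless \<open>A\<close> is block lower triangular with alternating upper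
  left block. In that case it is constant, and what remains is to count the \<open>D \<in> GL t\<close> with
  \<open>Tr D + Tr D\<^sup>-\<^sup>1 = \<beta>\<close>, where \<open>t\<close> is 1 or 2. For \<open>t = 1\<close> this is an Artin-Schreier equation, for \<open>t = 2\<close>
  it leads to a Kloosterman sum.

  That the product over \<open>\<tau>\<close> in part (b) exhausts the field is the Weil bound. It is proved along the
  lines of Manin's proof of the Hasse inequality: the \<open>x\<close>-coordinates of Frobenius plus \<open>n\<close> times the
  identity on the curve \<open>y\<^sup>2 + x y = x\<^sup>3 + a x\<close> are rational functions whose degrees \<open>d n\<close> satisfy
  \<open>d (n + 1) + d (n - 1) = 2 d n + 2\<close>, so that \<open>d n\<close> is the quadratic \<open>n\<^sup>2 - K n + q\<close>, which is
  nonnegative on the integers. No group law is needed: in characteristic two the coordinates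
  with indices \<open>n - 1\<close> and \<open>n + 1\<close> are the two roots of an explicit quadratic over the coordinate with
  index \<open>n\<close>, whose coefficients are coprime.
\<close>

section \<open>Coprime pairs of polynomials and the addition relation\<close>

text \<open>The curve enters through Artin-Schreier theory. Divided by \<open>x ^ 2\<close> its
  equation reads \<open>(y/x) ^ 2 + y/x = x + a/x\<close>, so a nonzero \<open>x\<close> in the
  field carries two points or none according to the trace of \<open>x + a/x\<close>, and the
  Kloosterman sum \<open>K\<close> counts points. The abscissas live in the rational functions in
  \<open>X\<close>: the identity has coordinate \<open>X\<close>, Frobenius has
  \<open>X ^ q\<close>, so \<open>d 0 = q\<close>, and adding these two points explicitly gives
  \<open>d 1 = q + 1 - K\<close>. The bound is strict because \<open>K\<close> is odd: the minimum
  over the integers is attained at two neighbouring indices, and two neighbouring coordinates cannot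
  both be constant. On the matrix side the exceptional \<open>A\<close> reflect that, in
  characteristic two, off-diagonal terms of the pairing between symmetric matrices occur in equal
  pairs. In both double cosets \<open>s = 2 * m\<close> is even, the parity in which invertible
  alternating matrices of size \<open>s\<close> exist. Their number splits off from the order of
  \<open>GL s\<close>; the quotient supplies the even factors \<open>q ^ (2 * j) - 1\<close> of
  \<open>B_minus\<close> and \<open>B_plus\<close>, the number itself the odd factors of
  \<open>A_minus\<close> and \<open>A_plus\<close>.\<close>

definition bezout :: "'a::idom \<Rightarrow> 'a \<Rightarrow> bool" where
  "bezout A B \<longleftrightarrow> (\<exists>u v. u * A + v * B = 1)"

text \<open>Squaring the Bezout identity leaves \<open>u ^ 2 * A ^ 2\<close> as the only term
  without a factor \<open>B\<close>. Coprimality is kept as an explicit identity because it is used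
  and established through ideal computations of this kind.\<close>

lemma bezout_dvd_mult_cancel:
  assumes "bezout A B" "B dvd C * A ^ 2"
  shows "B dvd C"
proof -
  from assms(1) obtain u v where uv: "u * A + v * B = 1"
    by (auto simp: bezout_def)
  have "C = C * (u * A + v * B) ^ 2"
    by (simp add: uv)
  also have "\<dots> = u ^ 2 * (C * A ^ 2) + B * (C * (2 * u * v * A + v ^ 2 * B))"
    by (simp add: algebra_simps power2_eq_square)
  finally show ?thesis
    using assms(2) by (metis dvd_add dvd_mult dvd_triv_left)
qed

lemma bezout_commute: "bezout A B \<longleftrightarrow> bezout B A"
  unfolding bezout_def by (metis add.commute)

lemma bezout_mult:
  assumes "bezout A B" "bezout A C"
  shows "bezout A (B * C)"
proof -
  from assms obtain u v u' v' where uv: "u * A + v * B = 1" "u' * A + v' * C = 1"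
    by (auto simp: bezout_def)
  have "(u * (u' * A + v' * C) + v * B * u') * A + (v * v') * (B * C) = (u * A + v * B) * (u' * A + v' * C)"
    by (simp add: algebra_simps)
  then have "(u * (u' * A + v' * C) + v * B * u') * A + (v * v') * (B * C) = 1"
    by (simp only: uv mult_1)
  then show ?thesis
    unfolding bezout_def by blast
qed

lemma bezout_one [simp]: "bezout A 1"
  unfolding bezout_def by (auto intro: exI[of _ 0])

lemma bezout_prod:
  assumes "\<And>c. c \<in> S \<Longrightarrow> bezout A (f c)"
  shows "bezout A (prod f S)"
  using assms by (induction S rule: infinite_finite_induct) (auto intro: bezout_mult)

text \<open>Modulo \<open>[:-c, 1:]\<close> the polynomial \<open>A\<close> is the constant
  \<open>poly A c\<close>, a unit.\<close>

lemma bezout_linear: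
  fixes A :: "'a::field poly"
  assumes "poly A c \<noteq> 0"
  shows "bezout A [:-c, 1:]"
proof -
  have "[:-c, 1:] dvd A - [:poly A c:]"
    by (simp add: poly_eq_0_iff_dvd[symmetric])
  then obtain k where k: "A - [:poly A c:] = [:-c, 1:] * k" ..
  have "[:inverse (poly A c):] * A + (- [:inverse (poly A c):] * k) * [:-c, 1:]
      = [:inverse (poly A c):] * (A - [:-c, 1:] * k)"
    by (simp only: right_diff_distrib mult.assoc minus_mult_left[symmetric] mult.commute[of k]
        add_uminus_conv_diff)
  also have "A - [:-c, 1:] * k = [:poly A c:]"
    unfolding k[symmetric] by simp
  also have "[:inverse (poly A c):] * [:poly A c:] = 1"
    using assms by (simp add: one_pCons)
  finally show ?thesis
    unfolding bezout_def by blast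
qed

text \<open>The next two definitions treat a rational function as a pair of polynomials
  \<open>(A : B)\<close>, the point at infinity being \<open>(1 : 0)\<close>. With \<open>T = A / B\<close> and \<open>U = A' / B'\<close> the second one
  reads \<open>T\<^sup>2 U\<^sup>2 + X\<^sup>2 T\<^sup>2 + X\<^sup>2 U\<^sup>2 + X T U + c\<^sup>2 = 0\<close>. It is symmetric in \<open>X\<close>, \<open>T\<close>, \<open>U\<close> and holds
  for the \<open>x\<close>-coordinates of three points \<open>P\<close>, \<open>Q\<close>, \<open>P + Q\<close> of \<open>y\<^sup>2 + x y = x\<^sup>3 + c x\<close> in characteristic two.\<close>

definition height :: "nat \<Rightarrow> 'a::zero poly \<Rightarrow> 'a poly \<Rightarrow> bool" where
  "height d A B \<longleftrightarrow> degree A \<le> d \<and> degree B \<le> d \<and> (coeff A d \<noteq> 0 \<or> coeff B d \<noteq> 0)"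

definition add_rel :: "'a::idom \<Rightarrow> 'a \<Rightarrow> 'a \<Rightarrow> 'a \<Rightarrow> 'a \<Rightarrow> 'a \<Rightarrow> bool" where
  "add_rel X c A B A' B' \<longleftrightarrow>
    (A + X * B) ^ 2 * A' ^ 2 + X * A * B * A' * B' + (X * A + c * B) ^ 2 * B' ^ 2 = 0"

lemma poly_two_eq_0: "(2::'a::comm_ring_1) = 0 \<Longrightarrow> (2::'a poly) = 0"
  by (metis numeral_poly pCons_0_0)

lemma add_rel_sym:
  assumes "(2::'a::idom) = 0" "add_rel X (c::'a) A B A' B'"
  shows "add_rel X c A' B' A B"
proof -
  have "(A' + X * B') ^ 2 * A ^ 2 + X * A' * B' * A * B + (X * A' + c * B') ^ 2 * B ^ 2 =
     ((A + X * B) ^ 2 * A' ^ 2 + X * A * B * A' * B' + (X * A + c * B) ^ 2 * B' ^ 2) +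
     2 * (X * A' * B' * A ^ 2 - X * A * B * A' ^ 2 + X * c * A' * B' * B ^ 2 - X * c * A * B * B' ^ 2)"
    by (simp add: algebra_simps power2_eq_square)
  then show ?thesis
    using assms unfolding add_rel_def by simp
qed

section \<open>Degrees of the quadratic relation\<close>

lemma coeff_X_mult: "coeff ([:0, 1:] * A) (Suc n) = coeff (A :: 'a::comm_ring_1 poly) n"
  by simp

lemma coeff_mult_top:
  assumes "degree (A::'a::comm_ring_1 poly) \<le> m" "degree B \<le> n"
  shows "coeff (A * B) (m + n) = coeff A m * coeff B n"
proof -
  have "coeff (A * B) (m + n) = (\<Sum>i\<le>m + n. coeff A i * coeff B (m + n - i))"
    by (simp add: coeff_mult)
  also have "\<dots> = (\<Sum>i\<in>{m}. coeff A i * coeff B (m + n - i))"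
  proof (rule sum.mono_neutral_right)
    show "\<forall>i\<in>{..m + n} - {m}. coeff A i * coeff B (m + n - i) = 0"
    proof
      fix i assume i: "i \<in> {..m + n} - {m}"
      then consider "i > m" | "m + n - i > n" by fastforce
      then show "coeff A i * coeff B (m + n - i) = 0"
        using assms by cases (auto simp: coeff_eq_0)
    qed
  qed auto
  finally show ?thesis by simp
qed

text \<open>The three polynomials are the coefficients of the product of the linear forms
  \<open>B * x + A\<close> and \<open>B' * x + A'\<close>. Their coefficients at
  \<open>d + d'\<close> are those of the product of two nonzero linear forms over a domain, so they
  do not all vanish.\<close>

lemma height_pair:
  fixes A B A' B' :: "'a::idom poly"
  assumes "height d A B" "height d' A' B'"
  shows "degree (B * B') \<le> d + d'" "degree (A * B' + A' * B) \<le> d + d'" "degree (A * A') \<le> d + d'"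
    "coeff (B * B') (d + d') \<noteq> 0 \<or> coeff (A * B' + A' * B) (d + d') \<noteq> 0 \<or> coeff (A * A') (d + d') \<noteq> 0"
proof -
  note h = assms[unfolded height_def]
  have le: "degree (p * q) \<le> d + d'" if "degree p \<le> d" "degree q \<le> d'" for p q :: "'a poly"
    using that degree_mult_le[of p q] by linarith
  show "degree (B * B') \<le> d + d'" "degree (A * A') \<le> d + d'" "degree (A * B' + A' * B) \<le> d + d'"
    using h le[of A B'] le[of B A'] by (auto intro!: le degree_add_le simp: mult.commute)
  have "coeff (B * B') (d + d') = coeff B d * coeff B' d'"
    "coeff (A * A') (d + d') = coeff A d * coeff A' d'"
    "coeff (A * B') (d + d') = coeff A d * coeff B' d'"
    "coeff (B * A') (d + d') = coeff B d * coeff A' d'"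
    using h by (intro coeff_mult_top; blast)+
  then show "coeff (B * B') (d + d') \<noteq> 0 \<or> coeff (A * B' + A' * B) (d + d') \<noteq> 0 \<or> coeff (A * A') (d + d') \<noteq> 0"
    using h by (auto simp: mult.commute[of A' B])
qed

text \<open>These are the coefficients of the relation, read as a quadratic in the second fraction.
  At degree \<open>Suc d\<close> the polynomials under the squares have the coefficients
  \<open>coeff B d\<close> and \<open>coeff A d\<close>, one of which is nonzero. So the triple has
  top degree exactly \<open>2 * d + 2\<close>, the source of the constant 2 in the degree
  recurrence.\<close>

lemma height_add_rel_coeffs:
  fixes A B :: "'a::idom poly"
  assumes "height d A B"
  shows "degree ((A + [:0, 1:] * B) ^ 2) \<le> 2 * d + 2" "degree ([:0, 1:] * A * B) \<le> 2 * d + 2"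
    "degree (([:0, 1:] * A + [:a:] * B) ^ 2) \<le> 2 * d + 2"
    "coeff ((A + [:0, 1:] * B) ^ 2) (2 * d + 2) \<noteq> 0 \<or> coeff (([:0, 1:] * A + [:a:] * B) ^ 2) (2 * d + 2) \<noteq> 0"
proof -
  note h = assms[unfolded height_def]
  have X: "degree ([:0, 1:] * p) \<le> Suc d" if "degree p \<le> d" for p :: "'a poly"
    using that degree_mult_le[of "[:0, 1:]" p] by simp
  have c: "degree ([:a:] * p) \<le> d" if "degree p \<le> d" for p :: "'a poly"
    using that degree_mult_le[of "[:a:]" p] by simp
  have 1: "degree (A + [:0, 1:] * B) \<le> Suc d"
    using h X[of B] by (intro degree_add_le) auto
  have 2: "degree ([:0, 1:] * A + [:a:] * B) \<le> Suc d"
    using h X[of A] c[of B] by (intro degree_add_le) auto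
  show "degree ((A + [:0, 1:] * B) ^ 2) \<le> 2 * d + 2" "degree (([:0, 1:] * A + [:a:] * B) ^ 2) \<le> 2 * d + 2"
    using 1 2 degree_power_le[of "A + [:0, 1:] * B" 2] degree_power_le[of "[:0, 1:] * A + [:a:] * B" 2]
    by linarith+
  show "degree ([:0, 1:] * A * B) \<le> 2 * d + 2"
    using h X[of A] degree_mult_le[of "[:0, 1:] * A" B] by linarith
  have "coeff ((A + [:0, 1:] * B) ^ 2) (Suc d + Suc d) = coeff (A + [:0, 1:] * B) (Suc d) ^ 2"
    "coeff (([:0, 1:] * A + [:a:] * B) ^ 2) (Suc d + Suc d) = coeff ([:0, 1:] * A + [:a:] * B) (Suc d) ^ 2"
    using coeff_mult_top[OF 1 1] coeff_mult_top[OF 2 2] by (simp_all only: power2_eq_square)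
  moreover have "coeff A (Suc d) = 0" "coeff B (Suc d) = 0"
    using h by (auto intro!: coeff_eq_0)
  moreover have "2 * d + 2 = Suc d + Suc d"
    by simp
  ultimately show "coeff ((A + [:0, 1:] * B) ^ 2) (2 * d + 2) \<noteq> 0 \<or>
      coeff (([:0, 1:] * A + [:a:] * B) ^ 2) (2 * d + 2) \<noteq> 0"
    using h by (simp only: coeff_add coeff_X_mult) auto
qed

lemma height_exists:
  fixes A B :: "'a::idom poly"
  assumes "bezout A B"
  shows "\<exists>d. height d A B"
proof -
  have nz: "A \<noteq> 0 \<or> B \<noteq> 0"
    using assms by (auto simp: bezout_def)
  have "height (max (degree A) (degree B)) A B"
    using nz leading_coeff_neq_0[of A] leading_coeff_neq_0[of B]
    unfolding height_def max_def by (cases "A = 0"; cases "B = 0"; auto simp del: leading_coeff_0_iff)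
  then show ?thesis ..
qed

lemma bezout_power3:
  assumes "bezout A B"
  shows "bezout (A ^ 3) (B ^ 3)"
proof -
  have "bezout A (B ^ 3)"
    using assms bezout_mult[of A] by (simp add: power3_eq_cube)
  then have "bezout (B ^ 3) A"
    by (simp add: bezout_commute)
  then have "bezout (B ^ 3) (A ^ 3)"
    using bezout_mult[of "B ^ 3"] by (simp add: power3_eq_cube)
  then show ?thesis
    by (simp add: bezout_commute)
qed

text \<open>Vieta: as a quadratic in \<open>A' : B'\<close> the relation has a second root \<open>A'' : B''\<close>.\<close>

lemma add_rel_step:
  fixes A B A' B' :: "'a::field poly"
  assumes two: "(2::'a) = 0" and a: "a \<noteq> 0"
    and bez: "bezout A B" and bez': "bezout A' B'"
    and rel: "add_rel [:0, 1:] [:a:] A B A' B'"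
    and h: "height d A B" and h': "height d' A' B'"
  shows "\<exists>A'' B'' d''. bezout A'' B'' \<and> add_rel [:0, 1:] [:a:] A B A'' B'' \<and> height d'' A'' B'' \<and> d' + d'' = 2 * d + 2"
proof -
  define X c where "X = ([:0, 1:] :: 'a poly)" and "c = [:a:]"
  define P where "P = (A + X * B) ^ 2"
  define Q where "Q = X * A * B"
  define R where "R = (X * A + c * B) ^ 2"
  note two' = poly_two_eq_0[OF two]
  have neg: "- p = p" for p :: "'a poly"
    using two' by (metis add_eq_0_iff mult_2 mult_zero_left)
  have rel': "P * A' ^ 2 + Q * A' * B' + R * B' ^ 2 = 0"
    using rel unfolding add_rel_def P_def Q_def R_def X_def c_def .
  \<comment> \<open>Gauss's lemma by hand: a quadratic with a root given by the coprime pair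
    \<open>(A', B')\<close> is divisible by the linear form \<open>B' * x + A'\<close>, and the
    cofactor is the second root.\<close>
  have "\<exists>A'' B''. B' * B'' = P \<and> A' * B'' + A'' * B' = Q \<and> A' * A'' = R"
  proof -
    have "P * A' ^ 2 + B' * (Q * A' + R * B') = 0"
      using rel' by (simp add: algebra_simps power2_eq_square)
    then have "P * A' ^ 2 = B' * (Q * A' + R * B')"
      by (metis neg add_eq_0_iff)
    then have "B' dvd P"
      by (rule bezout_dvd_mult_cancel[OF bez', OF dvdI])
    then obtain B'' where B'': "P = B' * B''" ..
    have "R * B' ^ 2 + A' * (Q * B' + P * A') = 0"
      using rel' by (simp add: algebra_simps power2_eq_square)
    then have "R * B' ^ 2 = A' * (Q * B' + P * A')"
      by (metis neg add_eq_0_iff)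
    then have "A' dvd R"
      by (rule bezout_dvd_mult_cancel[OF bez'[unfolded bezout_commute[of A']], OF dvdI])
    then obtain A'' where A'': "R = A' * A''" ..
    \<comment> \<open>The middle coefficient comes from cancelling \<open>A' * B'\<close>. If one of
      the two is zero, the other is a unit, and its inverse \<open>v\<close> gives the missing
      component of the second root as \<open>Q * v\<close>.\<close>
    consider "A' = 0" | "B' = 0" | "A' \<noteq> 0" "B' \<noteq> 0" by blast
    then show ?thesis
    proof cases
      case 1
      then obtain v where "v * B' = 1"
        using bez' by (auto simp: bezout_def)
      moreover from this have "R = 0"
        using 1 A'' by simp
      ultimately show ?thesis
        using 1 B'' by (intro exI[of _ "Q * v"] exI[of _ B'']) (simp add: mult.assoc)
    next
      case 2
      then obtain v where "v * A' = 1"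
        using bez' by (auto simp: bezout_def)
      moreover from this have "P = 0"
        using 2 B'' by simp
      ultimately show ?thesis
        using 2 A'' by (intro exI[of _ A''] exI[of _ "Q * v"]) (simp add: mult.left_commute mult.commute)
    next
      case 3
      have "(A' * B') * (A' * B'' + A'' * B' + Q) = 0"
        using rel' unfolding A'' B'' by (simp add: algebra_simps power2_eq_square)
      then have "A' * B'' + A'' * B' + Q = 0"
        using 3 by simp
      then have "A' * B'' + A'' * B' = Q"
        by (metis neg add_eq_0_iff)
      then show ?thesis
        using A'' B'' by metis
    qed
  qed
  then obtain A'' B'' where P: "B' * B'' = P" and Q: "A' * B'' + A'' * B' = Q" and R: "A' * A'' = R"
    by blast
  have rel'': "add_rel [:0, 1:] [:a:] A B A'' B''"
  proof -
    have "P * A'' ^ 2 + Q * A'' * B'' + R * B'' ^ 2 = 2 * (A' * A'' * B'' ^ 2 + A'' ^ 2 * B' * B'')"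
      unfolding P[symmetric] Q[symmetric] R[symmetric] by (simp add: algebra_simps power2_eq_square)
    then show ?thesis
      using two' unfolding add_rel_def P_def Q_def R_def X_def c_def by simp
  qed
  \<comment> \<open>In characteristic two the ideal of \<open>P\<close>, \<open>Q\<close>,
    \<open>R\<close> contains \<open>A ^ 3\<close> and \<open>c ^ 2 * B ^ 3\<close>, so it is the
    unit ideal; all three generators lie in the ideal of \<open>A''\<close> and
    \<open>B''\<close>.\<close>
  have bez'': "bezout A'' B''"
  proof -
    obtain u v where uv: "u * A ^ 3 + v * B ^ 3 = 1"
      using bezout_power3[OF bez] by (auto simp: bezout_def)
    have "A * P + X * B * Q = A ^ 3 + 2 * (X * A ^ 2 * B + X ^ 2 * A * B ^ 2)"
      by (simp add: P_def Q_def algebra_simps power2_eq_square power3_eq_cube)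
    then have A3: "A ^ 3 = A * P + X * B * Q"
      using two' by simp
    have "B * R + X * A * Q = c ^ 2 * B ^ 3 + 2 * (X ^ 2 * A ^ 2 * B + X * c * A * B ^ 2)"
      by (simp add: R_def Q_def algebra_simps power2_eq_square power3_eq_cube)
    then have B3: "c ^ 2 * B ^ 3 = B * R + X * A * Q"
      using two' by simp
    obtain c' where "c' * c = 1"
      using a by (intro that[of "[:inverse a:]"]) (simp add: c_def one_pCons)
    then have ia: "c' ^ 2 * c ^ 2 = 1"
      by (metis power_mult_distrib power_one)
    have "u * (A * P + X * B * Q) + v * c' ^ 2 * (B * R + X * A * Q) = 1"
    proof -
      have "v * c' ^ 2 * (c ^ 2 * B ^ 3) = v * (c' ^ 2 * c ^ 2) * B ^ 3"
        by (simp only: mult.assoc)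
      then show ?thesis
        unfolding A3[symmetric] B3[symmetric] using uv by (simp only: ia mult_1_right)
    qed
    then have "u * (A * (B' * B'') + X * B * (A' * B'' + A'' * B')) +
        v * c' ^ 2 * (B * (A' * A'') + X * A * (A' * B'' + A'' * B')) = 1"
      by (simp only: P Q R)
    moreover have "u * (A * (B' * B'') + X * B * (A' * B'' + A'' * B')) +
        v * c' ^ 2 * (B * (A' * A'') + X * A * (A' * B'' + A'' * B')) =
      (u * X * B * B' + v * c' ^ 2 * (B * A' + X * A * B')) * A'' +
      (u * (A * B' + X * B * A') + v * c' ^ 2 * X * A * A') * B''"
      by (simp add: algebra_simps)
    ultimately show ?thesis
      unfolding bezout_def by metis
  qed
  from height_exists[OF bez''] obtain d'' where h'': "height d'' A'' B''" by blast
  \<comment> \<open>The triple \<open>P\<close>, \<open>Q\<close>, \<open>R\<close> has top degree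
    \<open>d' + d''\<close> as a product of linear forms and \<open>2 * d + 2\<close> by
    construction.\<close>
  note * = height_pair[OF h' h'', unfolded P Q R]
  note ** = height_add_rel_coeffs(1,2)[OF h, folded X_def, folded P_def Q_def]
    height_add_rel_coeffs(3,4)[OF h, of a, folded X_def c_def, folded P_def R_def]
  have "d' + d'' \<le> 2 * d + 2"
    using *(4) **(1-3) by (meson le_degree le_trans)
  moreover have "2 * d + 2 \<le> d' + d''"
    using **(4) *(1-3) by (meson le_degree le_trans)
  ultimately show ?thesis
    using bez'' rel'' h'' by (metis le_antisym)
qed

text \<open>For constant fractions the relation is a quadratic polynomial in \<open>X\<close>, and
  the vanishing of its three coefficients forces one of the pairs to be \<open>(0, 0)\<close>. This
  is what makes the Weil bound strict.\<close>

lemma not_both_constant: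
  fixes a :: "'a::field"
  assumes two: "(2::'a) = 0" and a: "a \<noteq> 0"
    and rel: "add_rel [:0, 1:] [:a:] A B A' B'" and h: "height 0 A B" and h': "height 0 A' B'"
  shows False
proof -
  obtain x y x' y' where [simp]: "A = [:x:]" "B = [:y:]" "A' = [:x':]" "B' = [:y':]"
    using h h' unfolding height_def by (metis degree_eq_zeroE le_zero_eq)
  have nz: "x \<noteq> 0 \<or> y \<noteq> 0" "x' \<noteq> 0 \<or> y' \<noteq> 0"
    using h h' by (auto simp: height_def)
  have "(A + [:0, 1:] * B) ^ 2 * A' ^ 2 + [:0, 1:] * A * B * A' * B' + ([:0, 1:] * A + [:a:] * B) ^ 2 * B' ^ 2 =
      [:(x * x') ^ 2 + (a * y * y') ^ 2, 2 * x * y * x' ^ 2 + x * y * x' * y' + 2 * a * x * y * y' ^ 2,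
        (y * x') ^ 2 + (x * y') ^ 2:]"
    by (simp add: power2_eq_square algebra_simps)
  with rel two have "(x * x') ^ 2 + (a * y * y') ^ 2 = 0" "x * y * x' * y' = 0" "(y * x') ^ 2 + (x * y') ^ 2 = 0"
    by (simp_all add: add_rel_def)
  then show False
    using nz a by (auto simp del: power_mult_distrib)
qed

section \<open>Finite fields of characteristic two\<close>

lemma char2_add_self: "(2::'a::comm_ring_1) = 0 \<Longrightarrow> x + x = (0::'a)"
  by (metis mult_2 mult_zero_left)

lemma char2_minus: "(2::'a::comm_ring_1) = 0 \<Longrightarrow> - x = (x::'a)"
  by (metis char2_add_self add_eq_0_iff)

lemma char2_diff: "(2::'a::comm_ring_1) = 0 \<Longrightarrow> x - y = x + (y::'a)"
  by (metis char2_minus diff_conv_add_uminus)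

lemma char2_add_eq_0_iff: "(2::'a::comm_ring_1) = 0 \<Longrightarrow> x + y = 0 \<longleftrightarrow> x = (y::'a)"
  by (metis char2_minus eq_neg_iff_add_eq_0)

lemma char2_square_add: "(2::'a::comm_ring_1) = 0 \<Longrightarrow> (x + y) ^ 2 = x ^ 2 + (y::'a) ^ 2"
  by (simp add: power2_sum)

lemma char2_power_add:
  assumes "(2::'a::comm_ring_1) = 0"
  shows "(x + y :: 'a) ^ (2 ^ i) = x ^ (2 ^ i) + y ^ (2 ^ i)"
  by (induction i) (simp_all add: power_mult mult.commute[of 2] char2_square_add[OF assms])

lemma char2_square_sum:
  assumes "(2::'a::comm_ring_1) = 0"
  shows "(sum f S :: 'a) ^ 2 = (\<Sum>i\<in>S. f i ^ 2)"
  by (induction S rule: infinite_finite_induct) (simp_all add: char2_square_add[OF assms])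

section \<open>Powers and factorization into linear factors over a finite field\<close>

lemma finite_field_power_card_minus_1:
  fixes c :: "'a::{field,finite}"
  assumes "c \<noteq> 0"
  shows "c ^ (card (UNIV :: 'a set) - 1) = 1"
proof -
  let ?S = "UNIV - {0::'a}"
  have "(\<Prod>x\<in>?S. x) = (\<Prod>x\<in>?S. c * x)"
    by (rule prod.reindex_bij_witness[of _ "\<lambda>x. c * x" "\<lambda>x. x / c"]) (use assms in auto)
  also have "\<dots> = c ^ card ?S * (\<Prod>x\<in>?S. x)"
    by (simp add: prod.distrib)
  finally show ?thesis
    by (simp add: card_Diff_singleton)
qed

lemma finite_field_power_card: "(c::'a::{field,finite}) ^ card (UNIV :: 'a set) = c"
proof (cases "c = 0")
  case False
  have "c ^ card (UNIV :: 'a set) = c * c ^ (card (UNIV :: 'a set) - 1)"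
    by (metis finite_UNIV_card_ge_0 finite power_eq_if neq0_conv)
  with finite_field_power_card_minus_1[OF False] show ?thesis by simp
qed (simp add: finite_UNIV_card_ge_0)

text \<open>Translation by 1 permutes the ring, so adding \<open>card UNIV\<close> ones does not
  change the sum of all elements. For a field with \<open>2 ^ r\<close> elements this yields
  characteristic two.\<close>

lemma of_nat_card_UNIV_eq_0: "(of_nat (card (UNIV :: 'a::{ring_1,finite} set)) :: 'a) = 0"
proof -
  have "(\<Sum>x\<in>(UNIV::'a set). x) = (\<Sum>x\<in>UNIV. x + 1)"
    by (rule sum.reindex_bij_witness[of _ "\<lambda>x. x + 1" "\<lambda>x. x - 1"]) auto
  then show ?thesis
    by (simp add: sum.distrib)
qed

lemma prod_linear_dvd:
  fixes p :: "'a::field poly"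
  assumes "finite S" "\<And>c. c \<in> S \<Longrightarrow> poly p c = 0"
  shows "(\<Prod>c\<in>S. [:-c, 1:]) dvd p"
  using assms
proof (induction S)
  case (insert c S)
  then obtain k where k: "p = (\<Prod>c\<in>S. [:-c, 1:]) * k"
    by (metis dvdE insertCI)
  have "poly p c = 0"
    using insert by blast
  then have "poly k c = 0"
    using insert by (auto simp: k poly_prod)
  then have "[:-c, 1:] dvd k"
    by (simp add: poly_eq_0_iff_dvd)
  then show ?case
    using insert.hyps unfolding k by (simp add: mult.commute[of "[:-c, 1:]"] mult_dvd_mono del: mult_pCons_left mult_pCons_right)
qed simp

lemma degree_prod_linear: "degree (\<Prod>c\<in>S. [:-c, 1:] :: 'a::field poly) = card S"
  by (cases "finite S") (simp_all add: degree_prod_eq_sum_degree)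

text \<open>Both sides are monic of the same degree, and the left one divides the right one since
  every nonzero element is a root.\<close>

lemma prod_linear_nonzero_finite_field:
  "(\<Prod>c\<in>UNIV - {0}. [:-c, 1:]) = [:0, 1:] ^ (card (UNIV :: 'a set) - 1) - (1 :: 'a::{field,finite} poly)"
    (is "?P = ?M")
proof -
  define m where "m = card (UNIV :: 'a set) - 1"
  have "card (UNIV :: 'a set) \<ge> card {0, 1 :: 'a}"
    by (intro card_mono) auto
  then have m: "m > 0"
    by (simp add: m_def)
  have M: "?M = monom 1 m + [:-1:]"
    by (simp add: m_def monom_altdef one_pCons)
  have deg: "degree ?M = m"
    unfolding M using m by (subst degree_add_eq_left) (simp_all add: degree_monom_eq)
  have lc: "lead_coeff ?M = 1"
    unfolding deg unfolding M using m by (cases m) simp_all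
  have "?P dvd ?M"
    by (intro prod_linear_dvd) (auto simp: finite_field_power_card_minus_1 simp del: One_nat_def)
  then obtain k where k: "?M = ?P * k" ..
  have degP: "degree ?P = m"
    by (simp add: degree_prod_linear m_def card_Diff_singleton)
  have "?M \<noteq> 0"
    using lc by force
  then have "degree k = 0"
    using k deg degP degree_mult_eq[of ?P k] by (metis add_cancel_left_right mult_eq_0_iff)
  then obtain c where c: "k = [:c:]"
    by (rule degree_eq_zeroE)
  have "lead_coeff ?P = 1"
    by (simp add: lead_coeff_prod)
  then have "c = 1"
    using lc unfolding k lead_coeff_mult c by simp
  then show ?thesis
    using k c by simp
qed

text \<open>The \<open>itself\<close> parameter ties the locale to one field type, so that facts
  mentioning only \<open>q\<close> and \<open>r\<close>, and numbers such as orders of matrix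
  groups, refer to that type.\<close>

locale binary_field =
  fixes q r :: nat and field :: "'a::{field,finite} itself"
  assumes q_def: "q = 2 ^ r" and card_UNIV: "card (UNIV :: 'a set) = q"
begin

lemma q_ge_2: "q \<ge> 2"
proof -
  have "card (UNIV :: 'a set) \<ge> card {0, 1 :: 'a}"
    by (intro card_mono) auto
  then show ?thesis
    by (simp add: card_UNIV)
qed

lemma r_pos: "r > 0"
  using q_ge_2 q_def by (cases r) auto

lemma two: "(2 :: 'a) = 0"
proof -
  have "(2 :: 'a) ^ r = 0"
    using of_nat_card_UNIV_eq_0[where 'a = 'a] by (simp add: card_UNIV q_def)
  then show ?thesis
    by simp
qed

lemmas add_self [simp] = char2_add_self[OF two]
  and uminus_eq = char2_minus[OF two]
  and diff_eq = char2_diff[OF two]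
  and add_eq_0 = char2_add_eq_0_iff[OF two]
  and square_add = char2_square_add[OF two]

lemma power_q [simp]: "(x :: 'a) ^ q = x"
  using finite_field_power_card[of x] by (simp add: card_UNIV)

lemma power_q_minus_1: "(x :: 'a) \<noteq> 0 \<Longrightarrow> x ^ (q - 1) = 1"
  using finite_field_power_card_minus_1[of x] by (simp add: card_UNIV)

lemma square_inj: "(x :: 'a) ^ 2 = y ^ 2 \<Longrightarrow> x = y"
  by (metis square_add add_eq_0 zero_eq_power2)

lemma bij_square: "bij (\<lambda>x :: 'a. x ^ 2)"
  by (simp add: bij_betw_def finite_UNIV_inj_surj injI square_inj)

lemma tr_add: "tr r (x + y) = tr r x + tr r (y :: 'a)"
  by (simp add: tr_def char2_power_add[OF two] sum.distrib)

lemma tr_square_sum: "tr r x ^ 2 = tr r (x ^ 2 :: 'a)"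
  by (simp add: tr_def char2_square_sum[OF two] power_mult[symmetric] mult.commute)

text \<open>Squaring shifts the summands by one place and \<open>x ^ q = x\<close> closes the
  cycle.\<close>

lemma tr_square: "tr r (x ^ 2 :: 'a) = tr r x"
proof -
  have "tr r (x ^ 2) = (\<Sum>i<r. x ^ 2 ^ Suc i)"
    by (simp add: tr_def power_mult[symmetric])
  also have "x + \<dots> = (\<Sum>i<Suc r. x ^ 2 ^ i)"
    by (subst sum.lessThan_Suc_shift) simp
  also have "\<dots> = tr r x + x ^ q"
    by (simp add: tr_def q_def)
  finally show ?thesis
    by (simp add: add.commute)
qed

lemma tr_cases: "tr r (x :: 'a) = 0 \<or> tr r x = 1"
proof -
  have "tr r x ^ 2 = tr r x"
    by (simp add: tr_square_sum tr_square)
  then show ?thesis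
    by (simp add: power2_eq_square)
qed

lemma tr_0 [simp]: "tr r (0 :: 'a) = 0"
  by (simp add: tr_def power_0_left)

end

section \<open>The Weil bound for Kloosterman sums\<close>

text \<open>The heights start with the values of \<open>f\<close> and obey its recurrence, so each
  \<open>f n\<close> is a degree. The relation is symmetric, so each new fraction can take over as
  the one supplying the coefficients. \<open>f\<close> and the start are left abstract because the
  walk is made in both directions.\<close>

lemma add_rel_heights:
  fixes a :: "'a::field" and f :: "int \<Rightarrow> int"
  assumes two: "(2::'a) = 0" and a: "a \<noteq> 0"
    and bez: "bezout A0 B0" "bezout A1 B1" and rel: "add_rel [:0, 1:] [:a:] A1 B1 A0 B0"
    and h: "height d0 A0 B0" "height d1 A1 B1" and f: "f 0 = int d0" "f 1 = int d1"
    and rec: "\<And>n. f (n + 1) + f (n - 1) = 2 * f n + 2"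
  shows "f (int n) \<ge> 0 \<and> \<not> (f (int n) = 0 \<and> f (int n + 1) = 0)"
proof -
  have "\<exists>A' B' A B d' d. bezout A' B' \<and> bezout A B \<and> add_rel [:0, 1:] [:a:] A B A' B' \<and>
      height d' A' B' \<and> height d A B \<and> f (int n) = int d' \<and> f (int n + 1) = int d"
  proof (induction n)
    case 0
    show ?case
      using bez rel h f by auto
  next
    case (Suc n)
    then obtain A' B' A B d' d where *: "bezout A' B'" "bezout A B" "add_rel [:0, 1:] [:a:] A B A' B'"
      "height d' A' B'" "height d A B" "f (int n) = int d'" "f (int n + 1) = int d"
      by blast
    obtain A'' B'' d'' where **: "bezout A'' B''" "add_rel [:0, 1:] [:a:] A B A'' B''" "height d'' A'' B''"
      "d' + d'' = 2 * d + 2"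
      using add_rel_step[OF two a *(2,1,3,5,4)] by blast
    have "f (int (Suc n) + 1) = int d''"
      using rec[of "int n + 1"] *(6,7) **(4) by (simp add: add.commute)
    moreover have "f (int (Suc n)) = int d"
      using *(7) by (simp add: add.commute)
    ultimately show ?case
      using *(2,5) ** add_rel_sym[OF poly_two_eq_0[OF two] **(2)] by metis
  qed
  then obtain A' B' A B d' d where *: "add_rel [:0, 1:] [:a:] A B A' B'"
      "height d' A' B'" "height d A B" "f (int n) = int d'" "f (int n + 1) = int d"
    by blast
  then show ?thesis
    using not_both_constant[OF two a *(1)] by (cases "d = 0"; cases "d' = 0") auto
qed

text \<open>For \<open>k = 2 * e + 1\<close> the integers \<open>- e\<close> and
  \<open>- e - 1\<close> lie symmetrically about the vertex. They share the value
  \<open>q - e ^ 2 - e\<close>, which therefore cannot be zero, and four times it is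
  \<open>4 * q - k ^ 2 + 1\<close>.\<close>

lemma quadratic_bound:
  fixes k q :: int
  assumes nonneg: "\<And>n. n ^ 2 + k * n + q \<ge> 0"
    and not_both: "\<And>n. \<not> (n ^ 2 + k * n + q = 0 \<and> (n + 1) ^ 2 + k * (n + 1) + q = 0)"
    and odd: "odd k"
  shows "k ^ 2 < 4 * q"
proof -
  obtain e where e: "k = 2 * e + 1"
    using odd by (elim oddE)
  have "(- e) ^ 2 + k * (- e) + q = q - e ^ 2 - e" "(- e - 1) ^ 2 + k * (- e - 1) + q = q - e ^ 2 - e"
    by (simp_all add: e power2_eq_square algebra_simps)
  then have "q - e ^ 2 - e > 0"
    using nonneg[of "- e"] not_both[of "- e - 1"] by simp
  then show ?thesis
    by (simp add: e power2_eq_square algebra_simps)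
qed

lemma even_card_involution:
  assumes "finite S" "\<And>x. x \<in> S \<Longrightarrow> f x \<in> S" "\<And>x. x \<in> S \<Longrightarrow> f (f x) = x" "\<And>x. x \<in> S \<Longrightarrow> f x \<noteq> x"
  shows "even (card S)"
  using assms
proof (induction "card S" arbitrary: S rule: less_induct)
  case (less S)
  show ?case
  proof (cases "S = {}")
    case False
    then obtain x where x: "x \<in> S" by blast
    let ?T = "S - {x, f x}"
    have card: "card S = card ?T + 2"
    proof -
      have "card {x, f x} = 2" "{x, f x} \<subseteq> S"
        using x less.prems(2) less.prems(4)[OF x] by (auto simp: card_insert_if)
      then show ?thesis
        using less.prems(1) card_mono[of S "{x, f x}"] by (simp add: card_Diff_subset)
    qed
    have "even (card ?T)"
    proof (rule less.hyps)
      show "card ?T < card S"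
        by (simp add: card)
      show "f y \<in> ?T" if "y \<in> ?T" for y
        using that x less.prems(2,3) by (metis Diff_iff insert_iff singletonD insertCI)
    qed (use less.prems in auto)
    then show ?thesis
      by (simp add: card)
  qed simp
qed

section \<open>The Kloosterman sum and the curve\<close>

context binary_field
begin

text \<open>The nonzero abscissas over which \<open>y ^ 2 + x * y = x ^ 3 + a * x\<close> has no
  point with coordinates in the field.\<close>

definition odd_points :: "'a \<Rightarrow> 'a set" where
  "odd_points a = {c. c \<noteq> 0 \<and> tr r (c + a * inverse c) \<noteq> 0}"

lemma kloosterman_odd_points: "kloosterman r a = int q - 1 - 2 * int (card (odd_points a))"
proof -
  let ?S = "UNIV - {0 :: 'a}"
  have O: "odd_points a \<subseteq> ?S"
    by (auto simp: odd_points_def)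
  have "kloosterman r a = (\<Sum>c\<in>?S. 1 - 2 * (if c \<in> odd_points a then 1 else 0))"
    unfolding kloosterman_def by (rule sum.cong) (auto simp: odd_points_def add_char_def)
  also have "\<dots> = int (card ?S) - 2 * (\<Sum>c\<in>?S. if c \<in> odd_points a then 1 else 0)"
    by (simp add: sum_subtractf sum_distrib_left)
  also have "(\<Sum>c\<in>?S. if c \<in> odd_points a then 1 else 0) = int (card (odd_points a))"
    using O by (simp add: sum.If_cases Int_absorb1)
  also have "int (card ?S) = int q - 1"
    using q_ge_2 by (simp add: card_Diff_singleton card_UNIV)
  finally show ?thesis .
qed

lemma odd_kloosterman: "odd (kloosterman r (a :: 'a))"
  using r_pos by (simp add: kloosterman_odd_points q_def)

text \<open>\<open>s\<close> is the formal trace of \<open>X + a / X\<close>, multiplied by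
  \<open>y = X ^ (q - 1)\<close> to clear denominators. The formal trace \<open>T = s / y\<close>
  satisfies \<open>T ^ 2 + T = X ^ q + a / X ^ q + X + a / X\<close> by telescoping; multiplied by
  \<open>X * y ^ 2\<close> this is the displayed equation.\<close>

lemma tr_poly:
  fixes a :: 'a
  defines "y \<equiv> [:0, 1:] ^ (q - 1)"
  obtains s where "degree s \<le> q - 1 + q div 2"
    "[:0, 1:] * (s ^ 2 + y * s) = y * (y + 1) * ([:0, 1:] ^ 2 * y + [:a:])"
    "\<And>c. c \<noteq> 0 \<Longrightarrow> poly s c = tr r (c + a * inverse c)"
proof
  define X where "X = ([:0, 1:] :: 'a poly)"
  define s where "s = (\<Sum>i<r. X ^ (q - 1 + 2 ^ i) + [:a:] ^ (2 ^ i) * X ^ (q - 1 - 2 ^ i))"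
  note two' = poly_two_eq_0[OF two]
  have pow_le: "2 ^ i \<le> q div 2" if "i < r" for i
  proof -
    have "q div 2 = 2 ^ (r - 1)"
      using r_pos by (cases r) (simp_all add: q_def)
    then show ?thesis
      using that by (simp add: power_increasing)
  qed
  have degX: "degree (X ^ n) = n" for n
    by (simp add: X_def degree_linear_power)
  have "degree (X ^ (q - 1 + 2 ^ i) + [:a:] ^ (2 ^ i) * X ^ (q - 1 - 2 ^ i)) \<le> q - 1 + q div 2" if "i < r" for i
  proof (rule degree_add_le)
    show "degree (X ^ (q - 1 + 2 ^ i)) \<le> q - 1 + q div 2"
      using pow_le[OF that] by (simp only: degX)
    have "degree ([:a:] ^ (2 ^ i) * X ^ (q - 1 - 2 ^ i)) \<le> degree ([:a:] ^ (2 ^ i)) + degree (X ^ (q - 1 - 2 ^ i))"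
      by (rule degree_mult_le)
    also have "degree ([:a:] ^ (2 ^ i)) = 0"
      using degree_power_le[of "[:a:]" "2 ^ i"] by simp
    finally show "degree ([:a:] ^ (2 ^ i) * X ^ (q - 1 - 2 ^ i)) \<le> q - 1 + q div 2"
      by (simp only: degX)
  qed
  then show "degree s \<le> q - 1 + q div 2"
    unfolding s_def by (intro degree_sum_le) auto
  show "poly s c = tr r (c + a * inverse c)" if "c \<noteq> 0" for c
  proof -
    have "poly s c = (\<Sum>i<r. c ^ 2 ^ i + a ^ 2 ^ i * inverse c ^ 2 ^ i)"
      unfolding s_def poly_sum
    proof (rule sum.cong)
      fix i assume "i \<in> {..<r}"
      then have "2 ^ i \<le> q - 1"
        using pow_le[of i] q_ge_2 by simp
      then have "c ^ (q - 1 - 2 ^ i) * c ^ 2 ^ i = 1"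
        using power_q_minus_1[OF that] by (simp only: power_add[symmetric] le_add_diff_inverse2)
      then have "c ^ (q - 1 - 2 ^ i) = inverse c ^ 2 ^ i"
        using that by (simp add: field_simps)
      then show "poly (X ^ (q - 1 + 2 ^ i) + [:a:] ^ (2 ^ i) * X ^ (q - 1 - 2 ^ i)) c =
          c ^ 2 ^ i + a ^ 2 ^ i * inverse c ^ 2 ^ i"
        using that by (simp add: X_def power_add power_q_minus_1 del: One_nat_def)
    qed simp
    also have "\<dots> = tr r (c + a * inverse c)"
      by (simp add: tr_def char2_power_add[OF two] power_mult_distrib)
    finally show ?thesis .
  qed
  \<comment> \<open>The \<open>i\<close>-th summand of \<open>y * s\<close>; the square of the
    \<open>i\<close>-th summand of \<open>s\<close> is \<open>t (Suc i)\<close>, so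
    \<open>s ^ 2 + y * s\<close> telescopes.\<close>
  define t where "t i = X ^ (2 * q - 2 + 2 ^ i) + [:a:] ^ (2 ^ i) * X ^ (2 * q - 2 - 2 ^ i)" for i :: nat
  have "s ^ 2 = (\<Sum>i<r. t (Suc i))"
    unfolding s_def char2_square_sum[OF two']
  proof (rule sum.cong)
    fix i assume "i \<in> {..<r}"
    then have "2 ^ i \<le> q - 1"
      using pow_le[of i] q_ge_2 by simp
    then have "(q - 1 + 2 ^ i) * 2 = 2 * q - 2 + 2 ^ Suc i" "(q - 1 - 2 ^ i) * 2 = 2 * q - 2 - 2 ^ Suc i"
      using q_ge_2 by simp_all
    then show "(X ^ (q - 1 + 2 ^ i) + [:a:] ^ (2 ^ i) * X ^ (q - 1 - 2 ^ i)) ^ 2 = t (Suc i)"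
      by (simp only: char2_square_add[OF two'] power_mult_distrib power_mult[symmetric] t_def power_Suc2)
  qed simp
  moreover have "y * s = (\<Sum>i<r. t i)"
    unfolding s_def sum_distrib_left
  proof (rule sum.cong)
    fix i assume "i \<in> {..<r}"
    then have "2 ^ i \<le> q - 1"
      using pow_le[of i] q_ge_2 by simp
    then have "(q - 1) + (q - 1 + 2 ^ i) = 2 * q - 2 + 2 ^ i" "(q - 1) + (q - 1 - 2 ^ i) = 2 * q - 2 - 2 ^ i"
      using q_ge_2 by simp_all
    then show "y * (X ^ (q - 1 + 2 ^ i) + [:a:] ^ (2 ^ i) * X ^ (q - 1 - 2 ^ i)) = t i"
      by (simp only: y_def X_def[symmetric] distrib_left mult.left_commute[of _ "[:a:] ^ _"] power_add[symmetric] t_def)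
  qed simp
  ultimately have "s ^ 2 + y * s = (\<Sum>i<r. t (Suc i) + t i)"
    by (simp add: sum.distrib)
  also have "\<dots> = (\<Sum>i<r. t (Suc i) - t i)"
    by (simp only: char2_diff[OF two'])
  also have "\<dots> = t r - t 0"
    by (rule sum_lessThan_telescope)
  also have "\<dots> = t r + t 0"
    by (simp only: char2_diff[OF two'])
  also have "[:0, 1:] * \<dots> = y * (y + 1) * ([:0, 1:] ^ 2 * y + [:a:])"
  proof -
    have aq: "[:a:] ^ q = [:a:]"
      by (metis power_q poly_const_pow)
    have tr: "t r = X ^ (2 * q - 2 + q) + [:a:] * X ^ (2 * q - 2 - q)"
      by (simp only: t_def q_def[symmetric] aq)
    have t0: "t 0 = X ^ (2 * q - 2 + 1) + [:a:] * X ^ (2 * q - 2 - 1)"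
      by (simp add: t_def)
    have e: "Suc (2 * q - 2 + q) = (q - 1) + (q - 1) + (q - 1) + 2" "Suc (2 * q - 2 - q) = q - 1"
      "Suc (2 * q - 2 + 1) = (q - 1) + (q - 1) + 2" "Suc (2 * q - 2 - 1) = (q - 1) + (q - 1)"
      using q_ge_2 by simp_all
    have "X * (t r + t 0) = X ^ Suc (2 * q - 2 + q) + [:a:] * X ^ Suc (2 * q - 2 - q) +
        (X ^ Suc (2 * q - 2 + 1) + [:a:] * X ^ Suc (2 * q - 2 - 1))"
      by (simp only: tr t0 distrib_left power_Suc mult.left_commute[of X "[:a:]"])
    also have "\<dots> = y * y * y * X ^ 2 + [:a:] * y + (y * y * X ^ 2 + [:a:] * (y * y))"
      by (simp only: e power_add y_def X_def[symmetric])
    also have "\<dots> = y * (y + 1) * (X ^ 2 * y + [:a:])"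
      by (simp only: distrib_left distrib_right mult_1_left mult_1_right ac_simps)
    finally show ?thesis
      by (simp only: X_def)
  qed
  finally show "[:0, 1:] * (s ^ 2 + y * s) = y * (y + 1) * ([:0, 1:] ^ 2 * y + [:a:])" .
qed


text \<open>This is the sum of the generic point and its Frobenius image. Write the generic point as
  \<open>(X, X * w)\<close> with \<open>w ^ 2 + w = X + a / X\<close>. Frobenius sends
  \<open>w\<close> to \<open>w + s / y\<close>, so the chord has slope
  \<open>l = w + s / (y + 1)\<close>, and the abscissa \<open>l ^ 2 + l + X + X ^ q\<close> of the
  sum no longer involves \<open>w\<close>.\<close>

lemma first_point:
  fixes a :: 'a
  assumes a: "a \<noteq> 0"
  defines "h \<equiv> card (odd_points a)"
  obtains A B where "bezout A B" "height (2 * h + 2) A B" "add_rel [:0, 1:] [:a:] A B ([:0, 1:] ^ q) 1"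
proof -
  define X where "X = ([:0, 1:] :: 'a poly)"
  define y where "y = X ^ (q - 1)"
  define k where "k = X ^ 2 * y + [:a:]"
  note two' = poly_two_eq_0[OF two]
  obtain s where degs: "degree s \<le> q - 1 + q div 2" and s: "X * (s ^ 2 + y * s) = y * (y + 1) * k"
    and ev: "\<And>c. c \<noteq> 0 \<Longrightarrow> poly s c = tr r (c + a * inverse c)"
    using tr_poly[of a] unfolding X_def y_def k_def by blast
  define Z where "Z = {c :: 'a. c \<noteq> 0 \<and> tr r (c + a * inverse c) = 0}"
  define G where "G = (\<Prod>c\<in>Z. [:-c, 1:])"
  define H where "H = (\<Prod>c\<in>odd_points a. [:-c, 1:])"
  have Un: "UNIV - {0} = Z \<union> odd_points a" and disj: "Z \<inter> odd_points a = {}"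
    by (auto simp: Z_def odd_points_def)
  have M: "y + 1 = G * H"
  proof -
    have "G * H = (\<Prod>c\<in>UNIV - {0}. [:-c, 1:])"
      unfolding G_def H_def Un by (rule prod.union_disjoint[symmetric]) (use disj in auto)
    also have "\<dots> = y - 1"
      by (simp only: prod_linear_nonzero_finite_field card_UNIV y_def X_def)
    finally show ?thesis
      by (simp only: char2_diff[OF two'])
  qed
  have nz: "G \<noteq> 0" "H \<noteq> 0" "X \<noteq> 0"
    by (auto simp: G_def H_def X_def)
  \<comment> \<open>The values of \<open>s\<close> at nonzero points are traces: zero at the roots
    of \<open>G\<close>, nonzero at those of \<open>H\<close>. So \<open>G\<close> is the factor to
    cancel from \<open>s / (y + 1)\<close>.\<close>
  have "G dvd s"
    unfolding G_def by (rule prod_linear_dvd) (auto simp: Z_def ev)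
  then obtain s' where s': "s = G * s'" ..
  \<comment> \<open>\<open>A / B\<close> is \<open>X ^ q + a / X + (s' / H) ^ 2 + s' / H\<close>,
    where \<open>k / X\<close> contributes the first two terms and \<open>s' / H\<close> is the
    reduced form of \<open>s / (y + 1)\<close>.\<close>
  define A where "A = k * H ^ 2 + X * s' ^ 2 + X * s' * H"
  define B where "B = X * H ^ 2"
  \<comment> \<open>Leading terms cancel in the definition of \<open>A\<close>, which hides its
    degree. After multiplication by \<open>G\<close> the equation for \<open>s\<close> makes the
    expression linear in \<open>s'\<close>, and the degree can be read off.\<close>
  have GA: "G * A = k * H + X * s'"
  proof -
    have "G * (G * A) = (G * H) ^ 2 * k + X * (s ^ 2 + (G * H) * s)"
      by (simp add: A_def s' algebra_simps power2_eq_square)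
    also have "\<dots> = (y + 1) ^ 2 * k + X * (s ^ 2 + y * s) + X * s"
      unfolding M[symmetric] by (simp add: distrib_left distrib_right ac_simps)
    also have "\<dots> = (y + 1) * (y + 1 + y) * k + X * s"
      unfolding s by (simp add: algebra_simps power2_eq_square)
    also have "y + 1 + y = 1"
      using char2_add_self[OF two', of y] by (metis add.assoc add.commute add_0)
    also have "(y + 1) * 1 * k + X * s = G * (k * H + X * s')"
      unfolding M by (simp add: s' algebra_simps)
    finally show ?thesis
      using nz by simp
  qed
  \<comment> \<open>The wanted relation up to the factor \<open>X ^ 2 * H ^ 2\<close>. It is checked
    after multiplication by \<open>G ^ 2\<close>, since \<open>G ^ 2 * A\<close> is linear in
    \<open>s\<close>.\<close>
  have quad: "G ^ 2 * A ^ 2 + X * y * A = k ^ 2 * H ^ 2"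
  proof -
    have GGA: "G ^ 2 * A = k * (y + 1) + X * s"
      unfolding M using arg_cong[OF GA, of "(*) G"] by (simp add: s' algebra_simps power2_eq_square)
    have "G ^ 2 * (G ^ 2 * A ^ 2 + X * y * A) = (G ^ 2 * A) ^ 2 + X * y * (G ^ 2 * A)"
      by (simp add: algebra_simps power2_eq_square)
    also have "\<dots> = (k * (y + 1)) ^ 2 + (X * s) ^ 2 + X * y * (k * (y + 1) + X * s)"
      unfolding GGA char2_square_add[OF two'] ..
    also have "\<dots> = (k * (y + 1)) ^ 2 + (X * (X * (s ^ 2 + y * s)) + X * (y * (y + 1) * k))"
      by (simp add: algebra_simps power2_eq_square)
    also have "\<dots> = (k * (y + 1)) ^ 2"
      unfolding s char2_add_self[OF two'] by simp
    also have "\<dots> = G ^ 2 * (k ^ 2 * H ^ 2)"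
      unfolding M by (simp add: algebra_simps power2_eq_square)
    finally show ?thesis
      using nz by simp
  qed
  have Xq: "X ^ q = X * y"
    unfolding y_def using q_ge_2 by (simp flip: power_Suc)
  have rel: "add_rel X [:a:] (X ^ q) 1 A B"
  proof -
    have 1: "X ^ q + X * 1 = X * (G * H)"
      unfolding M[symmetric] Xq by (simp add: algebra_simps)
    have 2: "X * X ^ q + [:a:] * 1 = k"
      unfolding Xq k_def by (simp add: power2_eq_square)
    have "(X * (G * H)) ^ 2 * A ^ 2 + X * X ^ q * 1 * A * B + k ^ 2 * B ^ 2 =
        X ^ 2 * H ^ 2 * (G ^ 2 * A ^ 2 + X * y * A + k ^ 2 * H ^ 2)"
      unfolding Xq B_def by (simp add: algebra_simps power2_eq_square)
    also have "\<dots> = 0"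
      unfolding quad char2_add_self[OF two'] by simp
    finally show ?thesis
      unfolding add_rel_def 1 2 .
  qed
  have yX: "poly y 0 = 0"
    using q_ge_2 by (simp add: y_def X_def power_0_left)
  \<comment> \<open>The roots of \<open>B\<close> are 0 and the odd points; there \<open>A\<close>
    has the nonzero values \<open>a * poly H 0 ^ 2\<close> and
    \<open>c * poly s' c ^ 2\<close>.\<close>
  have "bezout A X"
  proof -
    have "poly A 0 = a * poly H 0 ^ 2"
      by (simp add: A_def k_def yX X_def)
    moreover have "poly H 0 \<noteq> 0"
      by (simp add: H_def poly_prod odd_points_def)
    ultimately show ?thesis
      using bezout_linear[of A 0] a by (simp add: X_def)
  qed
  moreover have "bezout A H"
    unfolding H_def
  proof (intro bezout_prod bezout_linear)
    fix c assume c: "c \<in> odd_points a"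
    then have "poly H c = 0"
      by (auto simp: H_def poly_prod intro!: bexI[of _ c])
    then have "poly A c = c * poly s' c ^ 2"
      by (simp add: A_def X_def)
    moreover have "poly s c \<noteq> 0"
      using c ev[of c] by (simp add: odd_points_def)
    then have "poly s' c \<noteq> 0"
      by (simp add: s')
    ultimately show "poly A c \<noteq> 0"
      using c by (simp add: odd_points_def)
  qed
  ultimately have bez: "bezout A B"
    unfolding B_def power2_eq_square by (intro bezout_mult)
  have degH: "degree H = h"
    by (simp add: H_def degree_prod_linear h_def)
  have "card (UNIV - {0 :: 'a}) = card Z + h"
    unfolding Un h_def by (rule card_Un_disjoint) (use disj in auto)
  then have degG: "degree G + h + 1 = q"
    using q_ge_2 by (simp add: G_def degree_prod_linear card_Diff_singleton card_UNIV)
  have degk: "degree k = q + 1"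
  proof -
    have "X ^ 2 * y = X ^ (q + 1)"
      unfolding power_add Xq by (simp add: power2_eq_square)
    then have "degree (X ^ 2 * y) = q + 1"
      by (simp only: X_def degree_linear_power)
    then show ?thesis
      unfolding k_def by (subst degree_add_eq_left) auto
  qed
  have "degree (k * H + X * s') = degree (k * H)"
  proof (rule degree_add_eq_left)
    \<comment> \<open>From \<open>degree s \<le> q - 1 + q div 2\<close> and
      \<open>degree G = q - 1 - h\<close> the left side is at most
      \<open>q div 2 + h + 1\<close>.\<close>
    have "degree (X * s') < q + 1 + h"
    proof (cases "s' = 0")
      case False
      then have "degree s = degree G + degree s'" "degree (X * s') = 1 + degree s'"
        using nz False by (simp_all add: s' degree_mult_eq) (simp add: X_def)
      moreover have "q div 2 < q"
        using q_ge_2 by simp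
      ultimately show ?thesis
        using degs degG by linarith
    qed simp
    then show "degree (X * s') < degree (k * H)"
      using degk degH nz by (subst degree_mult_eq) auto
  qed
  also have "\<dots> = q + 1 + h"
    using degk degH nz by (subst degree_mult_eq) auto
  finally have dGA: "degree (G * A) = q + 1 + h"
    unfolding GA .
  then have "A \<noteq> 0"
    by auto
  then have degA: "degree A = 2 * h + 2"
    using dGA nz degG by (simp add: degree_mult_eq)
  have degB: "degree B = 2 * h + 1"
  proof -
    have "degree B = degree X + degree (H ^ 2)"
      unfolding B_def using nz by (intro degree_mult_eq) auto
    then show ?thesis
      using nz degH by (simp add: degree_power_eq X_def)
  qed
  have "height (2 * h + 2) A B"
    using \<open>A \<noteq> 0\<close> degA degB unfolding height_def by (metis leading_coeff_0_iff le_refl add_left_mono one_le_numeral)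
  then show ?thesis
    using that[OF bez] add_rel_sym[OF two' rel] by (simp only: X_def)
qed

theorem kloosterman_bound:
  assumes "(a :: 'a) \<noteq> 0"
  shows "kloosterman r a ^ 2 < 4 * int q"
proof -
  define K where "K = kloosterman r a"
  define h where "h = card (odd_points a)"
  have K: "K = int q - 1 - 2 * int h"
    by (simp add: K_def h_def kloosterman_odd_points)
  obtain A B where AB: "bezout A B" "height (2 * h + 2) A B" "add_rel [:0, 1:] [:a:] A B ([:0, 1:] ^ q) 1"
    using first_point[OF assms] unfolding h_def by blast
  have BA: "add_rel [:0, 1:] [:a:] ([:0, 1:] ^ q) 1 A B"
    by (rule add_rel_sym[OF poly_two_eq_0[OF two] AB(3)])
  have h0: "height q ([:0, 1:] ^ q) (1 :: 'a poly)"
  proof -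
    have "degree ([:0, 1:] ^ q :: 'a poly) = q"
      by (rule degree_linear_power)
    moreover have "coeff ([:0, 1:] ^ q :: 'a poly) q = 1"
      by (rule coeff_linear_power)
    ultimately show ?thesis
      by (simp add: height_def)
  qed
  \<comment> \<open>The quadratic with second difference 2, value \<open>q\<close> at 0 for the
    Frobenius coordinate \<open>X ^ q\<close>, and value \<open>2 * h + 2 = q + 1 - K\<close> at 1
    for the constructed point.\<close>
  define f where "f n = n ^ 2 - K * n + int q" for n
  have f: "f 0 = int q" "f 1 = int (2 * h + 2)"
    by (simp_all add: f_def K)
  have rec: "f (n + 1) + f (n - 1) = 2 * f n + 2" for n
    by (simp add: f_def algebra_simps power2_eq_square)
  have fwd: "f (int n) \<ge> 0 \<and> \<not> (f (int n) = 0 \<and> f (int n + 1) = 0)" for n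
    by (rule add_rel_heights[OF two assms bezout_one AB(1) AB(3) h0 AB(2) f]) (rule rec)
  \<comment> \<open>The walk in the other direction: the two starting fractions are exchanged, and
    the indices \<open>1 - n\<close> cover everything up to 1.\<close>
  have bwd: "f (1 - int n) \<ge> 0 \<and> \<not> (f (1 - int n) = 0 \<and> f (1 - (int n + 1)) = 0)" for n
    by (rule add_rel_heights[OF two assms AB(1) bezout_one BA AB(2) h0, where f = "\<lambda>n. f (1 - n)"])
      (use f rec[of "1 - _"] in \<open>simp_all add: algebra_simps\<close>)
  have "f n \<ge> 0 \<and> \<not> (f n = 0 \<and> f (n + 1) = 0)" for n
  proof (cases "n \<ge> 0")
    case True
    then show ?thesis
      using fwd[of "nat n"] by simp
  next
    case False
    then show ?thesis
      using bwd[of "nat (- n)"] bwd[of "nat (1 - n)"] by (auto simp: algebra_simps)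
  qed
  then have "(- K) ^ 2 < 4 * int q"
    by (intro quadratic_bound) (auto simp: f_def K_def odd_kloosterman)
  then show ?thesis
    by (simp add: K_def)
qed

text \<open>The map sending \<open>c\<close> to \<open>a / c\<close> permutes the odd points. A
  fixed point would have \<open>c + a / c = 0\<close>, whose trace is zero, so their number
  \<open>h\<close> is even; and \<open>4\<close> divides \<open>q\<close> in
  \<open>K = q - 1 - 2 * h\<close>.\<close>

theorem kloosterman_mod_4:
  assumes "(a :: 'a) \<noteq> 0" "q \<ge> 4"
  shows "[kloosterman r a = -1] (mod 4)"
proof -
  have "even (card (odd_points a))"
  proof (rule even_card_involution[where f = "\<lambda>c. a * inverse c"])
    fix c assume c: "c \<in> odd_points a"
    then show "a * inverse c \<in> odd_points a" "a * inverse (a * inverse c) = c"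
      using assms by (auto simp: odd_points_def field_simps)
    show "a * inverse c \<noteq> c"
      using c by (auto simp: odd_points_def)
  qed simp
  then obtain m where m: "card (odd_points a) = 2 * m" ..
  have "4 dvd q"
  proof -
    have "r \<ge> 2"
    proof (rule ccontr)
      assume "\<not> r \<ge> 2"
      then have "r = 0 \<or> r = 1" by auto
      then show False using assms q_def by auto
    qed
    then show ?thesis
      using le_imp_power_dvd[of 2 r 2] by (simp add: q_def)
  qed
  then obtain l where l: "q = 4 * l" ..
  have "kloosterman r a - (-1) = 4 * (int l - int m)"
    by (simp add: kloosterman_odd_points m l)
  then show ?thesis
    unfolding cong_iff_dvd_diff by simp
qed

end

section \<open>Trace counts in dimensions one and two\<close>

context binary_field
begin

section \<open>Artin-Schreier equations\<close>

lemma artin_schreier_fibre: "\<gamma> ^ 2 + \<gamma> = \<delta> ^ 2 + \<delta> \<longleftrightarrow> \<gamma> = \<delta> \<or> \<gamma> = \<delta> + (1 :: 'a)"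
proof -
  have "\<gamma> ^ 2 + \<gamma> = \<delta> ^ 2 + \<delta> \<longleftrightarrow> (\<gamma> ^ 2 + \<gamma>) + (\<delta> ^ 2 + \<delta>) = 0"
    by (rule add_eq_0[symmetric])
  also have "(\<gamma> ^ 2 + \<gamma>) + (\<delta> ^ 2 + \<delta>) = (\<gamma> + \<delta>) ^ 2 + (\<gamma> + \<delta>)"
    by (simp add: square_add ac_simps)
  also have "\<dots> = (\<gamma> + \<delta>) * (\<gamma> + \<delta> + 1)"
    by (simp add: algebra_simps power2_eq_square)
  also have "\<dots> = (\<gamma> + \<delta>) * (\<gamma> + (\<delta> + 1))"
    by (simp add: ac_simps)
  finally show ?thesis
    by (simp only: mult_eq_0_iff add_eq_0)
qed

lemma card_artin_schreier_image: "2 * card (range (\<lambda>\<gamma>. \<gamma> ^ 2 + \<gamma> :: 'a)) = q"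
proof -
  have "card {\<gamma>. \<gamma> ^ 2 + \<gamma> = y} = 2" if y_in: "y \<in> range (\<lambda>\<gamma>. \<gamma> ^ 2 + \<gamma> :: 'a)" for y
  proof -
    obtain \<delta> where y: "y = \<delta> ^ 2 + \<delta>"
      using y_in by auto
    have "{\<gamma>. \<gamma> ^ 2 + \<gamma> = y} = {\<delta>, \<delta> + 1}"
      unfolding y artin_schreier_fibre by blast
    then show ?thesis
      by simp
  qed
  then have "(\<Sum>y\<in>range (\<lambda>\<gamma>. \<gamma> ^ 2 + \<gamma> :: 'a). card {\<gamma> \<in> UNIV. \<gamma> ^ 2 + \<gamma> = y}) =
      2 * card (range (\<lambda>\<gamma>. \<gamma> ^ 2 + \<gamma> :: 'a))"
    by simp
  moreover have "(\<Sum>y\<in>range (\<lambda>\<gamma>. \<gamma> ^ 2 + \<gamma> :: 'a). card {\<gamma> \<in> UNIV. \<gamma> ^ 2 + \<gamma> = y}) = card (UNIV :: 'a set)"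
    unfolding card_eq_sum by (rule sum.group) auto
  ultimately show ?thesis
    by (simp add: card_UNIV)
qed

lemma card_tr_0_le: "card {x :: 'a. tr r x = 0} \<le> 2 ^ (r - 1)"
proof -
  define p where "p = (\<Sum>i<r. monom (1 :: 'a) (2 ^ i))"
  have r: "r = Suc (r - 1)"
    using r_pos by simp
  have p: "p = (\<Sum>i<r - 1. monom (1 :: 'a) (2 ^ i)) + monom 1 (2 ^ (r - 1))"
    unfolding p_def by (subst r) simp
  have "degree (\<Sum>i<r - 1. monom (1 :: 'a) (2 ^ i)) < 2 ^ (r - 1)"
    by (rule degree_sum_less) (auto simp: degree_monom_eq)
  then have deg: "degree p = 2 ^ (r - 1)"
    unfolding p by (subst degree_add_eq_right) (auto simp: degree_monom_eq)
  then have "p \<noteq> 0"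
    by auto
  moreover have "poly p x = tr r x" for x
    by (simp add: p_def poly_sum poly_monom tr_def)
  ultimately show ?thesis
    using card_poly_roots_bound[of p] deg by simp
qed

text \<open>Inclusion is the invariance of the trace under squaring. The image has
  \<open>q / 2\<close> elements because all fibres have two, and the kernel of the trace is no
  larger because the trace is a polynomial of degree \<open>2 ^ (r - 1)\<close>.\<close>

lemma artin_schreier_image: "range (\<lambda>\<gamma>. \<gamma> ^ 2 + \<gamma>) = {x :: 'a. tr r x = 0}"
proof (rule card_seteq)
  show "range (\<lambda>\<gamma>. \<gamma> ^ 2 + \<gamma>) \<subseteq> {x :: 'a. tr r x = 0}"
    by (auto simp: tr_add tr_square)
  have "q = 2 * 2 ^ (r - 1)"
    using r_pos by (cases r) (simp_all add: q_def)
  then show "card {x :: 'a. tr r x = 0} \<le> card (range (\<lambda>\<gamma>. \<gamma> ^ 2 + \<gamma> :: 'a))"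
    using card_artin_schreier_image card_tr_0_le by linarith
qed simp

lemma card_artin_schreier: "int (card {\<gamma> :: 'a. \<gamma> ^ 2 + \<gamma> = \<delta>}) = 1 + add_char r \<delta>"
proof (cases "tr r \<delta> = 0")
  case True
  then obtain \<gamma> where "\<delta> = \<gamma> ^ 2 + \<gamma>"
    using artin_schreier_image by blast
  then have "{x. x ^ 2 + x = \<delta>} = {\<gamma>, \<gamma> + 1}"
    using artin_schreier_fibre by blast
  then show ?thesis
    using True by (simp add: add_char_def)
next
  case False
  then have "{\<gamma>. \<gamma> ^ 2 + \<gamma> = \<delta>} = {}"
    using artin_schreier_image by blast
  then show ?thesis
    using False by (simp add: add_char_def)
qed

section \<open>Character sums and quadratic equations\<close>

lemma add_char_0 [simp]: "add_char r (0 :: 'a) = 1"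
  by (simp add: add_char_def)

lemma add_char_square: "add_char r (x ^ 2 :: 'a) = add_char r x"
  by (simp add: add_char_def tr_square)

lemma sum_add_char: "(\<Sum>x\<in>UNIV. add_char r (x :: 'a)) = 0"
proof -
  have "2 * card {x :: 'a. tr r x = 0} = q"
    using card_artin_schreier_image unfolding artin_schreier_image .
  then have "2 * int (card {x :: 'a. tr r x = 0}) = int q"
    by linarith
  moreover have "(\<Sum>x\<in>UNIV. add_char r (x :: 'a)) = (\<Sum>x\<in>(UNIV::'a set). 2 * (if tr r x = 0 then 1 else 0) - 1)"
    by (rule sum.cong) (auto simp: add_char_def)
  moreover have "\<dots> = 2 * int (card {x :: 'a. tr r x = 0}) - int q"
    by (simp add: sum_subtractf sum_distrib_left[symmetric] card_UNIV flip: sum.inter_filter)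
  ultimately show ?thesis
    by simp
qed

lemma sum_add_char_nonzero: "(\<Sum>x\<in>UNIV - {0 :: 'a}. add_char r x) = -1"
  using sum_add_char by (simp add: sum_diff1)

text \<open>For \<open>t \<noteq> 0\<close> the substitution \<open>x = t * z\<close> leads to an
  Artin-Schreier equation; for \<open>t = 0\<close> squaring is bijective and there is exactly one
  root.\<close>

lemma card_quadratic:
  "int (card {x :: 'a. x ^ 2 + t * x + d = 0}) = 1 + (if t = 0 then 0 else add_char r (d / t ^ 2))"
proof (cases "t = 0")
  case True
  obtain y where y: "d = y ^ 2"
    using bij_square by (metis bij_pointE)
  have "{x. x ^ 2 + t * x + d = 0} = {y}"
    using True y by (auto simp: add_eq_0 dest: square_inj)
  then show ?thesis
    using True by simp
next
  case False
  have "bij_betw (\<lambda>x. t * x) {x. x ^ 2 + x = d / t ^ 2} {x. x ^ 2 + t * x + d = 0}"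
    by (rule bij_betw_byWitness[where f' = "\<lambda>x. x / t"])
      (use False in \<open>auto simp: add_eq_0 field_simps power2_eq_square\<close>)
  then show ?thesis
    using False card_artin_schreier[of "d / t ^ 2"] by (simp add: bij_betw_same_card)
qed

lemma card_plus_inverse:
  "int (card {\<alpha> :: 'a. \<alpha> \<noteq> 0 \<and> \<alpha> + inverse \<alpha> = \<beta>}) = 1 + (if \<beta> = 0 then 0 else add_char r (inverse \<beta>))"
proof -
  have "{\<alpha> :: 'a. \<alpha> \<noteq> 0 \<and> \<alpha> + inverse \<alpha> = \<beta>} = {x. x ^ 2 + \<beta> * x + 1 = 0}"
  proof (rule Collect_cong)
    fix x :: 'a
    show "x \<noteq> 0 \<and> x + inverse x = \<beta> \<longleftrightarrow> x ^ 2 + \<beta> * x + 1 = 0"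
    proof (cases "x = 0")
      case False
      have "x ^ 2 + \<beta> * x + 1 = x * ((x + inverse x) + \<beta>)"
        using False by (simp add: algebra_simps power2_eq_square)
      then show ?thesis
        using False by (simp only: mult_eq_0_iff add_eq_0) simp
    qed simp
  qed
  then show ?thesis
    using card_quadratic[of \<beta> 1] add_char_square[of "inverse \<beta>"] by (simp add: power_inverse divide_inverse)
qed

section \<open>Two by two matrices by trace and determinant\<close>

lemma card_mult_eq: "int (card {(b, c). b * c = (e :: 'a)}) = int q - 1 + (if e = 0 then int q else 0)"
proof (cases "e = 0")
  case True
  have "{(b, c). b * c = e} = {0 :: 'a} \<times> UNIV \<union> (UNIV - {0}) \<times> {0}"
    using True by auto
  moreover have "card ({0 :: 'a} \<times> (UNIV :: 'a set) \<union> (UNIV - {0}) \<times> {0}) = q + (q - 1)"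
    by (subst card_Un_disjoint) (auto simp: card_cartesian_product card_UNIV card_Diff_singleton)
  ultimately show ?thesis
    using True q_ge_2 by simp
next
  case False
  have "bij_betw (\<lambda>b. (b, e / b)) (UNIV - {0 :: 'a}) {(b, c). b * c = e}"
    by (rule bij_betw_byWitness[where f' = fst]) (use False in \<open>auto simp: field_simps\<close>)
  then show ?thesis
    using False q_ge_2 by (simp add: bij_betw_same_card[symmetric] card_UNIV card_Diff_singleton)
qed

text \<open>The triples are the 2 by 2 matrices of trace \<open>t\<close> and determinant
  \<open>d\<close>, with second diagonal entry \<open>t + a\<close>. For each \<open>a\<close> the
  product \<open>b * c\<close> is prescribed; there are \<open>q - 1\<close> solutions, and
  \<open>q\<close> more when \<open>a\<close> is a root of the quadratic.\<close>

lemma card_charpoly: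
  "int (card {(a, b, c). a * (t + a) + b * c = (d :: 'a)}) =
     int q ^ 2 + int q * (if t = 0 then 0 else add_char r (d / t ^ 2))"
proof -
  have "{(a, b, c). a * (t + a) + b * c = d} = (SIGMA a:UNIV. {(b, c). b * c = a ^ 2 + t * a + d})"
    by (auto simp: Sigma_def) (metis add_eq_0 add.assoc add.commute distrib_left mult.commute power2_eq_square)+
  then have "int (card {(a, b, c). a * (t + a) + b * c = d}) =
      (\<Sum>a\<in>UNIV. int (card {(b, c). b * c = a ^ 2 + t * a + d}))"
    by (simp add: card_SigmaI)
  also have "\<dots> = int q * (int q - 1) + int q * int (card {a. a ^ 2 + t * a + d = 0})"
    by (simp add: card_mult_eq sum.distrib card_UNIV flip: sum.inter_filter)
  also have "int (card {a. a ^ 2 + t * a + d = 0}) = 1 + (if t = 0 then 0 else add_char r (d / t ^ 2))"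
    by (rule card_quadratic)
  finally show ?thesis
    by (simp add: right_diff_distrib distrib_left power2_eq_square)
qed

lemma kloosterman_rescaled:
  assumes "(\<beta> :: 'a) \<noteq> 0"
  shows "(\<Sum>d\<in>UNIV - {0}. add_char r ((d + inverse d) / \<beta> ^ 2)) = kloosterman r (inverse \<beta>)"
proof -
  \<comment> \<open>Chosen so that the argument becomes the fourth power of
    \<open>\<alpha> + inverse \<beta> * inverse \<alpha>\<close>, where the character has the same
    value as at the base.\<close>
  define h where "h = (\<lambda>\<alpha>. \<beta> ^ 2 * (\<alpha> ^ 2) ^ 2)"
  have "inj_on h (UNIV - {0})"
  proof (rule inj_onI)
    fix x y assume "h x = h y"
    then have "(x ^ 2) ^ 2 = (y ^ 2) ^ 2"
      using assms by (simp add: h_def)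
    then show "x = y"
      by (rule square_inj[OF square_inj])
  qed
  moreover from this have "h ` (UNIV - {0}) = UNIV - {0}"
    by (intro endo_inj_surj) (use assms in \<open>auto simp: h_def\<close>)
  ultimately have bij: "bij_betw h (UNIV - {0}) (UNIV - {0})"
    by (simp add: bij_betw_def)
  have "(\<Sum>d\<in>UNIV - {0}. add_char r ((d + inverse d) / \<beta> ^ 2)) =
      (\<Sum>\<alpha>\<in>UNIV - {0}. add_char r ((h \<alpha> + inverse (h \<alpha>)) / \<beta> ^ 2))"
    by (rule sum.reindex_bij_betw[OF bij, symmetric])
  also have "\<dots> = (\<Sum>\<alpha>\<in>UNIV - {0}. add_char r (\<alpha> + inverse \<beta> * inverse \<alpha>))"
  proof (rule sum.cong)
    fix \<alpha> :: 'a
    have "(h \<alpha> + inverse (h \<alpha>)) / \<beta> ^ 2 = (\<alpha> ^ 2) ^ 2 + ((inverse \<beta> * inverse \<alpha>) ^ 2) ^ 2"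
      using assms by (cases "\<alpha> = 0") (simp_all add: h_def field_simps power2_eq_square)
    also have "\<dots> = ((\<alpha> + inverse \<beta> * inverse \<alpha>) ^ 2) ^ 2"
      by (simp add: square_add)
    finally show "add_char r ((h \<alpha> + inverse (h \<alpha>)) / \<beta> ^ 2) = add_char r (\<alpha> + inverse \<beta> * inverse \<alpha>)"
      by (simp only: add_char_square)
  qed simp
  finally show ?thesis
    by (simp add: kloosterman_def)
qed

text \<open>The entries of an invertible 2 by 2 matrix \<open>D\<close>. The adjugate has the same
  trace as \<open>D\<close>, so the factor \<open>1 + inverse (a * e + b * c)\<close> turns the
  trace of \<open>D\<close> into that of \<open>D\<close> plus its inverse.\<close>

definition gl2_count :: "'a \<Rightarrow> int" where
  "gl2_count \<beta> = int (card {(a, b, c, e). a * e + b * c \<noteq> 0 \<and> (a + e) * (1 + inverse (a * e + b * c)) = \<beta>})"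

lemma gl2_count_sum:
  "gl2_count \<beta> = (\<Sum>(t, d) | d \<noteq> 0 \<and> t * (1 + inverse d) = \<beta>.
     int q ^ 2 + int q * (if t = 0 then 0 else add_char r (d / t ^ 2)))"
proof -
  let ?S = "{(t, d :: 'a). d \<noteq> 0 \<and> t * (1 + inverse d) = \<beta>}"
  let ?T = "\<lambda>(t, d). {(a, b, c). a * (t + a) + b * c = (d :: 'a)}"
  have [simp]: "x + (x + y) = y" for x y :: 'a
    by (metis add_self add.assoc add_0)
  have "bij_betw (\<lambda>(a, b, c, e). ((a + e, a * e + b * c), (a, b, c)))
      {(a, b, c, e). a * e + b * c \<noteq> 0 \<and> (a + e) * (1 + inverse (a * e + b * c)) = \<beta>} (Sigma ?S ?T)"
    by (rule bij_betw_byWitness[where f' = "\<lambda>((t, d), (a, b, c)). (a, b, c, t + a)"]) (auto simp: ac_simps)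
  then have "gl2_count \<beta> = int (card (Sigma ?S ?T))"
    by (simp add: gl2_count_def bij_betw_same_card)
  also have "\<dots> = (\<Sum>x\<in>?S. int (card (?T x)))"
    by (simp add: card_SigmaI)
  also have "\<dots> = (\<Sum>(t, d)\<in>?S. int q ^ 2 + int q * (if t = 0 then 0 else add_char r (d / t ^ 2)))"
    by (rule sum.cong) (auto simp: card_charpoly)
  finally show ?thesis .
qed

text \<open>Either \<open>t = 0\<close> and \<open>d\<close> is arbitrary, or \<open>d = 1\<close>
  and \<open>t\<close> is arbitrary. In the second case the character sum over \<open>1 / t\<close>
  is -1, which gives the last term.\<close>

lemma gl2_count_0: "gl2_count 0 = 2 * int q ^ 3 - 2 * int q ^ 2 - int q"
proof -
  have e: "add_char r (1 / t ^ 2) = add_char r (inverse t)" for t :: 'a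
    using add_char_square[of "inverse t"] by (simp add: power_inverse divide_inverse)
  let ?f = "\<lambda>(t, d :: 'a). int q ^ 2 + int q * (if t = 0 then 0 else add_char r (d / t ^ 2))"
  have S: "{(t, d :: 'a). d \<noteq> 0 \<and> t * (1 + inverse d) = 0} = {0} \<times> (UNIV - {0}) \<union> (UNIV - {0}) \<times> {1}"
  proof -
    have "1 + inverse d = 0 \<longleftrightarrow> d = 1" for d :: 'a
      by (metis add_eq_0 inverse_eq_1_iff)
    then show ?thesis
      by auto
  qed
  have "gl2_count 0 = sum ?f ({0} \<times> (UNIV - {0})) + sum ?f ((UNIV - {0}) \<times> {1})"
    unfolding gl2_count_sum S by (rule sum.union_disjoint) auto
  also have "sum ?f ({0} \<times> (UNIV - {0})) = (\<Sum>d\<in>UNIV - {0 :: 'a}. int q ^ 2)"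
    by (rule sum.reindex_bij_witness[of _ "\<lambda>d. (0, d)" snd]) auto
  also have "\<dots> = (int q - 1) * int q ^ 2"
    using q_ge_2 by (simp add: card_Diff_singleton card_UNIV)
  also have "sum ?f ((UNIV - {0}) \<times> {1}) = (\<Sum>t\<in>UNIV - {0 :: 'a}. int q ^ 2 + int q * add_char r (inverse t))"
    by (rule sum.reindex_bij_witness[of _ "\<lambda>t. (t, 1)" fst]) (auto simp: e split: if_splits)
  also have "\<dots> = (int q - 1) * int q ^ 2 + int q * (\<Sum>t\<in>UNIV - {0 :: 'a}. add_char r (inverse t))"
    using q_ge_2 by (simp add: sum.distrib sum_distrib_left[symmetric] card_Diff_singleton card_UNIV)
  also have "(\<Sum>t\<in>UNIV - {0 :: 'a}. add_char r (inverse t)) = (\<Sum>t\<in>UNIV - {0 :: 'a}. add_char r t)"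
    by (rule sum.reindex_bij_witness[of _ inverse inverse]) auto
  finally show ?thesis
    by (simp add: sum_add_char_nonzero algebra_simps power2_eq_square power3_eq_cube)
qed

text \<open>The value \<open>d = 1\<close> is impossible, and every other \<open>d\<close>
  determines \<open>t\<close>, with \<open>d / t ^ 2 = (d + inverse d) / \<beta> ^ 2\<close>. The
  excluded \<open>d = 1\<close> would contribute \<open>add_char r 0 = 1\<close>, hence the
  \<open>- 1\<close> next to the Kloosterman sum.\<close>

lemma gl2_count_nonzero:
  assumes "(\<beta> :: 'a) \<noteq> 0"
  shows "gl2_count \<beta> = (int q - 2) * int q ^ 2 + int q * (kloosterman r (inverse \<beta>) - 1)"
proof -
  let ?g = "\<lambda>d. add_char r ((d + inverse d) / \<beta> ^ 2)"
  have ne: "1 + d \<noteq> 0" if "d \<noteq> 1" for d :: 'a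
    using that by (auto simp: add_eq_0)
  have "gl2_count \<beta> = (\<Sum>d\<in>UNIV - {0, 1 :: 'a}. int q ^ 2 + int q * ?g d)"
    unfolding gl2_count_sum
  proof (rule sum.reindex_bij_witness[of _ "\<lambda>d. (\<beta> / (1 + inverse d), d)" snd])
    fix x assume x: "x \<in> {(t, d). d \<noteq> 0 \<and> t * (1 + inverse d) = \<beta>}"
    obtain t d where td: "x = (t, d)" by (cases x)
    have d: "d \<noteq> 0" "t * (1 + inverse d) = \<beta>" "t \<noteq> 0" "1 + inverse d \<noteq> 0"
      using x td assms by auto
    then show "snd x \<in> UNIV - {0, 1}" "(\<beta> / (1 + inverse (snd x)), snd x) = x"
      using td d by (auto simp: field_simps)
    have "d / t ^ 2 = d * (1 + inverse d) ^ 2 / \<beta> ^ 2"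
      unfolding d(2)[symmetric] using d(3,4) by (simp add: power_mult_distrib)
    also have "d * (1 + inverse d) ^ 2 = d + inverse d"
      unfolding square_add using d(1) by (simp add: algebra_simps power2_eq_square)
    finally show "int q ^ 2 + int q * ?g (snd x) = (case x of (t, d) \<Rightarrow> int q ^ 2 + int q * (if t = 0 then 0 else add_char r (d / t ^ 2)))"
      using td d by simp
  next
    fix d assume "d \<in> UNIV - {0, 1 :: 'a}"
    moreover from this have "1 + inverse d \<noteq> 0"
      using ne[of "inverse d"] by (auto simp: inverse_eq_1_iff)
    ultimately show "(\<beta> / (1 + inverse d), d) \<in> {(t, d). d \<noteq> 0 \<and> t * (1 + inverse d) = \<beta>}"
      by simp
  qed simp
  also have "\<dots> = (\<Sum>d\<in>UNIV - {0 :: 'a} - {1}. int q ^ 2 + int q * ?g d)"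
    by (rule sum.cong) auto
  also have "\<dots> = (int q - 2) * int q ^ 2 + int q * (\<Sum>d\<in>UNIV - {0 :: 'a} - {1}. ?g d)"
    using q_ge_2 by (simp add: sum.distrib sum_distrib_left[symmetric] card_Diff_singleton card_UNIV)
  also have "(\<Sum>d\<in>UNIV - {0 :: 'a} - {1}. ?g d) = kloosterman r (inverse \<beta>) - 1"
    using kloosterman_rescaled[OF assms] by (simp add: sum_diff1)
  finally show ?thesis .
qed

end

section \<open>Zero-sum subsets\<close>

text \<open>The real upper arguments in the statement turn out to be fibre cardinalities, where the
  truncated coefficient is the usual one.\<close>

lemma binom_of_nat: "binom (real n) k = real (n choose k)"
  by (simp add: binom_def binomial_gbinomial[symmetric])

lemma finite_families: "finite (families j :: ('a::{field,finite} \<Rightarrow> nat) set)"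
proof (rule finite_subset)
  show "families j \<subseteq> PiE UNIV (\<lambda>_ :: 'a. {..j})"
  proof
    fix \<nu> :: "'a \<Rightarrow> nat"
    assume "\<nu> \<in> families j"
    then have "\<nu> \<beta> \<le> j" for \<beta>
      using member_le_sum[of \<beta> UNIV \<nu>] by (auto simp: families_def)
    then show "\<nu> \<in> PiE UNIV (\<lambda>_. {..j})"
      by auto
  qed
qed (auto intro: finite_PiE)

lemma card_subsets_with_profile:
  fixes t :: "'i \<Rightarrow> 'a::finite"
  assumes "finite I"
  shows "card {U. U \<subseteq> I \<and> (\<forall>\<beta>. card {i \<in> U. t i = \<beta>} = \<nu> \<beta>)} =
    (\<Prod>\<beta>\<in>UNIV. card {i \<in> I. t i = \<beta>} choose \<nu> \<beta>)"
    (is "card ?S = _")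
proof -
  let ?V = "\<lambda>\<beta>. {V. V \<subseteq> {i \<in> I. t i = \<beta>} \<and> card V = \<nu> \<beta>}"
  have "bij_betw (\<lambda>U \<beta>. {i \<in> U. t i = \<beta>}) ?S (PiE UNIV ?V)"
  proof (rule bij_betw_byWitness[where f' = "\<lambda>F. \<Union>\<beta>. F \<beta>"])
    have *: "{i \<in> \<Union> (range F). t i = \<beta>} = F \<beta>" if "F \<in> PiE UNIV ?V" for F \<beta>
      using that by (fastforce simp: PiE_iff)
    then show "\<forall>F\<in>PiE UNIV ?V. (\<lambda>\<beta>. {i \<in> \<Union> (range F). t i = \<beta>}) = F"
      by auto
    show "(\<lambda>F. \<Union> (range F)) ` PiE UNIV ?V \<subseteq> ?S"
    proof
      fix U assume "U \<in> (\<lambda>F. \<Union> (range F)) ` PiE UNIV ?V"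
      then obtain F where F: "F \<in> PiE UNIV ?V" and U: "U = \<Union> (range F)"
        by blast
      from F have "U \<subseteq> I" "card (F \<beta>) = \<nu> \<beta>" for \<beta>
        by (auto simp: PiE_iff U)
      then show "U \<in> ?S"
        using *[OF F] by (simp add: U)
    qed
  qed (auto simp: PiE_iff)
  then have "card ?S = card (PiE UNIV ?V)"
    by (rule bij_betw_same_card)
  also have "\<dots> = (\<Prod>\<beta>\<in>UNIV. card (?V \<beta>))"
    by (rule card_PiE) simp
  also have "\<dots> = (\<Prod>\<beta>\<in>UNIV. card {i \<in> I. t i = \<beta>} choose \<nu> \<beta>)"
    by (rule prod.cong) (use assms in \<open>auto simp: n_subsets\<close>)
  finally show ?thesis .
qed

text \<open>The numbers of elements of a subset over each \<open>\<beta>\<close> determine its size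
  and its sum, and \<open>families j\<close> collects the profiles of size \<open>j\<close> and sum
  zero. Within one profile the choices over different \<open>\<beta>\<close> are
  independent.\<close>

lemma card_zero_sum_subsets:
  fixes t :: "'i \<Rightarrow> 'a::{field,finite}"
  assumes "finite I"
  shows "card {U. U \<subseteq> I \<and> card U = j \<and> (\<Sum>i\<in>U. t i) = 0} =
    (\<Sum>\<nu>\<in>families j. \<Prod>\<beta>\<in>UNIV. card {i \<in> I. t i = \<beta>} choose \<nu> \<beta>)"
    (is "card ?S = _")
proof -
  let ?P = "\<lambda>\<nu>. {U. U \<subseteq> I \<and> (\<forall>\<beta>. card {i \<in> U. t i = \<beta>} = \<nu> \<beta>)}"
  let ?U = "\<Union>\<nu>\<in>families j. ?P \<nu>"
  have profile: "(\<Sum>\<beta>\<in>UNIV. card {i \<in> U. t i = \<beta>}) = card U"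
    "(\<Sum>\<beta>\<in>UNIV. of_nat (card {i \<in> U. t i = \<beta>}) * \<beta>) = (\<Sum>i\<in>U. t i)" if "U \<subseteq> I" for U
  proof -
    have U: "finite U"
      using that assms finite_subset by blast
    show "(\<Sum>\<beta>\<in>UNIV. card {i \<in> U. t i = \<beta>}) = card U"
      unfolding card_eq_sum by (rule sum.group) (use U in auto)
    have "(\<Sum>\<beta>\<in>UNIV. of_nat (card {i \<in> U. t i = \<beta>}) * \<beta>) = (\<Sum>\<beta>\<in>UNIV. \<Sum>i | i \<in> U \<and> t i = \<beta>. t i)"
      by (rule sum.cong) auto
    also have "\<dots> = (\<Sum>i\<in>U. t i)"
      by (rule sum.group) (use U in auto)
    finally show "(\<Sum>\<beta>\<in>UNIV. of_nat (card {i \<in> U. t i = \<beta>}) * \<beta>) = (\<Sum>i\<in>U. t i)" .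
  qed
  have "?S = ?U"
  proof (intro Set.set_eqI iffI)
    fix U assume "U \<in> ?S"
    then show "U \<in> ?U"
      using profile[of U] by (intro UN_I[of "\<lambda>\<beta>. card {i \<in> U. t i = \<beta>}"]) (auto simp: families_def)
  next
    fix U assume "U \<in> ?U"
    then obtain \<nu> where \<nu>: "\<nu> \<in> families j" "U \<subseteq> I" "\<And>\<beta>. card {i \<in> U. t i = \<beta>} = \<nu> \<beta>"
      by blast
    then show "U \<in> ?S"
      using profile[of U] by (auto simp: families_def)
  qed
  also have "card \<dots> = (\<Sum>\<nu>\<in>families j. card (?P \<nu>))"
    using assms finite_families by (intro card_UN_disjoint) auto
  finally show ?thesis
    by (simp only: card_subsets_with_profile[OF assms])
qed

lemma num_codewords_eq:
  fixes g :: "nat \<Rightarrow> 'a::{field,finite} mat"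
  shows "num_codewords N g j =
    (\<Sum>\<nu>\<in>families j. \<Prod>\<beta>\<in>UNIV. card {i. i < N \<and> mat_tr (g i) = \<beta>} choose \<nu> \<beta>)"
proof -
  let ?W = "{U. U \<subseteq> {..<N} \<and> card U = j \<and> (\<Sum>i\<in>U. mat_tr (g i)) = 0}"
  have [simp]: "(if i \<in> U then 1 else 0 :: bit) = 1 \<longleftrightarrow> i \<in> U" for i U
    by auto
  have sum: "(\<Sum>i<N. if i \<in> U then mat_tr (g i) else 0) = (\<Sum>i\<in>U. mat_tr (g i))" if "U \<subseteq> {..<N}" for U
    using that by (simp add: sum.If_cases Int_absorb1)
  have "bij_betw (\<lambda>u. {i. i < N \<and> u $ i = 1}) {u \<in> trace_code N g. weight u = j} ?W"
  proof (rule bij_betw_byWitness[where f' = "\<lambda>U. vec N (\<lambda>i. if i \<in> U then 1 else 0)"])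
    show "\<forall>u\<in>{u \<in> trace_code N g. weight u = j}. vec N (\<lambda>i. if i \<in> {i. i < N \<and> u $ i = 1} then 1 else 0) = u"
      by (auto simp: trace_code_def intro!: eq_vecI)
    show "\<forall>U\<in>?W. {i. i < N \<and> vec N (\<lambda>i. if i \<in> U then 1 else 0) $ i = (1 :: bit)} = U"
      by auto
    show "(\<lambda>u. {i. i < N \<and> u $ i = 1}) ` {u \<in> trace_code N g. weight u = j} \<subseteq> ?W"
    proof safe
      fix u assume u: "u \<in> trace_code N g"
      then show "card {i. i < N \<and> u $ i = 1} = weight u"
        by (auto simp: trace_code_def weight_def)
      show "(\<Sum>i\<in>{i. i < N \<and> u $ i = 1}. mat_tr (g i)) = 0"
        using u sum[of "{i. i < N \<and> u $ i = 1}"] by (auto simp: trace_code_def cong: if_cong)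
    qed
    show "(\<lambda>U. vec N (\<lambda>i. if i \<in> U then 1 else 0)) ` ?W \<subseteq> {u \<in> trace_code N g. weight u = j}"
    proof safe
      fix U assume U: "U \<subseteq> {..<N}" "(\<Sum>i\<in>U. mat_tr (g i)) = 0"
      then show "vec N (\<lambda>i. if i \<in> U then 1 else 0) \<in> trace_code N g"
        using sum[of U] by (auto simp: trace_code_def cong: if_cong)
      have "{i. i < N \<and> i \<in> U} = U"
        using U by auto
      then show "weight (vec N (\<lambda>i. if i \<in> U then 1 else 0)) = card U"
        by (simp add: weight_def cong: conj_cong)
    qed
  qed
  then have "num_codewords N g j = card ?W"
    unfolding num_codewords_def by (rule bij_betw_same_card)
  then show ?thesis
    by (simp add: card_zero_sum_subsets)
qed

section \<open>The order of the general linear group\<close>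

text \<open>\<open>J\<close> is the set of free positions. Full matrices take the whole rectangle;
  symmetric matrices reduce to this through their upper triangle.\<close>

lemma card_mat_supported:
  assumes "J \<subseteq> {..<m} \<times> {..<n}"
  shows "card {A \<in> carrier_mat m n. \<forall>i<m. \<forall>j<n. (i, j) \<notin> J \<longrightarrow> A $$ (i, j) = (0 :: 'a::{zero,finite})} =
    card (UNIV :: 'a set) ^ card J"
proof -
  let ?S = "{A \<in> carrier_mat m n. \<forall>i<m. \<forall>j<n. (i, j) \<notin> J \<longrightarrow> A $$ (i, j) = (0 :: 'a)}"
  have fin: "finite J"
    using assms finite_subset by blast
  let ?m = "\<lambda>f :: nat \<times> nat \<Rightarrow> 'a. mat m n (\<lambda>ij. if ij \<in> J then f ij else 0)"
  have "bij_betw ?m (PiE J (\<lambda>_. UNIV)) ?S"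
  proof (rule bij_betw_byWitness[where f' = "\<lambda>A. restrict (($$) A) J"])
    show "\<forall>f\<in>PiE J (\<lambda>_. UNIV). restrict (($$) (?m f)) J = (f :: nat \<times> nat \<Rightarrow> 'a)"
    proof
      fix f :: "nat \<times> nat \<Rightarrow> 'a"
      assume f: "f \<in> PiE J (\<lambda>_. UNIV)"
      show "restrict (($$) (?m f)) J = f"
      proof
        fix ij show "restrict (($$) (?m f)) J ij = f ij"
          using assms PiE_arb[OF f] by (cases ij) (auto simp: restrict_def)
      qed
    qed
  qed (auto intro!: eq_matI)
  then have "card ?S = card (PiE J (\<lambda>_. UNIV :: 'a set))"
    by (simp add: bij_betw_same_card)
  also have "\<dots> = card (UNIV :: 'a set) ^ card J"
    using fin by (simp add: card_PiE)
  finally show ?thesis .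
qed

lemma card_carrier_mat: "card (carrier_mat m n :: 'a::{zero,finite} mat set) = card (UNIV :: 'a set) ^ (m * n)"
  using card_mat_supported[of "{..<m} \<times> {..<n}" m n, where 'a = 'a] by (simp add: card_cartesian_product)

lemma finite_carrier_mat: "finite (carrier_mat m n :: 'a::{zero,finite} mat set)"
  by (rule card_ge_0_finite) (simp add: card_carrier_mat finite_UNIV_card_ge_0)

lemma card_carrier_vec: "card (carrier_vec n :: 'a::{zero,finite} vec set) = card (UNIV :: 'a set) ^ n"
proof -
  have "bij_betw (\<lambda>v. mat n 1 (\<lambda>(i, j). v $ i)) (carrier_vec n) (carrier_mat n 1 :: 'a mat set)"
    by (rule bij_betw_byWitness[where f' = "\<lambda>A. col A 0"]) (auto intro!: eq_matI eq_vecI)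
  then show ?thesis
    by (simp add: bij_betw_same_card card_carrier_mat)
qed

lemma finite_carrier_vec: "finite (carrier_vec n :: 'a::{zero,finite} vec set)"
  by (rule card_ge_0_finite) (simp add: card_carrier_vec finite_UNIV_card_ge_0)

lemma mat_mult_index:
  assumes "A \<in> carrier_mat l m" "B \<in> carrier_mat m n" "i < l" "j < n"
  shows "(A * B) $$ (i, j) = (\<Sum>k<m. A $$ (i, k) * B $$ (k, j))"
  using assms by (simp add: scalar_prod_def atLeast0LessThan)

lemma four_block_mat_eq_iff:
  assumes "A \<in> carrier_mat m n" "B \<in> carrier_mat m n'" "C \<in> carrier_mat m' n" "D \<in> carrier_mat m' n'"
    and "A' \<in> carrier_mat m n" "B' \<in> carrier_mat m n'" "C' \<in> carrier_mat m' n" "D' \<in> carrier_mat m' n'"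
  shows "four_block_mat A B C D = four_block_mat A' B' C' D' \<longleftrightarrow> A = A' \<and> B = B' \<and> C = C' \<and> D = D'"
proof
  assume eq: "four_block_mat A B C D = four_block_mat A' B' C' D'"
  have e: "four_block_mat A B C D $$ (i, j) = four_block_mat A' B' C' D' $$ (i, j)" for i j
    by (simp only: eq)
  show "A = A' \<and> B = B' \<and> C = C' \<and> D = D'"
  proof (intro conjI eq_matI)
    fix i j
    show "A $$ (i, j) = A' $$ (i, j)" if "i < dim_row A'" "j < dim_col A'"
      using e[of i j] that assms by simp
    show "B $$ (i, j) = B' $$ (i, j)" if "i < dim_row B'" "j < dim_col B'"
      using e[of i "n + j"] that assms by simp
    show "C $$ (i, j) = C' $$ (i, j)" if "i < dim_row C'" "j < dim_col C'"
      using e[of "m + i" j] that assms by simp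
    show "D $$ (i, j) = D' $$ (i, j)" if "i < dim_row D'" "j < dim_col D'"
      using e[of "m + i" "n + j"] that assms by simp
  qed (use assms in auto)
qed auto

lemma four_block_mat_cases:
  assumes "M \<in> carrier_mat (m + m') (n + n')"
  obtains A B C D where "M = four_block_mat A B C D" "A \<in> carrier_mat m n" "B \<in> carrier_mat m n'"
    "C \<in> carrier_mat m' n" "D \<in> carrier_mat m' n'"
  using split_block[of M m n _ _ _ _ m' n'] assms by (metis carrier_matD prod_cases4)

lemma GL_iff_det: "A \<in> GL n \<longleftrightarrow> A \<in> carrier_mat n n \<and> det A \<noteq> (0 :: 'a::field)"
proof (cases "A \<in> carrier_mat n n")
  case True
  have "invertible_mat A \<longleftrightarrow> det A \<noteq> 0"
  proof
    assume "invertible_mat A"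
    then obtain B where B: "A * B = 1\<^sub>m n" "B * A = 1\<^sub>m (dim_row B)"
      using True by (auto simp: invertible_mat_def inverts_mat_def)
    then have "B \<in> carrier_mat n n"
      using True by (metis carrier_matD(2) carrier_matI index_mult_mat(3) index_one_mat(3))
    then have "det A * det B = 1"
      using B(1) True by (metis det_mult det_one)
    then show "det A \<noteq> 0"
      by auto
  next
    assume "det A \<noteq> 0"
    then obtain B where "B \<in> carrier_mat n n" "A * B = 1\<^sub>m n" "B * A = 1\<^sub>m n"
      using det_non_zero_imp_unit[OF True, of True] unfolding Units_def ring_mat_def by auto
    then show "invertible_mat A"
      using True unfolding invertible_mat_def inverts_mat_def by auto
  qed
  with True show ?thesis
    by (simp add: GL_def)
qed (simp add: GL_def)

lemma GL_inverse:
  assumes "A \<in> GL n"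
  obtains B where "B \<in> GL n" "A * B = 1\<^sub>m n" "B * A = (1\<^sub>m n :: 'a::field mat)"
proof -
  have A: "A \<in> carrier_mat n n" "det A \<noteq> 0"
    using assms by (auto simp: GL_iff_det)
  obtain B where B: "B \<in> carrier_mat n n" "A * B = 1\<^sub>m n" "B * A = 1\<^sub>m n"
    using det_non_zero_imp_unit[OF A, of True] unfolding Units_def ring_mat_def by auto
  then have "det A * det B = 1"
    using A by (metis det_mult det_one)
  then have "B \<in> GL n"
    using B by (auto simp: GL_iff_det)
  with B show ?thesis
    by (intro that) auto
qed

lemma GL_mult: "A \<in> GL n \<Longrightarrow> B \<in> GL n \<Longrightarrow> A * B \<in> (GL n :: 'a::field mat set)"
  by (auto simp: GL_iff_det det_mult)

lemma GL_transpose: "A \<in> GL n \<Longrightarrow> transpose_mat A \<in> (GL n :: 'a::field mat set)"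
  by (auto simp: GL_iff_det det_transpose)

lemma finite_GL: "finite (GL n :: 'a::{field,finite} mat set)"
  by (rule finite_subset[OF _ finite_carrier_mat[of n n]]) (auto simp: GL_iff_det)

text \<open>A vector with nonzero first entry is the first column of a lower triangular matrix with
  ones further down the diagonal. If the first entry is zero, a nonzero entry is first copied into
  its place, and \<open>addrow\<close> undoes this.\<close>

lemma ex_GL_first_col:
  fixes v :: "'a::field vec"
  assumes v: "v \<in> carrier_vec (Suc n)" "v \<noteq> 0\<^sub>v (Suc n)"
  shows "\<exists>g\<in>GL (Suc n). col g 0 = v"
proof -
  have *: "\<exists>g\<in>GL (Suc n). col g 0 = v" if v: "v \<in> carrier_vec (Suc n)" "v $ 0 \<noteq> 0" for v :: "'a vec"
  proof -
    define g where "g = mat (Suc n) (Suc n) (\<lambda>(i, j). if j = 0 then v $ i else if i = j then 1 else 0)"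
    have g: "g \<in> carrier_mat (Suc n) (Suc n)"
      by (simp add: g_def)
    have "det g = prod_list (diag_mat g)"
      by (rule det_lower_triangular[OF _ g]) (simp add: g_def)
    moreover have "prod_list (diag_mat g) \<noteq> 0"
      using v by (auto simp: prod_list_zero_iff diag_mat_def g_def)
    ultimately have "g \<in> GL (Suc n)"
      using g by (simp add: GL_iff_det)
    moreover have "col g 0 = v"
      using v by (intro eq_vecI) (auto simp: g_def)
    ultimately show ?thesis
      by blast
  qed
  show ?thesis
  proof (cases "v $ 0 = 0")
    case True
    obtain k where k: "k < Suc n" "v $ k \<noteq> 0"
      using v by (metis carrier_vecD eq_vecI index_zero_vec)
    then have "k \<noteq> 0"
      using True by metis
    define w where "w = vec (Suc n) (\<lambda>i. if i = 0 then v $ k else v $ i)"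
    obtain g where g: "g \<in> GL (Suc n)" "col g 0 = w"
      using *[of w] k by (auto simp: w_def)
    have gc: "g \<in> carrier_mat (Suc n) (Suc n)"
      using g by (simp add: GL_iff_det)
    have gw: "g $$ (i, 0) = w $ i" if "i < Suc n" for i
      using that gc by (simp flip: g(2))
    have "addrow (- 1) 0 k g \<in> GL (Suc n)"
      using g gc k \<open>k \<noteq> 0\<close> by (simp add: GL_iff_det det_addrow)
    moreover have "col (addrow (- 1) 0 k g) 0 = v"
      using gc v k True \<open>k \<noteq> 0\<close> by (intro eq_vecI) (auto simp: gw w_def)
    ultimately show ?thesis
      by blast
  qed (use * v in blast)
qed

lemma mult_unit_vec:
  assumes "g \<in> carrier_mat (Suc n) (Suc n)"
  shows "g *\<^sub>v unit_vec (Suc n) 0 = col (g :: 'a::field mat) 0"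
  using assms by (intro eq_vecI) (auto simp: scalar_prod_right_unit[of _ "Suc n"])

lemma det_zero_col:
  fixes A :: "'a::field mat"
  assumes "A \<in> carrier_mat (Suc n) (Suc n)" "col A 0 = 0\<^sub>v (Suc n)"
  shows "det A = 0"
proof -
  have "A *\<^sub>v unit_vec (Suc n) 0 = 0\<^sub>v (Suc n)"
    using assms by (simp add: mult_unit_vec)
  moreover have "unit_vec (Suc n) 0 \<noteq> (0\<^sub>v (Suc n) :: 'a vec)"
    by simp
  ultimately show ?thesis
    using det_0_iff_vec_prod_zero_field[OF assms(1)] by (metis unit_vec_carrier)
qed

text \<open>\<open>GL\<close> is transitive on nonzero vectors, so the inequalities for
  \<open>g\<close> and for its inverse give equality. The hypothesis asks only for an inequality so
  that an injection suffices.\<close>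

lemma card_fibre_transitive:
  fixes F :: "'a::field vec \<Rightarrow> 'b set"
  assumes le: "\<And>g u. g \<in> GL (Suc n) \<Longrightarrow> u \<in> carrier_vec (Suc n) \<Longrightarrow> card (F u) \<le> card (F (g *\<^sub>v u))"
    and v: "v \<in> carrier_vec (Suc n)" "v \<noteq> 0\<^sub>v (Suc n)"
  shows "card (F v) = card (F (unit_vec (Suc n) 0))"
proof -
  obtain g where g: "g \<in> GL (Suc n)" "col g 0 = v"
    using ex_GL_first_col[OF v] by blast
  then have gc: "g \<in> carrier_mat (Suc n) (Suc n)"
    by (simp add: GL_iff_det)
  from g obtain h where h: "h \<in> GL (Suc n)" "h * g = 1\<^sub>m (Suc n)"
    by (blast elim: GL_inverse)
  then have hc: "h \<in> carrier_mat (Suc n) (Suc n)"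
    by (simp add: GL_iff_det)
  have v_eq: "v = g *\<^sub>v unit_vec (Suc n) 0"
    using gc g by (simp add: mult_unit_vec)
  then have "h *\<^sub>v v = unit_vec (Suc n) 0"
    by (simp add: h(2) flip: assoc_mult_mat_vec[OF hc gc])
  then show ?thesis
    using le[OF g(1), of "unit_vec (Suc n) 0"] le[OF h(1) v(1)] v_eq by simp
qed

lemma card_by_nonzero_fibre:
  fixes f :: "'b \<Rightarrow> 'a::{field,finite} vec"
  assumes fin: "finite S" and f: "\<And>x. x \<in> S \<Longrightarrow> f x \<in> carrier_vec (Suc n) - {0\<^sub>v (Suc n)}"
    and card: "\<And>v. v \<in> carrier_vec (Suc n) - {0\<^sub>v (Suc n)} \<Longrightarrow> card {x \<in> S. f x = v} = c"
  shows "card S = (card (UNIV :: 'a set) ^ Suc n - 1) * c"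
proof -
  let ?V = "carrier_vec (Suc n) - {0\<^sub>v (Suc n) :: 'a vec}"
  have "card S = (\<Sum>v\<in>?V. card {x \<in> S. f x = v})"
    unfolding card_eq_sum by (rule sum.group[symmetric]) (use fin f finite_carrier_vec in auto)
  also have "\<dots> = card ?V * c"
    by (simp add: card)
  also have "card ?V = card (UNIV :: 'a set) ^ Suc n - 1"
    by (simp add: card_Diff_singleton card_carrier_vec)
  finally show ?thesis .
qed

text \<open>By transitivity the first column may be taken to be a unit vector; the rest of the first
  row is then free and the remaining block must be invertible.\<close>

lemma card_GL_Suc:
  "card (GL (Suc n) :: 'a::{field,finite} mat set) =
    (card (UNIV :: 'a set) ^ Suc n - 1) * (card (UNIV :: 'a set) ^ n * card (GL n :: 'a mat set))"
proof (rule card_by_nonzero_fibre[where f = "\<lambda>A. col A 0"])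
  let ?F = "\<lambda>v. {A \<in> GL (Suc n). col A 0 = (v :: 'a vec)}"
  fix v :: "'a vec"
  assume v: "v \<in> carrier_vec (Suc n) - {0\<^sub>v (Suc n)}"
  have "card (?F v) = card (?F (unit_vec (Suc n) 0))"
  proof (rule card_fibre_transitive)
    fix g :: "'a mat" and u :: "'a vec"
    assume g: "g \<in> GL (Suc n)" and "u \<in> carrier_vec (Suc n)"
    then have gc: "g \<in> carrier_mat (Suc n) (Suc n)"
      by (simp add: GL_iff_det)
    obtain h where h: "h \<in> GL (Suc n)" "h * g = 1\<^sub>m (Suc n)"
      using g by (blast elim: GL_inverse)
    show "card (?F u) \<le> card (?F (g *\<^sub>v u))"
    proof (rule card_inj_on_le)
      have hc: "h \<in> carrier_mat (Suc n) (Suc n)"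
        using h by (simp add: GL_iff_det)
      have "h * (g * A) = A" if "A \<in> ?F u" for A
      proof -
        have A: "A \<in> carrier_mat (Suc n) (Suc n)"
          using that by (simp add: GL_iff_det)
        then show ?thesis
          by (simp add: h(2) flip: assoc_mult_mat[OF hc gc A])
      qed
      then show "inj_on ((*) g) (?F u)"
        by (rule inj_on_inverseI)
      show "(*) g ` ?F u \<subseteq> ?F (g *\<^sub>v u)"
      proof clarify
        fix A :: "'a mat" assume A: "A \<in> GL (Suc n)"
        then show "g * A \<in> GL (Suc n) \<and> col (g * A) 0 = g *\<^sub>v col A 0"
          using g GL_mult[OF g A] by (auto simp: GL_iff_det[of g] GL_iff_det[of A] col_mult2)
      qed
    qed (simp add: finite_GL)
  qed (use v in auto)
  also have "\<dots> = card ((carrier_mat 1 n :: 'a mat set) \<times> (GL n :: 'a mat set))"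
  proof (rule bij_betw_same_card[symmetric])
    let ?f = "\<lambda>(W, A). four_block_mat (1\<^sub>m 1) W (0\<^sub>m n 1) (A :: 'a mat)"
    have "inj_on ?f (carrier_mat 1 n \<times> GL n)"
      by (rule inj_onI) (auto simp: GL_iff_det four_block_mat_eq_iff[of _ 1 1 _ n _ n])
    moreover have "?f ` (carrier_mat 1 n \<times> GL n) = ?F (unit_vec (Suc n) 0)"
    proof (intro equalityI subsetI)
      fix M assume "M \<in> ?f ` (carrier_mat 1 n \<times> GL n)"
      then obtain W A where WA: "W \<in> carrier_mat 1 n" "A \<in> carrier_mat n n" "det A \<noteq> 0"
        and M: "M = four_block_mat (1\<^sub>m 1) W (0\<^sub>m n 1) A"
        by (auto simp: GL_iff_det)
      have "det M = det A"
        unfolding M using WA by (subst det_four_block_mat_lower_left_zero_col[of _ _ n]) auto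
      then show "M \<in> ?F (unit_vec (Suc n) 0)"
        using WA by (auto simp: M GL_iff_det intro!: eq_vecI)
    next
      fix M assume M: "M \<in> ?F (unit_vec (Suc n) 0)"
      then have Mc: "M \<in> carrier_mat (1 + n) (1 + n)"
        by (simp add: GL_iff_det)
      then obtain E W Z A where b: "M = four_block_mat E W Z A" "E \<in> carrier_mat 1 1" "W \<in> carrier_mat 1 n"
        "Z \<in> carrier_mat n 1" "A \<in> carrier_mat n n"
        by (rule four_block_mat_cases)
      have e: "M $$ (i, 0) = (if i = 0 then 1 else 0)" if "i < Suc n" for i
      proof -
        have "M $$ (i, 0) = col M 0 $ i"
          using that Mc by simp
        also have "col M 0 = unit_vec (Suc n) 0"
          using M by simp
        finally show ?thesis
          using that by simp
      qed
      have E: "E = 1\<^sub>m 1"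
        using e[of 0] b by (intro eq_matI) auto
      have Z: "Z = 0\<^sub>m n 1"
        using e[of "Suc _"] b by (intro eq_matI) auto
      have "det M = det A"
        unfolding b E Z using b by (subst det_four_block_mat_lower_left_zero_col[of _ _ n]) auto
      then have "A \<in> GL n"
        using M b by (simp add: GL_iff_det)
      then show "M \<in> ?f ` (carrier_mat 1 n \<times> GL n)"
        using b E Z by force
    qed
    ultimately show "bij_betw ?f (carrier_mat 1 n \<times> GL n) (?F (unit_vec (Suc n) 0))"
      by (simp add: bij_betw_def)
  qed
  finally show "card (?F v) = card (UNIV :: 'a set) ^ n * card (GL n :: 'a mat set)"
    by (simp add: card_cartesian_product card_carrier_mat)
next
  fix A :: "'a mat"
  assume "A \<in> GL (Suc n)"
  then show "col A 0 \<in> carrier_vec (Suc n) - {0\<^sub>v (Suc n)}"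
    using det_zero_col[of A n] by (auto simp: GL_iff_det intro: col_carrier_vec)
qed (rule finite_GL)

lemma card_GL_0: "card (GL 0 :: 'a::field mat set) = 1"
proof -
  have "GL 0 = {1\<^sub>m 0 :: 'a mat}"
    by (auto simp: GL_iff_det intro!: eq_matI)
  then show ?thesis
    by simp
qed

section \<open>Symmetric and alternating matrices\<close>

text \<open>Symmetry stands in for skew-symmetry, so these are the matrices of alternating forms in
  characteristic two.\<close>

definition alternating :: "nat \<Rightarrow> 'a::field mat set" where
  "alternating n = {A \<in> carrier_mat n n. transpose_mat A = A \<and> (\<forall>i<n. A $$ (i, i) = 0)}"

definition symmetric :: "nat \<Rightarrow> 'a::field mat set" where
  "symmetric n = {A \<in> carrier_mat n n. transpose_mat A = A}"

lemma symmetric_index: "A \<in> symmetric n \<Longrightarrow> i < n \<Longrightarrow> j < n \<Longrightarrow> A $$ (i, j) = A $$ (j, i)"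
  unfolding symmetric_def by (metis (mono_tags, lifting) carrier_matD index_transpose_mat(1) mem_Collect_eq)

lemma symmetricI:
  assumes "A \<in> carrier_mat n n" "\<And>i j. i < n \<Longrightarrow> j < n \<Longrightarrow> A $$ (i, j) = A $$ (j, i)"
  shows "A \<in> symmetric n"
  using assms by (auto simp: symmetric_def intro!: eq_matI)

lemma alternating_iff: "A \<in> alternating n \<longleftrightarrow> A \<in> symmetric n \<and> (\<forall>i<n. A $$ (i, i) = 0)"
  by (auto simp: alternating_def symmetric_def)

text \<open>Off-diagonal terms come in equal pairs and cancel. This is why congruence preserves a
  zero diagonal and why alternating matrices pair to zero with symmetric ones.\<close>

lemma char2_sum_symmetric:
  fixes n :: nat
  assumes "(2 :: 'a::comm_ring_1) = 0" "\<And>i j. i < n \<Longrightarrow> j < n \<Longrightarrow> f i j = (f j i :: 'a)"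
  shows "(\<Sum>i<n. \<Sum>j<n. f i j) = (\<Sum>i<n. f i i)"
  using assms(2)
proof (induction n)
  case (Suc n)
  have "(\<Sum>i<Suc n. \<Sum>j<Suc n. f i j) = (\<Sum>i<n. \<Sum>j<n. f i j) + ((\<Sum>i<n. f i n) + (\<Sum>j<n. f n j)) + f n n"
    by (simp add: sum.distrib add.assoc)
  also have "(\<Sum>j<n. f n j) = (\<Sum>i<n. f i n)"
    by (rule sum.cong) (auto intro: Suc.prems)
  finally show ?case
    using Suc by (simp add: char2_add_self[OF assms(1)])
qed simp

text \<open>\<open>E\<close> is its own inverse. Eliminating the lower left block changes
  \<open>D\<close> by \<open>transpose_mat B * E * B\<close>, which is zero because only the second
  row of \<open>B\<close> survives and \<open>E\<close> has zero diagonal.\<close>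

lemma det_alternating_block:
  fixes D :: "'a::field mat"
  assumes D: "D \<in> carrier_mat n n" and B: "B \<in> carrier_mat 2 n" and B1: "\<And>j. j < n \<Longrightarrow> B $$ (0, j) = 0"
  defines "E \<equiv> mat 2 2 (\<lambda>(i, j). if i = j then 0 else (1 :: 'a))"
  shows "det (four_block_mat E B (transpose_mat B) D) = - det D"
proof -
  have E: "E \<in> carrier_mat 2 2"
    by (simp add: E_def)
  have Bt: "transpose_mat B \<in> carrier_mat n 2"
    using B by simp
  have EE: "E * E = 1\<^sub>m 2"
    by (rule eq_matI) (auto simp: E_def scalar_prod_def numeral_2_eq_2 less_Suc_eq)
  have det_E: "det E = -1"
  proof -
    have "E = four_block_mat (0\<^sub>m 1 1) (1\<^sub>m 1) (1\<^sub>m 1) (0\<^sub>m 1 1)"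
      by (rule eq_matI) (auto simp: E_def)
    also have "det \<dots> = - 1"
    proof -
      have "det (0\<^sub>m 1 1 - 1\<^sub>m 1 :: 'a mat) = - 1"
        by (subst det_single) auto
      then show ?thesis
        by (subst det_four_block_mat[of _ 1]) (auto simp del: One_nat_def)
    qed
    finally show ?thesis .
  qed
  have BEB: "transpose_mat B * E * B = 0\<^sub>m n n"
  proof (rule eq_matI)
    fix i j assume "i < dim_row (0\<^sub>m n n :: 'a mat)" "j < dim_col (0\<^sub>m n n :: 'a mat)"
    then show "(transpose_mat B * E * B) $$ (i, j) = 0\<^sub>m n n $$ (i, j)"
      using B B1 by (simp add: E_def scalar_prod_def numeral_2_eq_2)
  qed (use B in auto)
  have TE: "transpose_mat B * E \<in> carrier_mat n 2"
    using Bt E by simp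
  have "transpose_mat B * E * E = transpose_mat B"
    using Bt E EE by (simp add: assoc_mult_mat[OF Bt E E])
  then have "four_block_mat E B (transpose_mat B) D =
      four_block_mat (1\<^sub>m 2) (0\<^sub>m 2 n) (transpose_mat B * E) (1\<^sub>m n) * four_block_mat E B (0\<^sub>m n 2) D"
    using E B Bt D TE BEB by (subst mult_four_block_mat[of _ 2 2 _ n _ n _ _ 2 _ n]) auto
  also have "det \<dots> = det (four_block_mat (1\<^sub>m 2) (0\<^sub>m 2 n) (transpose_mat B * E) (1\<^sub>m n)) *
      det (four_block_mat E B (0\<^sub>m n 2) D)"
    using E B D TE by (intro det_mult[of _ "2 + n"]) auto
  also have "det (four_block_mat (1\<^sub>m 2) (0\<^sub>m 2 n) (transpose_mat B * E) (1\<^sub>m n)) = 1"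
    using TE by (subst det_four_block_mat_upper_right_zero[of _ 2 _ n]) auto
  also have "det (four_block_mat E B (0\<^sub>m n 2) D) = det E * det D"
    using E B D by (intro det_four_block_mat_lower_left_zero) auto
  finally show ?thesis
    by (simp add: det_E)
qed

lemma card_symmetric_supported:
  assumes "J \<subseteq> {(i, j). i \<le> j \<and> j < n}"
  shows "card {B \<in> symmetric n. \<forall>i j. i \<le> j \<and> j < n \<and> (i, j) \<notin> J \<longrightarrow> B $$ (i, j) = (0 :: 'a::{field,finite})} =
    card (UNIV :: 'a set) ^ card J"
    (is "card ?S = _")
proof -
  let ?T = "{A \<in> carrier_mat n n. \<forall>i<n. \<forall>j<n. (i, j) \<notin> J \<longrightarrow> A $$ (i, j) = (0 :: 'a)}"
  let ?up = "\<lambda>B. mat n n (\<lambda>(i, j). if i \<le> j then B $$ (i, j) else 0)"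
  let ?sym = "\<lambda>A. mat n n (\<lambda>(i, j). if i \<le> j then A $$ (i, j) else A $$ (j, i))"
  have "bij_betw ?up ?S ?T"
  proof (rule bij_betw_byWitness[where f' = ?sym])
    show "\<forall>B\<in>?S. ?sym (?up B) = B"
    proof
      fix B assume B: "B \<in> ?S"
      then have "B \<in> carrier_mat n n"
        by (simp add: symmetric_def)
      then show "?sym (?up B) = B"
        using B by (intro eq_matI) (auto simp: symmetric_index[of B n])
    qed
    show "\<forall>A\<in>?T. ?up (?sym A) = A"
    proof
      fix A assume A: "A \<in> ?T"
      have "(i, j) \<notin> J" if "\<not> i \<le> j" for i j
        using assms that by auto
      then show "?up (?sym A) = A"
        using A by (intro eq_matI) auto
    qed
    show "?up ` ?S \<subseteq> ?T"
      by auto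
    show "?sym ` ?T \<subseteq> ?S"
      by (auto intro!: symmetricI)
  qed
  then have "card ?S = card ?T"
    by (rule bij_betw_same_card)
  also have "\<dots> = card (UNIV :: 'a set) ^ card J"
    using assms by (intro card_mat_supported) auto
  finally show ?thesis .
qed

lemma card_triangle: "card {(i, j). i \<le> j \<and> s \<le> j \<and> j < n} = (\<Sum>j = s..<n. Suc j)"
proof -
  have "{(i, j). i \<le> j \<and> s \<le> j \<and> j < n} = prod.swap ` (SIGMA j:{s..<n}. {..j})"
    by (auto simp: image_iff)
  also have "card \<dots> = (\<Sum>j = s..<n. Suc j)"
    by (subst card_image) (auto simp: card_SigmaI)
  finally show ?thesis .
qed

lemma card_symmetric:
  "card (symmetric n :: 'a::{field,finite} mat set) = card (UNIV :: 'a set) ^ (\<Sum>j<n. Suc j)"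
proof -
  have "{B \<in> symmetric n. \<forall>i j. i \<le> j \<and> j < n \<and> (i, j) \<notin> {(i, j). i \<le> j \<and> j < n} \<longrightarrow> B $$ (i, j) = (0 :: 'a)} =
      symmetric n"
    by auto
  then have "card (symmetric n :: 'a mat set) = card (UNIV :: 'a set) ^ card {(i, j). i \<le> j \<and> j < n}"
    using card_symmetric_supported[of "{(i, j). i \<le> j \<and> j < n}" n, where 'a = 'a] by (simp only:)
  then show ?thesis
    using card_triangle[of 0 n] by (simp add: atLeast0LessThan)
qed

lemma card_symmetric_corner:
  assumes "s \<le> n"
  shows "card {B \<in> symmetric n. \<forall>i<s. \<forall>j<s. B $$ (i, j) = (0 :: 'a::{field,finite})} =
    card (UNIV :: 'a set) ^ (\<Sum>j = s..<n. Suc j)"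
proof -
  let ?R = "{B \<in> symmetric n. \<forall>i j. i \<le> j \<and> j < n \<and> (i, j) \<notin> {(i, j). i \<le> j \<and> s \<le> j \<and> j < n} \<longrightarrow> B $$ (i, j) = (0 :: 'a)}"
  have "{B \<in> symmetric n. \<forall>i<s. \<forall>j<s. B $$ (i, j) = (0 :: 'a)} = ?R"
    (is "?L = _")
  proof (intro equalityI subsetI)
    fix B :: "'a mat" assume B: "B \<in> ?R"
    have "B $$ (i, j) = 0" if "i < s" "j < s" for i j
    proof (cases "i \<le> j")
      case True
      then show ?thesis
        using B that assms by auto
    next
      case False
      then have "B $$ (j, i) = 0"
        using B that assms by auto
      then show ?thesis
        using B that assms symmetric_index[of B n i j] by auto
    qed
    then show "B \<in> ?L"
      using B by auto
  qed auto
  moreover have "card ?R = card (UNIV :: 'a set) ^ card {(i, j). i \<le> j \<and> s \<le> j \<and> j < n}"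
    by (rule card_symmetric_supported) auto
  ultimately show ?thesis
    by (simp only: card_triangle)
qed

lemma symmetric_congruence:
  assumes "h \<in> carrier_mat m n" "A \<in> symmetric n"
  shows "h * A * transpose_mat h \<in> (symmetric m :: 'a::field mat set)"
proof -
  have A: "A \<in> carrier_mat n n" "transpose_mat A = A"
    using assms by (auto simp: symmetric_def)
  have "transpose_mat (h * A * transpose_mat h) = h * (transpose_mat A * transpose_mat h)"
    using A assms by (simp add: transpose_mult[of "h * A" m n _ m] transpose_mult[of h m n A n] del: assoc_mult_mat)
  then show ?thesis
    using A assms by (simp add: symmetric_def assoc_mult_mat[of h m n A n "transpose_mat h" m])
qed

section \<open>Invertible alternating matrices\<close>

context binary_field
begin

lemma alternating_congruence:
  assumes h: "h \<in> carrier_mat m n" and A: "A \<in> alternating n"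
  shows "h * A * transpose_mat h \<in> (alternating m :: 'a mat set)"
proof -
  have Ac: "A \<in> carrier_mat n n" and sym: "A \<in> symmetric n" and diag: "\<And>i. i < n \<Longrightarrow> A $$ (i, i) = 0"
    using A by (auto simp: alternating_def symmetric_def)
  have "(h * A * transpose_mat h) $$ (i, i) = 0" if i: "i < m" for i
  proof -
    have "(h * A * transpose_mat h) $$ (i, i) = (\<Sum>l<n. (\<Sum>k<n. h $$ (i, k) * A $$ (k, l)) * h $$ (i, l))"
      using h Ac i by (simp add: scalar_prod_def atLeast0LessThan del: assoc_mult_mat)
    also have "\<dots> = (\<Sum>l<n. \<Sum>k<n. h $$ (i, k) * A $$ (k, l) * h $$ (i, l))"
      by (simp add: sum_distrib_right)
    also have "\<dots> = (\<Sum>l<n. h $$ (i, l) * A $$ (l, l) * h $$ (i, l))"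
      by (rule char2_sum_symmetric[OF two]) (simp add: symmetric_index[OF sym] ac_simps)
    also have "\<dots> = 0"
      by (simp add: diag)
    finally show ?thesis .
  qed
  then show ?thesis
    using symmetric_congruence[OF h sym] by (simp add: alternating_iff)
qed

text \<open>Such a matrix has \<open>E\<close> in its upper left corner. The rest \<open>W\<close>
  of its second row is free, which gives \<open>q ^ n\<close>, and its determinant is that of the
  lower right block \<open>D\<close> up to sign.\<close>

lemma card_alternating_unit_row:
  "card {M \<in> alternating (Suc (Suc n)) \<inter> GL (Suc (Suc n)). row M 0 = (unit_vec (Suc (Suc n)) 1 :: 'a vec)} =
    q ^ n * card (alternating n \<inter> GL n :: 'a mat set)" (is "card ?F = _")
proof -
  define E where "E = mat 2 2 (\<lambda>(i, j). if i = j then 0 else (1 :: 'a))"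
  define B where "B W = mat 2 n (\<lambda>(i, j). if i = 0 then 0 else (W :: 'a mat) $$ (0, j))" for W
  have E: "E \<in> carrier_mat 2 2" and B: "B W \<in> carrier_mat 2 n" for W
    by (auto simp: E_def B_def)
  let ?f = "\<lambda>(W, D). four_block_mat E (B W) (transpose_mat (B W)) D"
  have B_inj: "W = W'" if "W \<in> carrier_mat 1 n" "W' \<in> carrier_mat 1 n" "B W = B W'" for W W'
  proof (rule eq_matI)
    fix i j assume "i < dim_row W'" "j < dim_col W'"
    then have "B W $$ (1, j) = W $$ (i, j)" "B W' $$ (1, j) = W' $$ (i, j)"
      using that(1,2) by (auto simp: B_def)
    then show "W $$ (i, j) = W' $$ (i, j)"
      unfolding that(3) by simp
  qed (use that in auto)
  have inj: "inj_on ?f (carrier_mat 1 n \<times> (alternating n \<inter> GL n))"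
    using E B B_inj by (intro inj_onI) (auto simp: GL_iff_det four_block_mat_eq_iff[of _ 2 2 _ n _ n])
  have "?f ` (carrier_mat 1 n \<times> (alternating n \<inter> GL n)) = ?F"
  proof (intro equalityI subsetI)
    fix M assume "M \<in> ?f ` (carrier_mat 1 n \<times> (alternating n \<inter> GL n))"
    then obtain W D where W: "W \<in> carrier_mat 1 n" and D: "D \<in> carrier_mat n n" "det D \<noteq> 0" "D \<in> symmetric n"
        "\<And>i. i < n \<Longrightarrow> D $$ (i, i) = 0"
      and M: "M = four_block_mat E (B W) (transpose_mat (B W)) D"
      by (auto simp: GL_iff_det alternating_iff)
    have Mc: "M \<in> carrier_mat (Suc (Suc n)) (Suc (Suc n))"
      using E D four_block_carrier_mat[OF E D(1)] by (simp add: M)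
    have "det M = - det D"
      unfolding M E_def by (rule det_alternating_block[OF D(1) B]) (simp add: B_def)
    moreover have "M \<in> symmetric (Suc (Suc n))"
      using Mc D(1) by (intro symmetricI) (auto simp: M E_def B_def symmetric_index[OF D(3)])
    moreover have "M $$ (i, i) = 0" if "i < Suc (Suc n)" for i
      using that D by (auto simp: M E_def B_def)
    moreover have "row M 0 = unit_vec (Suc (Suc n)) 1"
      using Mc D(1) by (intro eq_vecI) (auto simp: M E_def B_def)
    ultimately show "M \<in> ?F"
      using Mc D by (simp add: alternating_iff GL_iff_det)
  next
    fix M assume M: "M \<in> ?F"
    then have Mc: "M \<in> carrier_mat (Suc (Suc n)) (Suc (Suc n))" and det: "det M \<noteq> 0"
      and sym: "M \<in> symmetric (Suc (Suc n))" and diag: "\<And>i. i < Suc (Suc n) \<Longrightarrow> M $$ (i, i) = 0"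
      and row: "row M 0 = unit_vec (Suc (Suc n)) 1"
      by (auto simp: GL_iff_det alternating_iff)
    have M0: "M $$ (0, j) = (if j = 1 then 1 else 0)" if "j < Suc (Suc n)" for j
    proof -
      have "M $$ (0, j) = row M 0 $ j"
        using Mc that by simp
      then show ?thesis
        using that unfolding row by simp
    qed
    define W where "W = mat 1 n (\<lambda>(_, j). M $$ (1, j + 2))"
    define D where "D = mat n n (\<lambda>(i, j). M $$ (i + 2, j + 2))"
    have D: "D \<in> carrier_mat n n"
      by (simp add: D_def)
    have M_eq: "M = four_block_mat E (B W) (transpose_mat (B W)) D"
    proof (rule eq_matI)
      fix i j assume ij: "i < dim_row (four_block_mat E (B W) (transpose_mat (B W)) D)"
        "j < dim_col (four_block_mat E (B W) (transpose_mat (B W)) D)"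
      then have ij': "i < Suc (Suc n)" "j < Suc (Suc n)"
        using E D by simp_all
      have sw: "M $$ (i, j) = M $$ (j, i)"
        by (rule symmetric_index[OF sym ij'])
      have "i = 0 \<or> i = 1 \<or> (\<exists>i'. i = Suc (Suc i'))" "j = 0 \<or> j = 1 \<or> (\<exists>j'. j = Suc (Suc j'))"
        by (metis One_nat_def old.nat.exhaust)+
      then show "M $$ (i, j) = four_block_mat E (B W) (transpose_mat (B W)) D $$ (i, j)"
        using ij' sw by (elim disjE exE) (auto simp: E_def B_def W_def D_def M0 diag)
    qed (use Mc E D in auto)
    have "det M = - det D"
      unfolding M_eq E_def by (rule det_alternating_block[OF D B]) (simp add: B_def)
    moreover have "D \<in> symmetric n"
      using D by (rule symmetricI) (auto simp: D_def symmetric_index[OF sym])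
    ultimately have "D \<in> alternating n \<inter> GL n"
      using D det by (auto simp: GL_iff_det alternating_iff D_def diag)
    moreover have "W \<in> carrier_mat 1 n"
      by (simp add: W_def)
    ultimately show "M \<in> ?f ` (carrier_mat 1 n \<times> (alternating n \<inter> GL n))"
      unfolding M_eq by (intro image_eqI[of _ _ "(W, D)"]) auto
  qed
  then have "bij_betw ?f (carrier_mat 1 n \<times> (alternating n \<inter> GL n)) ?F"
    using inj by (simp add: bij_betw_def)
  then have "card ?F = card ((carrier_mat 1 n :: 'a mat set) \<times> (alternating n \<inter> GL n :: 'a mat set))"
    by (simp add: bij_betw_same_card)
  then show ?thesis
    by (simp add: card_cartesian_product card_carrier_mat card_UNIV)
qed


text \<open>Matrices are sorted by their first row without its zero diagonal entry, a vector which
  invertibility keeps nonzero. Congruence by the block diagonal matrix of 1 and \<open>g\<close>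
  acts on this vector as \<open>g\<close>, so all fibres are as large as the one over a unit
  vector.\<close>

lemma card_alternating_Suc_Suc:
  "card (alternating (Suc (Suc n)) \<inter> GL (Suc (Suc n)) :: 'a mat set) =
    (q ^ Suc n - 1) * (q ^ n * card (alternating n \<inter> GL n :: 'a mat set))"
proof -
  let ?m = "Suc n"
  let ?S = "alternating (Suc ?m) \<inter> GL (Suc ?m) :: 'a mat set"
  let ?f = "\<lambda>M :: 'a mat. vec ?m (\<lambda>j. M $$ (0, Suc j))"
  let ?F = "\<lambda>v. {M \<in> ?S. ?f M = v}"
  have S: "M \<in> carrier_mat (Suc ?m) (Suc ?m)" "M \<in> symmetric (Suc ?m)" "det M \<noteq> 0" "M $$ (0, 0) = 0"
    if "M \<in> ?S" for M
    using that by (auto simp: GL_iff_det alternating_iff)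
  have "card ?S = (card (UNIV :: 'a set) ^ ?m - 1) * (q ^ n * card (alternating n \<inter> GL n :: 'a mat set))"
  proof (rule card_by_nonzero_fibre[where f = ?f])
    show "finite ?S"
      using finite_GL by blast
    show "?f M \<in> carrier_vec ?m - {0\<^sub>v ?m}" if M: "M \<in> ?S" for M
    proof -
      have "?f M \<noteq> 0\<^sub>v ?m"
      proof
        assume 0: "?f M = 0\<^sub>v ?m"
        have "M $$ (i, 0) = 0" if "i < Suc ?m" for i
        proof (cases i)
          case (Suc j)
          then have "M $$ (0, i) = ?f M $ j"
            using that by simp
          also have "\<dots> = 0"
            unfolding 0 using that Suc by simp
          finally show ?thesis
            using symmetric_index[OF S(2)[OF M], of i 0] that by simp
        qed (use S(4)[OF M] in simp)
        then have "col M 0 = 0\<^sub>v (Suc ?m)"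
          using S(1)[OF M] by (intro eq_vecI) auto
        then show False
          using det_zero_col S(1,3)[OF M] by blast
      qed
      then show ?thesis
        by simp
    qed
    fix v :: "'a vec"
    assume v: "v \<in> carrier_vec ?m - {0\<^sub>v ?m}"
    have "card (?F v) = card (?F (unit_vec ?m 0))"
    proof (rule card_fibre_transitive)
      fix g :: "'a mat" and u :: "'a vec"
      assume g: "g \<in> GL ?m" and u: "u \<in> carrier_vec ?m"
      define h where "h = four_block_mat (1\<^sub>m 1) (0\<^sub>m 1 ?m) (0\<^sub>m ?m 1) g"
      have gc: "g \<in> carrier_mat ?m ?m"
        using g by (simp add: GL_iff_det)
      have hc: "h \<in> carrier_mat (Suc ?m) (Suc ?m)"
        using four_block_carrier_mat[of "1\<^sub>m 1" 1 1 g ?m ?m] gc by (simp add: h_def)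
      have "det h = det g"
        unfolding h_def using gc by (subst det_four_block_mat_lower_left_zero_col[of _ _ ?m]) auto
      then have h: "h \<in> GL (Suc ?m)"
        using g hc by (simp add: GL_iff_det)
      obtain k where k: "k \<in> GL (Suc ?m)" "k * h = 1\<^sub>m (Suc ?m)"
        using h by (blast elim: GL_inverse)
      then have kc: "k \<in> carrier_mat (Suc ?m) (Suc ?m)"
        by (simp add: GL_iff_det)
      have h0: "h $$ (0, j) = (if j = 0 then 1 else 0)" "h $$ (Suc i, 0) = 0" "h $$ (Suc i, Suc j) = g $$ (i, j)"
        if "i < ?m" "j < ?m" for i j
        using that gc by (auto simp: h_def)
      have h00: "h $$ (0, Suc j) = 0" if "j < ?m" for j
        using that gc by (auto simp: h_def)
      have ht: "transpose_mat h * transpose_mat k = 1\<^sub>m (Suc ?m)"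
        using transpose_mult[OF kc hc] by (simp add: k(2))
      show "card (?F u) \<le> card (?F (g *\<^sub>v u))"
      proof (rule card_inj_on_le)
        have "k * (h * M * transpose_mat h) * transpose_mat k = M" if "M \<in> ?F u" for M
        proof -
          have M: "M \<in> carrier_mat (Suc ?m) (Suc ?m)"
            using that S(1) by blast
          note assoc = assoc_mult_mat[of _ "Suc ?m" "Suc ?m" _ "Suc ?m" _ "Suc ?m"]
          have tc: "transpose_mat h \<in> carrier_mat (Suc ?m) (Suc ?m)" "transpose_mat k \<in> carrier_mat (Suc ?m) (Suc ?m)"
            using hc kc by auto
          have "k * (h * M * transpose_mat h) * transpose_mat k = (k * h) * (M * (transpose_mat h * transpose_mat k))"
            using M hc kc tc by (simp add: assoc)
          then show ?thesis
            using M by (simp add: k(2) ht)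
        qed
        then show "inj_on (\<lambda>M. h * M * transpose_mat h) (?F u)"
          by (rule inj_on_inverseI)
        show "(\<lambda>M. h * M * transpose_mat h) ` ?F u \<subseteq> ?F (g *\<^sub>v u)"
        proof clarify
          fix M :: "'a mat" assume M: "M \<in> alternating (Suc ?m)" "M \<in> GL (Suc ?m)"
          then have Mc: "M \<in> carrier_mat (Suc ?m) (Suc ?m)"
            by (simp add: GL_iff_det)
          have "?f (h * M * transpose_mat h) = g *\<^sub>v ?f M"
          proof (rule eq_vecI)
            fix j assume "j < dim_vec (g *\<^sub>v ?f M)"
            then have j: "j < ?m"
              using gc by simp
            have row: "(h * M) $$ (0, l) = M $$ (0, l)" if "l < Suc ?m" for l
            proof -
              have "(h * M) $$ (0, l) = (\<Sum>k<Suc ?m. h $$ (0, k) * M $$ (k, l))"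
                using hc Mc that by (simp add: scalar_prod_def atLeast0LessThan del: sum.lessThan_Suc)
              also have "\<dots> = M $$ (0, l)"
                using h0(1)[of 0 0] by (subst sum.lessThan_Suc_shift) (simp add: h00 del: sum.lessThan_Suc)
              finally show ?thesis .
            qed
            have "(h * M * transpose_mat h) $$ (0, Suc j) = (\<Sum>l<Suc ?m. (h * M) $$ (0, l) * h $$ (Suc j, l))"
              by (subst mat_mult_index[of _ "Suc ?m" "Suc ?m" _ "Suc ?m"])
                (use hc Mc j in \<open>auto simp del: sum.lessThan_Suc assoc_mult_mat index_mult_mat(1) intro!: sum.cong\<close>)
            also have "\<dots> = (\<Sum>l<Suc ?m. M $$ (0, l) * h $$ (Suc j, l))"
              by (rule sum.cong) (simp_all add: row)
            also have "\<dots> = (\<Sum>l<?m. M $$ (0, Suc l) * g $$ (j, l))"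
              using j by (subst sum.lessThan_Suc_shift) (simp add: h0 del: sum.lessThan_Suc)
            also have "\<dots> = (g *\<^sub>v ?f M) $ j"
              using gc j by (simp add: scalar_prod_def atLeast0LessThan mult.commute del: sum.lessThan_Suc)
            finally show "?f (h * M * transpose_mat h) $ j = (g *\<^sub>v ?f M) $ j"
              using j by simp
          qed (use gc in simp)
          then show "h * M * transpose_mat h \<in> ?S \<and> ?f (h * M * transpose_mat h) = g *\<^sub>v ?f M"
            using M h hc by (simp add: alternating_congruence GL_mult GL_transpose)
        qed
        show "finite (?F (g *\<^sub>v u))"
          using finite_GL by (rule finite_subset[rotated]) blast
      qed
    qed (use v in auto)
    also have "?F (unit_vec ?m 0) = {M \<in> ?S. row M 0 = unit_vec (Suc ?m) 1}"
    proof (rule Collect_cong, rule conj_cong[OF refl])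
      fix M assume M: "M \<in> ?S"
      have "?f M = unit_vec ?m 0 \<longleftrightarrow> (\<forall>j<?m. M $$ (0, Suc j) = (if j = 0 then 1 else 0))"
        by (auto simp: vec_eq_iff)
      also have "\<dots> \<longleftrightarrow> (\<forall>j<Suc ?m. M $$ (0, j) = (if j = 1 then 1 else 0))"
        using S(4)[OF M] by (subst (2) All_less_Suc2) simp
      also have "\<dots> \<longleftrightarrow> row M 0 = unit_vec (Suc ?m) 1"
        using S(1)[OF M] by (auto simp: vec_eq_iff)
      finally show "?f M = unit_vec ?m 0 \<longleftrightarrow> row M 0 = unit_vec (Suc ?m) 1" .
    qed
    finally show "card (?F v) = q ^ n * card (alternating n \<inter> GL n :: 'a mat set)"
      by (simp only: card_alternating_unit_row)
  qed
  then show ?thesis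
    by (simp only: card_UNIV)
qed

lemma card_alternating_0: "card (alternating 0 \<inter> GL 0 :: 'a mat set) = 1"
proof -
  have "alternating 0 \<inter> GL 0 = {1\<^sub>m 0 :: 'a mat}"
    by (auto simp: GL_iff_det alternating_def intro!: eq_matI)
  then show ?thesis
    by simp
qed

end

text \<open>Both sides count the pairs \<open>(x, y)\<close> in \<open>P \<times> P\<close> with \<open>f (x \<sigma> y) = \<beta>\<close>.\<close>

lemma card_double_coset_fibre:
  fixes P :: "'a::field mat set" and \<sigma> :: "'a mat" and f :: "'a mat \<Rightarrow> 'b"
  assumes fin: "finite P" and Pc: "P \<subseteq> carrier_mat m m"
    and mult: "\<And>x y. x \<in> P \<Longrightarrow> y \<in> P \<Longrightarrow> x * y \<in> P"
    and inv: "\<And>x. x \<in> P \<Longrightarrow> \<exists>y\<in>P. x * y = 1\<^sub>m m \<and> y * x = 1\<^sub>m m"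
    and \<sigma>: "\<sigma> \<in> carrier_mat m m" "\<sigma> * \<sigma> = 1\<^sub>m m"
    and f: "\<And>x y. x \<in> carrier_mat m m \<Longrightarrow> y \<in> carrier_mat m m \<Longrightarrow> f (x * y) = f (y * x)"
  shows "card {w \<in> {x * \<sigma> * y | x y. x \<in> P \<and> y \<in> P}. f w = \<beta>} * card {z \<in> P. \<sigma> * z * \<sigma> \<in> P} =
    card P * card {p \<in> P. f (p * \<sigma>) = \<beta>}"
proof -
  define D where "D = {x * \<sigma> * y | x y. x \<in> P \<and> y \<in> P}"
  define T where "T = {(x, y) \<in> P \<times> P. f (x * \<sigma> * y) = \<beta>}"
  let ?Q = "{p \<in> P. f (p * \<sigma>) = \<beta>}" and ?R = "\<lambda>y. {x \<in> P. f (x * \<sigma> * y) = \<beta>}"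
  let ?W = "\<lambda>w. {xy \<in> T. (\<lambda>(x, y). x * \<sigma> * y) xy = w}" and ?Z = "{z \<in> P. \<sigma> * z * \<sigma> \<in> P}"
  obtain \<iota> where \<iota>: "\<And>x. x \<in> P \<Longrightarrow> \<iota> x \<in> P" "\<And>x. x \<in> P \<Longrightarrow> x * \<iota> x = 1\<^sub>m m" "\<And>x. x \<in> P \<Longrightarrow> \<iota> x * x = 1\<^sub>m m"
    using inv by metis
  have c: "x \<in> carrier_mat m m" if "x \<in> P" for x
    using that Pc by blast
  note mc = mult_carrier_mat[of _ m m _ m]
  note assoc = assoc_mult_mat[of _ m m _ m _ m]
  have cancel: "\<iota> x * (x * w) = w" "x * (\<iota> x * w) = w" "\<sigma> * (\<sigma> * w) = w"
    if "x \<in> P" "w \<in> carrier_mat m m" for x w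
    using that c \<iota> \<sigma> by (simp_all flip: assoc)
  have one [simp]: "x * 1\<^sub>m m = x" "1\<^sub>m m * x = x" if "x \<in> P" for x
    using c[OF that] by (simp_all only: right_mult_one_mat left_mult_one_mat)
  have finT: "finite T"
    by (rule finite_subset[of _ "P \<times> P"]) (use fin in \<open>auto simp: T_def\<close>)
  have "T = prod.swap ` (SIGMA y:P. (?R y))"
    by (auto simp: T_def image_iff)
  then have "card T = card (SIGMA y:P. (?R y))"
    by (simp add: card_image)
  also have "\<dots> = (\<Sum>y\<in>P. card (?R y))"
    using fin by (simp add: card_SigmaI)
  also have "\<dots> = (\<Sum>y\<in>P. card ?Q)"
  proof (rule sum.cong)
    fix y assume y: "y \<in> P"
    \<comment> \<open>Cyclic invariance moves \<open>y\<close> to the front, where left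
      multiplication by \<open>y\<close> permutes \<open>P\<close>.\<close>
    have ff: "f (x * \<sigma> * y) = f (y * x * \<sigma>)" if "x \<in> P" for x
    proof -
      have "x * \<sigma> \<in> carrier_mat m m"
        by (rule mult_carrier_mat[OF c[OF that] \<sigma>(1)])
      then have "f (x * \<sigma> * y) = f (y * (x * \<sigma>))"
        using y c by (intro f) auto
      then show ?thesis
        using that y c \<sigma> by (simp add: assoc)
    qed
    have "bij_betw (\<lambda>x. y * x) (?R y) ?Q"
      by (rule bij_betw_byWitness[where f' = "\<lambda>x. \<iota> y * x"])
        (use y c \<iota> mult ff in \<open>auto simp: cancel simp del: assoc_mult_mat\<close>)
    then show "card (?R y) = card ?Q"
      by (rule bij_betw_same_card)
  qed simp
  finally have T1: "card T = card P * card ?Q"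
    by simp
  have "D = (\<lambda>(x, y). x * \<sigma> * y) ` (P \<times> P)"
    by (auto simp: D_def)
  then have finD: "finite {w \<in> D. f w = \<beta>}"
    using fin by simp
  have "card T = (\<Sum>w\<in>{w \<in> D. f w = \<beta>}. card (?W w))"
    unfolding card_eq_sum by (rule sum.group[symmetric]) (use finT finD in \<open>auto simp: T_def D_def\<close>)
  also have "\<dots> = (\<Sum>w\<in>{w \<in> D. f w = \<beta>}. card ?Z)"
  proof (rule sum.cong)
    fix w assume w: "w \<in> {w \<in> D. f w = \<beta>}"
    then obtain x0 y0 where xy0: "x0 \<in> P" "y0 \<in> P" "w = x0 * \<sigma> * y0"
      by (auto simp: D_def)
    \<comment> \<open>From \<open>x * \<sigma> * y = x0 * \<sigma> * y0\<close> and
      \<open>z = \<iota> x * x0\<close> follows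
      \<open>\<sigma> * z * \<sigma> = y * \<iota> y0\<close>. So the factorizations of
      \<open>w\<close> form a torsor under the intersection of \<open>P\<close> with its conjugate
      by \<open>\<sigma>\<close>.\<close>
    have "bij_betw (\<lambda>z. (x0 * \<iota> z, \<sigma> * z * \<sigma> * y0)) ?Z
      (?W w)"
    proof (rule bij_betw_byWitness[where f' = "\<lambda>(x, y). \<iota> x * x0"])
      have prod_inv: "\<iota> (x * y) = \<iota> y * \<iota> x" if "x \<in> P" "y \<in> P" for x y
      proof -
        have "\<iota> (x * y) \<in> carrier_mat m m"
          by (rule c[OF \<iota>(1)[OF mult[OF that]]])
        moreover have "(x * y) * (\<iota> y * \<iota> x) = 1\<^sub>m m"
        proof -
          have cs: "x \<in> carrier_mat m m" "y \<in> carrier_mat m m" "\<iota> x \<in> carrier_mat m m" "\<iota> y \<in> carrier_mat m m"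
            using that by (simp_all add: c \<iota>(1))
          then have "(x * y) * (\<iota> y * \<iota> x) = x * (y * (\<iota> y * \<iota> x))"
            by (simp add: assoc)
          then show ?thesis
            using cs that by (simp only: cancel(2) \<iota>(2))
        qed
        ultimately have "\<iota> (x * y) = \<iota> (x * y) * ((x * y) * (\<iota> y * \<iota> x))"
          by (simp only: right_mult_one_mat)
        also have "\<dots> = \<iota> y * \<iota> x"
          using that c \<iota> mult by (intro cancel) auto
        finally show ?thesis .
      qed
      have inv_inv: "\<iota> (\<iota> x) = x" if "x \<in> P" for x
      proof -
        have "\<iota> (\<iota> x) \<in> carrier_mat m m"
          by (rule c[OF \<iota>(1)[OF \<iota>(1)[OF that]]])
        then have "\<iota> (\<iota> x) = \<iota> (\<iota> x) * (\<iota> x * x)"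
          by (simp only: \<iota>(3)[OF that] right_mult_one_mat)
        also have "\<dots> = x"
          using that c \<iota> by (intro cancel) auto
        finally show ?thesis .
      qed
      show "\<forall>z\<in>?Z. (case (x0 * \<iota> z, \<sigma> * z * \<sigma> * y0) of (x, y) \<Rightarrow> \<iota> x * x0) = z"
        using xy0 c \<iota> by (auto simp: prod_inv inv_inv assoc)
      show "\<forall>xy\<in>(?W w).
          (x0 * \<iota> (case xy of (x, y) \<Rightarrow> \<iota> x * x0), \<sigma> * (case xy of (x, y) \<Rightarrow> \<iota> x * x0) * \<sigma> * y0) = xy"
      proof
        fix xy assume xyT: "xy \<in> (?W w)"
        obtain x y where p: "xy = (x, y)"
          by (cases xy)
        from xyT have xy: "x \<in> P" "y \<in> P" and eq: "x * \<sigma> * y = x0 * \<sigma> * y0"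
          by (auto simp: T_def xy0 p)
        have cs: "x \<in> carrier_mat m m" "y \<in> carrier_mat m m" "x0 \<in> carrier_mat m m" "y0 \<in> carrier_mat m m"
            "\<iota> x \<in> carrier_mat m m" "\<iota> y0 \<in> carrier_mat m m"
          using xy xy0 by (simp_all add: c \<iota>(1))
        have "\<sigma> * (\<iota> x * x0) * \<sigma> * y0 = \<sigma> * (\<iota> x * (x0 * \<sigma> * y0))"
          using cs \<sigma> by (simp add: assoc mc)
        also have "\<dots> = y"
          unfolding eq[symmetric] using xy cs \<sigma> by (simp add: assoc mc cancel)
        finally have "\<sigma> * (\<iota> x * x0) * \<sigma> * y0 = y" .
        then show "(x0 * \<iota> (case xy of (x, y) \<Rightarrow> \<iota> x * x0), \<sigma> * (case xy of (x, y) \<Rightarrow> \<iota> x * x0) * \<sigma> * y0) = xy"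
          unfolding p using xy xy0 cs \<iota>(1) by (simp only: prod.case) (simp add: prod_inv inv_inv cancel del: assoc_mult_mat)
      qed
      show "(\<lambda>z. (x0 * \<iota> z, \<sigma> * z * \<sigma> * y0)) ` ?Z \<subseteq> (?W w)"
      proof (rule image_subsetI)
        fix z assume "z \<in> ?Z"
        then have z: "z \<in> P" "\<sigma> * z * \<sigma> \<in> P"
          by auto
        have "x0 * \<iota> z * \<sigma> * (\<sigma> * z * \<sigma> * y0) = w"
        proof -
          have cs: "x0 \<in> carrier_mat m m" "y0 \<in> carrier_mat m m" "z \<in> carrier_mat m m" "\<iota> z \<in> carrier_mat m m"
            using z(1) xy0 by (simp_all add: c \<iota>(1))
          then show ?thesis
            using z(1) \<sigma> by (simp add: xy0(3) assoc mc cancel)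
        qed
        moreover have "x0 * \<iota> z \<in> P" "\<sigma> * z * \<sigma> * y0 \<in> P"
          using z xy0 \<iota> mult by auto
        ultimately show "(x0 * \<iota> z, \<sigma> * z * \<sigma> * y0) \<in> (?W w)"
          using w by (simp add: T_def del: assoc_mult_mat)
      qed
      show "(\<lambda>(x, y). \<iota> x * x0) ` (?W w) \<subseteq> ?Z"
      proof (rule image_subsetI)
        fix xy assume xyT: "xy \<in> (?W w)"
        obtain x y where p: "xy = (x, y)"
          by (cases xy)
        from xyT have xy: "x \<in> P" "y \<in> P" and eq: "x0 * \<sigma> * y0 = x * \<sigma> * y"
          by (auto simp: T_def xy0 p)
        have cs: "x \<in> carrier_mat m m" "y \<in> carrier_mat m m" "x0 \<in> carrier_mat m m" "y0 \<in> carrier_mat m m"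
            "\<iota> x \<in> carrier_mat m m" "\<iota> y0 \<in> carrier_mat m m"
          using xy xy0 by (simp_all add: c \<iota>(1))
        have "\<sigma> * (\<iota> x * x0) * \<sigma> = \<sigma> * (\<iota> x * (x0 * \<sigma> * y0 * \<iota> y0))"
          using xy xy0 cs \<sigma> by (simp add: assoc mc cancel \<iota>)
        also have "\<dots> = y * \<iota> y0"
          unfolding eq using xy xy0 cs \<sigma> by (simp add: assoc mc cancel)
        finally have "\<sigma> * (\<iota> x * x0) * \<sigma> = y * \<iota> y0" .
        then show "(\<lambda>(x, y). \<iota> x * x0) xy \<in> ?Z"
          using xy xy0 \<iota> mult by (simp add: p)
      qed
    qed
    then show "card (?W w) = card ?Z"
      by (simp add: bij_betw_same_card)
  qed simp
  finally have "card T = card {w \<in> D. f w = \<beta>} * card ?Z"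
    by simp
  with T1 show ?thesis
    by (simp add: D_def)
qed

section \<open>The parabolic subgroup\<close>

definition GL_inv :: "'a::field mat \<Rightarrow> 'a mat" where
  "GL_inv A = (SOME B. B \<in> GL (dim_row A) \<and> A * B = 1\<^sub>m (dim_row A) \<and> B * A = 1\<^sub>m (dim_row A))"

lemma GL_inv:
  assumes "A \<in> GL n"
  shows "GL_inv A \<in> GL n" "A * GL_inv A = 1\<^sub>m n" "GL_inv A * A = (1\<^sub>m n :: 'a::field mat)"
proof -
  have "dim_row A = n"
    using assms by (auto simp: GL_iff_det)
  moreover have "\<exists>B. B \<in> GL n \<and> A * B = 1\<^sub>m n \<and> B * A = 1\<^sub>m n"
    using assms by (blast elim: GL_inverse)
  ultimately show "GL_inv A \<in> GL n" "A * GL_inv A = 1\<^sub>m n" "GL_inv A * A = 1\<^sub>m n"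
    unfolding GL_inv_def by (metis (mono_tags, lifting) someI_ex)+
qed

lemma GL_inv_eqI:
  assumes "A \<in> GL n" "B \<in> carrier_mat n n" "A * B = (1\<^sub>m n :: 'a::field mat)"
  shows "GL_inv A = B"
proof -
  have c: "A \<in> carrier_mat n n" "GL_inv A \<in> carrier_mat n n"
    using assms GL_inv(1)[OF assms(1)] by (auto simp: GL_iff_det)
  have "GL_inv A = GL_inv A * (A * B)"
    using c by (simp add: assms(3))
  also have "\<dots> = (GL_inv A * A) * B"
    using c assms(2) by (simp add: assoc_mult_mat[of _ n n _ n _ n])
  also have "\<dots> = B"
    using assms by (simp add: GL_inv)
  finally show ?thesis .
qed

lemma GL_carrier: "A \<in> GL n \<Longrightarrow> A \<in> carrier_mat n n"
  by (simp add: GL_def)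

lemma GL_I: "A \<in> carrier_mat n n \<Longrightarrow> B \<in> carrier_mat n n \<Longrightarrow> A * B = 1\<^sub>m n \<Longrightarrow> A \<in> (GL n :: 'a::field mat set)"
  by (metis GL_iff_det det_mult det_one mult_zero_left one_neq_zero)

lemma J_mat_carrier: "J_mat n \<in> carrier_mat (n + n) (n + n)"
  unfolding J_mat_def by (rule four_block_carrier_mat) auto

lemma inverts_mat_GL:
  assumes "A \<in> carrier_mat n n" "B \<in> carrier_mat n n" "inverts_mat A B" "inverts_mat B A"
  shows "A \<in> (GL n :: 'a::field mat set)" "GL_inv A = B"
proof -
  have "A * B = 1\<^sub>m n"
    using assms by (simp add: inverts_mat_def)
  then show "A \<in> GL n" "GL_inv A = B"
    using assms GL_I GL_inv_eqI by blast+
qed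

text \<open>The two factors in \<open>parabolic\<close>, multiplied out. The parameter remains the
  symmetric \<open>B\<close>, not the block \<open>A * B\<close>, so that \<open>(A, B)\<close> are
  coordinates on \<open>GL n \<times> symmetric n\<close>.\<close>

definition parabolic_mat :: "'a::field mat \<Rightarrow> 'a mat \<Rightarrow> 'a mat" where
  "parabolic_mat A B = four_block_mat A (A * B) (0\<^sub>m (dim_row A) (dim_row A)) (transpose_mat (GL_inv A))"

lemma parabolic_mat_carrier:
  assumes "A \<in> GL n" "B \<in> carrier_mat n n"
  shows "parabolic_mat A B \<in> carrier_mat (n + n) (n + n)"
  unfolding parabolic_mat_def using assms GL_inv(1)[OF assms(1)]
  by (intro four_block_carrier_mat) (auto dest: GL_carrier)

lemma parabolic_eq: "parabolic n = (\<lambda>(A, B). parabolic_mat A B) ` (GL n \<times> (symmetric n :: 'a::field mat set))"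
proof -
  have eq: "four_block_mat A (0\<^sub>m n n) (0\<^sub>m n n) (transpose_mat A') * four_block_mat (1\<^sub>m n) B (0\<^sub>m n n) (1\<^sub>m n) =
      four_block_mat A (A * B) (0\<^sub>m n n) (transpose_mat A')"
    if "A \<in> carrier_mat n n" "A' \<in> carrier_mat n n" "B \<in> carrier_mat n n" for A A' B :: "'a mat"
    using that by (subst mult_four_block_mat[of _ n n _ n _ n _ _ n _ n]) auto
  show ?thesis
  proof (intro equalityI subsetI)
    fix w :: "'a mat" assume "w \<in> parabolic n"
    then obtain A A' B where w: "w = four_block_mat A (0\<^sub>m n n) (0\<^sub>m n n) (transpose_mat A') * four_block_mat (1\<^sub>m n) B (0\<^sub>m n n) (1\<^sub>m n)"
      and A: "A \<in> GL n" "A' \<in> carrier_mat n n" "inverts_mat A A'" "inverts_mat A' A" and B: "B \<in> symmetric n"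
      unfolding parabolic_def symmetric_def by blast
    have "GL_inv A = A'"
      using A by (intro inverts_mat_GL) (auto dest: GL_carrier)
    then have "w = parabolic_mat A B"
      unfolding w using A B by (subst eq) (auto simp: parabolic_mat_def symmetric_def dest!: GL_carrier)
    then show "w \<in> (\<lambda>(A, B). parabolic_mat A B) ` (GL n \<times> symmetric n)"
      using A B by auto
  next
    fix w assume "w \<in> (\<lambda>(A, B). parabolic_mat A B) ` (GL n \<times> (symmetric n :: 'a mat set))"
    then obtain A B where A: "A \<in> GL n" and B: "B \<in> carrier_mat n n" "transpose_mat B = B" and w: "w = parabolic_mat A B"
      by (auto simp: symmetric_def)
    have c: "A \<in> carrier_mat n n" "GL_inv A \<in> carrier_mat n n"
      using A GL_inv(1) by (auto dest: GL_carrier)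
    have "inverts_mat A (GL_inv A)" "inverts_mat (GL_inv A) A"
      using c GL_inv[OF A] by (simp_all add: inverts_mat_def)
    moreover have "w = four_block_mat A (0\<^sub>m n n) (0\<^sub>m n n) (transpose_mat (GL_inv A)) * four_block_mat (1\<^sub>m n) B (0\<^sub>m n n) (1\<^sub>m n)"
      using c B by (subst eq) (auto simp: w parabolic_mat_def)
    ultimately show "w \<in> parabolic n"
      unfolding parabolic_def using A B c by blast
  qed
qed

lemma inj_on_parabolic_mat: "inj_on (\<lambda>(A, B). parabolic_mat A B) (GL n \<times> (symmetric n :: 'a::field mat set))"
proof (rule inj_onI, clarify)
  fix A B A' B' :: "'a mat"
  assume A: "A \<in> GL n" "A' \<in> GL n" and B: "B \<in> symmetric n" "B' \<in> symmetric n"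
    and eq: "parabolic_mat A B = parabolic_mat A' B'"
  have c: "A \<in> carrier_mat n n" "A' \<in> carrier_mat n n" "GL_inv A \<in> carrier_mat n n" "GL_inv A' \<in> carrier_mat n n"
      "B \<in> carrier_mat n n" "B' \<in> carrier_mat n n"
    using A B GL_inv(1) by (auto simp: symmetric_def dest: GL_carrier)
  have "A = A' \<and> A * B = A' * B'"
    using eq c by (auto simp: parabolic_mat_def four_block_mat_eq_iff[of _ n n _ n _ n])
  then have AA: "A' = A" and AB: "A * B = A * B'"
    by auto
  have "GL_inv A * (A * X) = X" if "X \<in> carrier_mat n n" for X
    using that c GL_inv[OF A(1)] by (simp flip: assoc_mult_mat[of _ n n _ n _ n])
  then show "A = A' \<and> B = B'"
    using AA AB c by metis
qed

lemma finite_symmetric: "finite (symmetric n :: 'a::{field,finite} mat set)"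
  by (rule finite_subset[OF _ finite_carrier_mat[of n n]]) (auto simp: symmetric_def)

lemma card_parabolic_filter:
  "card {w \<in> parabolic n. Q w} = card {(A, B). A \<in> GL n \<and> B \<in> symmetric n \<and> Q (parabolic_mat A (B :: 'a::field mat))}"
proof -
  have "{w \<in> parabolic n. Q w} =
    (\<lambda>(A, B). parabolic_mat A B) ` {(A, B). A \<in> GL n \<and> B \<in> symmetric n \<and> Q (parabolic_mat A B)}"
    unfolding parabolic_eq by auto
  moreover have "inj_on (\<lambda>(A, B). parabolic_mat A B) {(A, B). A \<in> GL n \<and> B \<in> symmetric n \<and> Q (parabolic_mat A B)}"
    by (rule inj_on_subset[OF inj_on_parabolic_mat[of n]]) auto
  ultimately show ?thesis
    by (simp add: card_image)
qed

text \<open>\<open>sigma n s\<close> is the permutation matrix of this involution, so products with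
  it become substitutions of indices.\<close>

definition sigma_perm :: "nat \<Rightarrow> nat \<Rightarrow> nat \<Rightarrow> nat" where
  "sigma_perm n s i = (if i < s then n + i else if n \<le> i \<and> i < n + s then i - n else i)"

lemma sigma_carrier: "s \<le> n \<Longrightarrow> sigma n s \<in> carrier_mat (n + n) (n + n)"
  unfolding sigma_def by (intro carrier_matI) simp_all

lemma block_cases:
  fixes s n i :: nat
  assumes "s \<le> n" "i < n + n"
  obtains "i < s" | "s \<le> i" "i < n" | i' where "i = n + i'" "i' < s" | i' where "i = n + i'" "s \<le> i'" "i' < n"
  using assms by (metis add_less_cancel_left le_Suc_ex not_le)

lemma sigma_index:
  assumes "s \<le> n" "i < n + n" "j < n + n"
  shows "sigma n s $$ (i, j) = (if j = sigma_perm n s i then 1 else (0 :: 'a::field))"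
  by (rule block_cases[OF assms(1,2)]; rule block_cases[OF assms(1,3)];
    use assms(1) in \<open>auto simp: sigma_def sigma_perm_def\<close>)

lemma sigma_perm_less: "s \<le> n \<Longrightarrow> i < n + n \<Longrightarrow> sigma_perm n s i < n + n"
  by (auto simp: sigma_perm_def)

lemma sigma_perm_invol: "s \<le> n \<Longrightarrow> sigma_perm n s (sigma_perm n s i) = i"
  by (auto simp: sigma_perm_def)

lemma sigma_perm_eq_iff: "s \<le> n \<Longrightarrow> j = sigma_perm n s i \<longleftrightarrow> i = sigma_perm n s j"
  by (metis sigma_perm_invol)

lemma mult_sigma_index:
  assumes "s \<le> n" "w \<in> carrier_mat m (n + n)" "i < m" "j < n + n"
  shows "(w * sigma n s) $$ (i, j) = (w $$ (i, sigma_perm n s j) :: 'a::field)"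
proof -
  have "(w * sigma n s) $$ (i, j) = (\<Sum>k<n + n. w $$ (i, k) * sigma n s $$ (k, j))"
    using assms sigma_carrier by (intro mat_mult_index) auto
  also have "\<dots> = (\<Sum>k<n + n. if k = sigma_perm n s j then w $$ (i, k) else 0)"
    by (rule sum.cong) (use assms in \<open>auto simp: sigma_index sigma_perm_eq_iff[of s n j]\<close>)
  also have "\<dots> = w $$ (i, sigma_perm n s j)"
    using assms by (simp add: sigma_perm_less)
  finally show ?thesis .
qed

lemma sigma_mult_index:
  assumes "s \<le> n" "w \<in> carrier_mat (n + n) m" "i < n + n" "j < m"
  shows "(sigma n s * w) $$ (i, j) = (w $$ (sigma_perm n s i, j) :: 'a::field)"
proof -
  have "(sigma n s * w) $$ (i, j) = (\<Sum>k<n + n. sigma n s $$ (i, k) * w $$ (k, j))"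
    using assms sigma_carrier by (intro mat_mult_index) auto
  also have "\<dots> = (\<Sum>k<n + n. if k = sigma_perm n s i then w $$ (k, j) else 0)"
    by (rule sum.cong) (use assms in \<open>auto simp: sigma_index\<close>)
  also have "\<dots> = w $$ (sigma_perm n s i, j)"
    using assms by (simp add: sigma_perm_less)
  finally show ?thesis .
qed

lemma sigma_conj_index:
  assumes "s \<le> n" "w \<in> carrier_mat (n + n) (n + n)" "i < n + n" "j < n + n"
  shows "(sigma n s * w * sigma n s) $$ (i, j) = (w $$ (sigma_perm n s i, sigma_perm n s j) :: 'a::field)"
proof -
  have "sigma n s * w \<in> carrier_mat (n + n) (n + n)"
    using sigma_carrier[OF assms(1)] assms(2) by (rule mult_carrier_mat)
  then show ?thesis
    using assms by (simp add: mult_sigma_index sigma_mult_index sigma_perm_less del: assoc_mult_mat index_mult_mat(1))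
qed

lemma sigma_sigma: "s \<le> n \<Longrightarrow> sigma n s * sigma n s = (1\<^sub>m (n + n) :: 'a::field mat)"
  using sigma_carrier[of s n, where 'a = 'a]
  by (intro eq_matI) (auto simp: mult_sigma_index sigma_index sigma_perm_less sigma_perm_eq_iff[of s n] sigma_perm_invol
      simp del: index_mult_mat(1))

lemma transpose_sigma: "s \<le> n \<Longrightarrow> transpose_mat (sigma n s) = (sigma n s :: 'a::field mat)"
  using sigma_carrier[of s n, where 'a = 'a]
  by (intro eq_matI) (auto simp: sigma_index sigma_perm_eq_iff[of s n])

text \<open>\<open>sigma_perm\<close> commutes with the exchange of \<open>i\<close> and
  \<open>n + i\<close> for all \<open>i < n\<close>, whose permutation matrix is
  \<open>J_mat n\<close>.\<close>

lemma sigma_J_sigma: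
  assumes "s \<le> n"
  shows "sigma n s * J_mat n * sigma n s = (J_mat n :: 'a::field mat)"
proof (rule eq_matI)
  fix i j assume "i < dim_row (J_mat n :: 'a mat)" "j < dim_col (J_mat n :: 'a mat)"
  then have ij: "i < n + n" "j < n + n"
    using J_mat_carrier[of n, where 'a = 'a] by auto
  show "(sigma n s * J_mat n * sigma n s) $$ (i, j) = (J_mat n :: 'a mat) $$ (i, j)"
    unfolding sigma_conj_index[OF assms J_mat_carrier ij]
    by (rule block_cases[OF assms ij(1)]; rule block_cases[OF assms ij(2)];
      use assms in \<open>auto simp: J_mat_def sigma_perm_def\<close>)
qed (use J_mat_carrier[of n, where 'a = 'a] sigma_carrier[OF assms, where 'a = 'a] in auto)

lemma mat_tr_comm:
  assumes "A \<in> carrier_mat m m" "B \<in> carrier_mat m m"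
  shows "mat_tr (A * B) = mat_tr (B * A :: 'a::comm_ring_1 mat)"
proof -
  have "mat_tr (A * B) = (\<Sum>i<m. \<Sum>k<m. A $$ (i, k) * B $$ (k, i))"
    using assms by (simp add: mat_tr_def mat_mult_index[of _ m m _ m] del: index_mult_mat(1))
  also have "\<dots> = (\<Sum>k<m. \<Sum>i<m. A $$ (i, k) * B $$ (k, i))"
    by (rule sum.swap)
  also have "\<dots> = mat_tr (B * A)"
    using assms by (simp add: mat_tr_def mat_mult_index[of _ m m _ m] mult.commute del: index_mult_mat(1))
  finally show ?thesis .
qed

section \<open>The parabolic subgroup inside the symplectic group\<close>

context binary_field
begin

text \<open>With lower left block zero, diagonal blocks \<open>A\<close>, \<open>E\<close> and upper
  right block \<open>X\<close>, the symplectic condition says that the transpose of \<open>E\<close>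
  inverts \<open>A\<close> and that its product with \<open>X\<close> is symmetric; this product is
  the parameter \<open>B\<close>. The implicit description makes closure properties easy to
  check.\<close>

lemma parabolic_iff:
  "w \<in> parabolic n \<longleftrightarrow> w \<in> carrier_mat (n + n) (n + n) \<and> transpose_mat w * J_mat n * w = J_mat n \<and>
    (\<forall>i<n. \<forall>j<n. w $$ (n + i, j) = (0 :: 'a))"
proof
  assume w: "w \<in> parabolic n"
  then have "w \<in> Sp n"
    using parabolic_subset_Sp[OF two] by blast
  then have "w \<in> carrier_mat (n + n) (n + n)" "transpose_mat w * J_mat n * w = J_mat n"
    by (auto simp: Sp_def GL_def mult_2)
  moreover obtain A B where "A \<in> GL n" "B \<in> symmetric n" "w = parabolic_mat A B"
    using w by (auto simp: parabolic_eq)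
  then have "\<forall>i<n. \<forall>j<n. w $$ (n + i, j) = 0"
    using GL_inv(1)[of A n] by (auto simp: parabolic_mat_def dest!: GL_carrier)
  ultimately show "w \<in> carrier_mat (n + n) (n + n) \<and> transpose_mat w * J_mat n * w = J_mat n \<and>
    (\<forall>i<n. \<forall>j<n. w $$ (n + i, j) = 0)"
    by blast
next
  assume w: "w \<in> carrier_mat (n + n) (n + n) \<and> transpose_mat w * J_mat n * w = J_mat n \<and>
    (\<forall>i<n. \<forall>j<n. w $$ (n + i, j) = 0)"
  then obtain A X Z E where b: "w = four_block_mat A X Z E" and c: "A \<in> carrier_mat n n" "X \<in> carrier_mat n n"
      "Z \<in> carrier_mat n n" "E \<in> carrier_mat n n"
    by (elim conjE four_block_mat_cases)
  have "Z $$ (i, j) = 0" if "i < n" "j < n" for i j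
  proof -
    have "w $$ (n + i, j) = Z $$ (i, j)"
      using that c by (simp add: b)
    then show ?thesis
      using w that by simp
  qed
  then have Z: "Z = 0\<^sub>m n n"
    using c by (intro eq_matI) auto
  let ?A = "transpose_mat A" and ?X = "transpose_mat X" and ?E = "transpose_mat E"
  have tc: "?A \<in> carrier_mat n n" "?X \<in> carrier_mat n n" "?E \<in> carrier_mat n n"
    using c by auto
  have tw: "transpose_mat w = four_block_mat ?A (0\<^sub>m n n) ?X ?E"
    unfolding b Z using c by (subst transpose_four_block_mat[of _ n n _ n _ n]) auto
  have "transpose_mat w * J_mat n * w = four_block_mat (0\<^sub>m n n) (?A * E) (?E * A) (?E * X + ?X * E)"
    unfolding tw J_mat_def unfolding b Z using c tc
    by (simp add: mult_four_block_mat[of _ n n _ n _ n _ _ n _ n])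
  then have "four_block_mat (0\<^sub>m n n) (?A * E) (?E * A) (?E * X + ?X * E) =
      four_block_mat (0\<^sub>m n n) (1\<^sub>m n) (1\<^sub>m n) (0\<^sub>m n n)"
    using w by (simp add: J_mat_def)
  then have eqs: "?A * E = 1\<^sub>m n" "?E * A = 1\<^sub>m n" "?E * X + ?X * E = 0\<^sub>m n n"
    using c tc by (subst (asm) four_block_mat_eq_iff[of _ n n _ n _ n]; auto)+
  have AE: "A * ?E = 1\<^sub>m n"
    using mat_mult_left_right_inverse[OF tc(3) c(1) eqs(2)] .
  have A: "A \<in> GL n" and inv: "GL_inv A = ?E"
    using GL_I[OF c(1) tc(3) AE] GL_inv_eqI[OF _ tc(3) AE] by auto
  have "?E * X \<in> symmetric n"
  proof (rule symmetricI)
    fix i j assume ij: "i < n" "j < n"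
    have t: "transpose_mat (?E * X) = ?X * E"
      using c tc by (simp add: transpose_mult[of ?E n n X n])
    have "(?E * X + ?X * E) $$ (i, j) = 0"
      using ij by (simp add: eqs(3))
    then have "(?E * X) $$ (i, j) = (?X * E) $$ (i, j)"
      using ij c tc add_eq_0 by (simp del: index_mult_mat(1))
    also have "\<dots> = (?E * X) $$ (j, i)"
      unfolding t[symmetric] using ij c by (simp del: index_mult_mat(1))
    finally show "(?E * X) $$ (i, j) = (?E * X) $$ (j, i)" .
  qed (use c tc in auto)
  moreover have "w = parabolic_mat A (?E * X)"
  proof -
    have "A * (?E * X) = X"
      using c tc AE by (simp flip: assoc_mult_mat[of A n n ?E n X n])
    then show ?thesis
      using c by (simp add: b Z parabolic_mat_def inv)
  qed
  ultimately show "w \<in> parabolic n"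
    using A by (auto simp: parabolic_eq)
qed

lemma parabolic_carrier: "w \<in> parabolic n \<Longrightarrow> (w :: 'a mat) \<in> carrier_mat (n + n) (n + n)"
  by (simp add: parabolic_iff)

lemma parabolic_mult:
  assumes x: "x \<in> parabolic n" and y: "y \<in> parabolic n"
  shows "x * y \<in> (parabolic n :: 'a mat set)"
proof -
  note assoc = assoc_mult_mat[of _ "n + n" "n + n" _ "n + n" _ "n + n"]
  have c: "x \<in> carrier_mat (n + n) (n + n)" "y \<in> carrier_mat (n + n) (n + n)" "(J_mat n :: 'a mat) \<in> carrier_mat (n + n) (n + n)"
    using x y J_mat_carrier by (auto dest: parabolic_carrier)
  have tc: "transpose_mat x \<in> carrier_mat (n + n) (n + n)" "transpose_mat y \<in> carrier_mat (n + n) (n + n)"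
    using c by auto
  have xJ: "transpose_mat x * (J_mat n * x) = J_mat n" and yJ: "transpose_mat y * (J_mat n * y) = J_mat n"
    using x y c tc by (simp_all add: parabolic_iff assoc)
  have "transpose_mat (x * y) * J_mat n * (x * y) = transpose_mat y * (transpose_mat x * (J_mat n * x) * y)"
    using c tc by (simp add: assoc transpose_mult[of _ "n + n" "n + n" _ "n + n"])
  also have "\<dots> = J_mat n"
    unfolding xJ yJ ..
  finally have J: "transpose_mat (x * y) * J_mat n * (x * y) = J_mat n" .
  have "(x * y) $$ (n + i, j) = 0" if "i < n" "j < n" for i j
  proof -
    have "(x * y) $$ (n + i, j) = (\<Sum>k<n + n. x $$ (n + i, k) * y $$ (k, j))"
      using c that by (intro mat_mult_index[of _ "n + n" "n + n" _ "n + n"]) auto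
    also have "\<dots> = 0"
    proof (rule sum.neutral, rule ballI)
      fix k assume "k \<in> {..<n + n}"
      then consider "k < n" | k' where "k = n + k'" "k' < n"
        by (metis add_less_cancel_left le_Suc_ex lessThan_iff not_le)
      then show "x $$ (n + i, k) * y $$ (k, j) = 0"
        using x y that by cases (auto simp: parabolic_iff)
    qed
    finally show ?thesis .
  qed
  then show ?thesis
    using J c by (simp add: parabolic_iff del: index_mult_mat(1))
qed

lemma parabolic_inverse:
  assumes w: "w \<in> parabolic n"
  shows "\<exists>v\<in>parabolic n. w * v = 1\<^sub>m (n + n) \<and> v * w = (1\<^sub>m (n + n) :: 'a mat)"
proof -
  note assoc = assoc_mult_mat[of _ "n + n" "n + n" _ "n + n" _ "n + n"]
  have "w \<in> GL (n + n)"
    using w parabolic_subset_Sp[OF two, of n] by (auto simp: Sp_def mult_2)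
  then obtain v where v: "v \<in> GL (n + n)" "w * v = 1\<^sub>m (n + n)" "v * w = 1\<^sub>m (n + n)"
    by (rule GL_inverse)
  have c: "w \<in> carrier_mat (n + n) (n + n)" "v \<in> carrier_mat (n + n) (n + n)" "(J_mat n :: 'a mat) \<in> carrier_mat (n + n) (n + n)"
    using w v J_mat_carrier by (auto dest: parabolic_carrier GL_carrier)
  have tc: "transpose_mat w \<in> carrier_mat (n + n) (n + n)" "transpose_mat v \<in> carrier_mat (n + n) (n + n)"
    using c by auto
  have tvw: "transpose_mat v * transpose_mat w = 1\<^sub>m (n + n)"
    using transpose_mult[OF c(1,2)] v(2) by simp
  have wJ: "transpose_mat w * J_mat n * w = J_mat n"
    using w by (simp add: parabolic_iff)
  have "transpose_mat v * J_mat n * v = transpose_mat v * (transpose_mat w * J_mat n * w) * v"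
    by (simp only: wJ)
  also have "\<dots> = (transpose_mat v * transpose_mat w) * (J_mat n * (w * v))"
    using c tc by (simp add: assoc)
  also have "\<dots> = J_mat n"
    using c by (simp add: tvw v(2))
  finally have J: "transpose_mat v * J_mat n * v = J_mat n" .
  obtain A B where AB: "A \<in> GL n" "B \<in> symmetric n" and wAB: "w = parabolic_mat A B"
    using w by (auto simp: parabolic_eq)
  define E where "E = transpose_mat (GL_inv A)"
  have Ac: "A \<in> carrier_mat n n" "A * B \<in> carrier_mat n n" "E \<in> carrier_mat n n"
    using AB GL_inv(1)[OF AB(1)] by (auto simp: symmetric_def E_def dest!: GL_carrier)
  have AE: "transpose_mat A * E = 1\<^sub>m n"
    unfolding E_def using transpose_mult[of "GL_inv A" n n A n] GL_inv[OF AB(1)] Ac by (auto dest: GL_carrier)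
  from c(2) obtain A1 X1 C1 E1 where b: "v = four_block_mat A1 X1 C1 E1" and c1: "A1 \<in> carrier_mat n n" "X1 \<in> carrier_mat n n"
      "C1 \<in> carrier_mat n n" "E1 \<in> carrier_mat n n"
    by (rule four_block_mat_cases)
  have "E * C1 = 0\<^sub>m n n"
  proof -
    have "w * v = four_block_mat (A * A1 + A * B * C1) (A * X1 + A * B * E1) (E * C1) (E * E1)"
      unfolding b wAB parabolic_mat_def E_def[symmetric] using Ac c1
      by (simp add: mult_four_block_mat[of _ n n _ n _ n _ _ n _ n])
    also have "w * v = four_block_mat (1\<^sub>m n) (0\<^sub>m n n) (0\<^sub>m n n) (1\<^sub>m n)"
      unfolding v by (rule eq_matI) auto
    finally show ?thesis
      using Ac c1 by (subst (asm) four_block_mat_eq_iff[of _ n n _ n _ n]) auto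
  qed
  then have "transpose_mat A * (E * C1) = 0\<^sub>m n n"
    using Ac by simp
  then have "C1 = 0\<^sub>m n n"
    using Ac c1 AE by (simp flip: assoc_mult_mat[of _ n n _ n _ n])
  then have "v \<in> parabolic n"
    using J c c1 by (auto simp: parabolic_iff b)
  then show ?thesis
    using v by blast
qed

lemma finite_parabolic: "finite (parabolic n :: 'a mat set)"
  by (rule finite_subset[OF _ finite_carrier_mat[of "n + n" "n + n"]]) (auto dest: parabolic_carrier)

text \<open>\<open>sigma\<close> preserves \<open>J_mat\<close>, so the conjugate is always
  symplectic and only its lower left block has to be tested.\<close>

lemma sigma_conj_parabolic_iff:
  assumes "s \<le> n" and z: "z \<in> parabolic n"
  shows "sigma n s * z * sigma n s \<in> parabolic n \<longleftrightarrow>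
    (\<forall>i<n. \<forall>j<n. z $$ (sigma_perm n s (n + i), sigma_perm n s j) = (0 :: 'a))"
proof -
  let ?g = "sigma n s :: 'a mat"
  note assoc = assoc_mult_mat[of _ "n + n" "n + n" _ "n + n" _ "n + n"]
  have c: "z \<in> carrier_mat (n + n) (n + n)" "?g \<in> carrier_mat (n + n) (n + n)" "(J_mat n :: 'a mat) \<in> carrier_mat (n + n) (n + n)"
    using z sigma_carrier[OF assms(1)] J_mat_carrier by (auto dest: parabolic_carrier)
  have tc: "transpose_mat z \<in> carrier_mat (n + n) (n + n)"
    using c by auto
  have gJ: "?g * (J_mat n * ?g) = J_mat n" and zJ: "transpose_mat z * (J_mat n * z) = J_mat n"
    using sigma_J_sigma[OF assms(1), where 'a = 'a] z c tc by (simp_all add: assoc parabolic_iff)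
  have "transpose_mat (?g * z * ?g) = ?g * (transpose_mat z * ?g)"
    using c tc by (simp add: transpose_mult[of _ "n + n" "n + n" _ "n + n"] transpose_sigma[OF assms(1)])
  then have "transpose_mat (?g * z * ?g) * J_mat n * (?g * z * ?g) = ?g * (transpose_mat z * ((?g * (J_mat n * ?g)) * (z * ?g)))"
    using c tc by (simp add: assoc)
  also have "\<dots> = ?g * ((transpose_mat z * (J_mat n * z)) * ?g)"
    unfolding gJ using c tc by (simp add: assoc)
  also have "\<dots> = J_mat n"
    unfolding zJ gJ ..
  finally have "transpose_mat (?g * z * ?g) * J_mat n * (?g * z * ?g) = J_mat n" .
  moreover have "?g * z * ?g \<in> carrier_mat (n + n) (n + n)"
    using c by simp
  ultimately show ?thesis
    using sigma_conj_index[OF assms(1) c(1)] by (simp add: parabolic_iff del: assoc_mult_mat index_mult_mat(1))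
qed

end

section \<open>Traces on the double coset\<close>

text \<open>\<open>L\<close> restricts the upper left block: \<open>UNIV\<close> describes the
  stabilizer, \<open>alternating s\<close> the \<open>A\<close> for which the trace does not depend
  on \<open>B\<close>.\<close>

definition block_lower :: "nat \<Rightarrow> nat \<Rightarrow> 'a::field mat set \<Rightarrow> 'a mat set" where
  "block_lower s t L = (\<lambda>(A, C, D). four_block_mat A (0\<^sub>m s t) C D) ` ((L \<inter> GL s) \<times> carrier_mat t s \<times> GL t)"

lemma sum_lessThan_add:
  fixes f :: "nat \<Rightarrow> 'a::comm_monoid_add"
  shows "(\<Sum>i<m + n. f i) = (\<Sum>i<m. f i) + (\<Sum>i<n. f (m + i))"
  by (induction n) (simp_all add: add.assoc)

lemma GL_inv_block_lower:
  assumes A: "A \<in> GL s" and C: "C \<in> carrier_mat t s" and D: "D \<in> GL t"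
  shows "four_block_mat A (0\<^sub>m s t) C D \<in> GL (s + t)"
    and "GL_inv (four_block_mat A (0\<^sub>m s t) C D) =
      four_block_mat (GL_inv A) (0\<^sub>m s t) (- (GL_inv D * C * GL_inv A)) (GL_inv D)"
proof -
  have c: "A \<in> carrier_mat s s" "GL_inv A \<in> carrier_mat s s" "D \<in> carrier_mat t t" "GL_inv D \<in> carrier_mat t t"
    using A D GL_inv(1) by (auto dest: GL_carrier)
  define X where "X = - (GL_inv D * C * GL_inv A)"
  have X: "X \<in> carrier_mat t s"
    using c C by (auto simp: X_def)
  have DX: "D * X = - (C * GL_inv A)"
  proof -
    have "D * (GL_inv D * C * GL_inv A) = (D * GL_inv D) * (C * GL_inv A)"
      using c C by (simp add: assoc_mult_mat[of _ t t _ t _ s] assoc_mult_mat[of _ t t _ s _ s])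
    then show ?thesis
      using c C GL_inv[OF D] by (simp add: X_def)
  qed
  have M: "four_block_mat A (0\<^sub>m s t) C D \<in> carrier_mat (s + t) (s + t)"
    using c C by (intro four_block_carrier_mat) auto
  have N: "four_block_mat (GL_inv A) (0\<^sub>m s t) X (GL_inv D) \<in> carrier_mat (s + t) (s + t)"
    using c X by (intro four_block_carrier_mat) auto
  have "C * GL_inv A + D * X = 0\<^sub>m t s"
    unfolding DX using c C by (intro eq_matI) auto
  then have "four_block_mat A (0\<^sub>m s t) C D * four_block_mat (GL_inv A) (0\<^sub>m s t) X (GL_inv D) =
      four_block_mat (1\<^sub>m s) (0\<^sub>m s t) (0\<^sub>m t s) (1\<^sub>m t)"
    using c C X GL_inv[OF A] GL_inv[OF D] by (subst mult_four_block_mat[of _ s s _ t _ t _ _ s _ t]) auto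
  also have "\<dots> = 1\<^sub>m (s + t)"
    by (rule eq_matI) auto
  finally have eq: "four_block_mat A (0\<^sub>m s t) C D * four_block_mat (GL_inv A) (0\<^sub>m s t) X (GL_inv D) = 1\<^sub>m (s + t)" .
  show "four_block_mat A (0\<^sub>m s t) C D \<in> GL (s + t)"
    by (rule GL_I[OF M N eq])
  then show "GL_inv (four_block_mat A (0\<^sub>m s t) C D) =
      four_block_mat (GL_inv A) (0\<^sub>m s t) (- (GL_inv D * C * GL_inv A)) (GL_inv D)"
    unfolding X_def[symmetric] by (rule GL_inv_eqI[OF _ N eq])
qed

lemma block_lowerE:
  assumes "M \<in> block_lower s t (L :: 'a::field mat set)"
  obtains A C D where "M = four_block_mat A (0\<^sub>m s t) C D" "A \<in> L" "A \<in> GL s" "C \<in> carrier_mat t s" "D \<in> GL t"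
    "A \<in> carrier_mat s s" "GL_inv A \<in> carrier_mat s s" "D \<in> carrier_mat t t" "GL_inv D \<in> carrier_mat t t"
proof -
  from assms obtain A C D where "M = four_block_mat A (0\<^sub>m s t) C D" "A \<in> L" "A \<in> GL s"
      "C \<in> carrier_mat t s" "D \<in> GL t"
    by (auto simp: block_lower_def)
  then show thesis
    by (intro that) (auto intro: GL_carrier GL_inv(1))
qed

lemma block_lower_iff:
  "M \<in> block_lower s t L \<longleftrightarrow> M \<in> GL (s + t) \<and> (\<forall>i<s. \<forall>j<t. M $$ (i, s + j) = 0) \<and>
    mat s s (\<lambda>ij. M $$ ij) \<in> (L :: 'a::field mat set)"
proof
  assume "M \<in> block_lower s t L"
  then obtain A C D where M: "M = four_block_mat A (0\<^sub>m s t) C D"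
    and c: "A \<in> GL s" "A \<in> L" "C \<in> carrier_mat t s" "D \<in> GL t" "A \<in> carrier_mat s s" "D \<in> carrier_mat t t"
    by (elim block_lowerE)
  then have "mat s s (\<lambda>ij. M $$ ij) = A" "\<forall>i<s. \<forall>j<t. M $$ (i, s + j) = 0"
    by (auto simp: M intro!: eq_matI)
  then show "M \<in> GL (s + t) \<and> (\<forall>i<s. \<forall>j<t. M $$ (i, s + j) = 0) \<and> mat s s (\<lambda>ij. M $$ ij) \<in> L"
    using GL_inv_block_lower(1)[OF c(1,3,4)] c M by auto
next
  assume M: "M \<in> GL (s + t) \<and> (\<forall>i<s. \<forall>j<t. M $$ (i, s + j) = 0) \<and> mat s s (\<lambda>ij. M $$ ij) \<in> L"
  then obtain A Z C D where b: "M = four_block_mat A Z C D" and c: "A \<in> carrier_mat s s" "Z \<in> carrier_mat s t"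
      "C \<in> carrier_mat t s" "D \<in> carrier_mat t t"
    by (meson GL_carrier four_block_mat_cases)
  have "Z $$ (i, j) = 0" if "i < s" "j < t" for i j
  proof -
    have "M $$ (i, s + j) = Z $$ (i, j)"
      using that c by (simp add: b)
    then show ?thesis
      using M that by simp
  qed
  then have Z: "Z = 0\<^sub>m s t"
    using c by (intro eq_matI) auto
  have A: "mat s s (\<lambda>ij. M $$ ij) = A"
    using c by (intro eq_matI) (auto simp: b)
  then have "A \<in> L"
    using M by simp
  have "det M = det A * det D"
    unfolding b using c Z by (intro det_four_block_mat_upper_right_zero) auto
  then have "A \<in> GL s" "D \<in> GL t"
    using M c by (auto simp: GL_iff_det)
  then show "M \<in> block_lower s t L"
    unfolding block_lower_def using \<open>A \<in> L\<close> c by (intro image_eqI[of _ _ "(A, C, D)"]) (auto simp: b Z)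
qed

lemma card_block_lower_filter:
  "card {M \<in> block_lower s t L. Q (mat t t (\<lambda>(i, j). M $$ (s + i, s + j)))} =
    card (L \<inter> GL s) * card (UNIV :: 'a set) ^ (t * s) * card {D \<in> GL t. Q (D :: 'a::{field,finite} mat)}"
    (is "card ?R = _")
proof -
  let ?f = "\<lambda>(A, C, D). four_block_mat A (0\<^sub>m s t) C (D :: 'a mat)"
  let ?S = "(L \<inter> GL s) \<times> (carrier_mat t s :: 'a mat set) \<times> {D \<in> GL t. Q D}"
  have D: "mat t t (\<lambda>(i, j). four_block_mat A (0\<^sub>m s t) C D $$ (s + i, s + j)) = D"
    if "A \<in> GL s" "C \<in> carrier_mat t s" "D \<in> GL t" for A C D :: "'a mat"
    using that by (intro eq_matI) (auto dest!: GL_carrier)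
  have "inj_on ?f ?S"
    by (rule inj_onI) (auto simp: four_block_mat_eq_iff[of _ s s _ t _ t] dest!: GL_carrier)
  moreover have "?R = ?f ` ?S"
  proof (intro equalityI subsetI)
    fix M assume "M \<in> ?R"
    then obtain A C D' where c: "A \<in> L \<inter> GL s" "C \<in> carrier_mat t s" "D' \<in> GL t"
      and M: "M = four_block_mat A (0\<^sub>m s t) C D'" and Q: "Q (mat t t (\<lambda>(i, j). M $$ (s + i, s + j)))"
      by (auto simp: block_lower_def)
    have "Q D'"
      using Q D c by (auto simp: M)
    then show "M \<in> ?f ` ?S"
      using c M by (intro image_eqI[of _ _ "(A, C, D')"]) auto
  next
    fix M assume "M \<in> ?f ` ?S"
    then obtain A C D' where c: "A \<in> L \<inter> GL s" "C \<in> carrier_mat t s" "D' \<in> GL t" "Q D'"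
      and M: "M = four_block_mat A (0\<^sub>m s t) C D'"
      by auto
    have "Q (mat t t (\<lambda>(i, j). M $$ (s + i, s + j)))"
      using D c by (auto simp: M)
    moreover have "M \<in> block_lower s t L"
      unfolding block_lower_def M using c by (intro image_eqI[of _ _ "(A, C, D')"]) auto
    ultimately show "M \<in> ?R"
      by blast
  qed
  ultimately show ?thesis
    by (simp add: card_image card_cartesian_product card_carrier_mat mult.assoc)
qed

lemma card_block_lower:
  "card (block_lower s t L) = card (L \<inter> GL s) * card (UNIV :: 'a set) ^ (t * s) * card (GL t :: 'a mat set)"
  for L :: "'a::{field,finite} mat set"
  using card_block_lower_filter[of s t L "\<lambda>_. True"] by simp

text \<open>Translation by a multiple of \<open>B0\<close> carries each fibre into any other, so all
  have the same size.\<close>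

lemma card_linear_fibre:
  fixes \<phi> :: "'a::{field,finite} mat \<Rightarrow> 'a"
  assumes fin: "finite S" and S: "S \<subseteq> carrier_mat n n" and B0: "B0 \<in> S" "\<phi> B0 \<noteq> 0"
    and closed: "\<And>B c. B \<in> S \<Longrightarrow> B + c \<cdot>\<^sub>m B0 \<in> S"
    and lin: "\<And>B c. B \<in> S \<Longrightarrow> \<phi> (B + c \<cdot>\<^sub>m B0) = \<phi> B + c * \<phi> B0"
  shows "card (UNIV :: 'a set) * card {B \<in> S. \<phi> B = \<beta>} = card S"
proof -
  have le: "card {B \<in> S. \<phi> B = \<beta>} \<le> card {B \<in> S. \<phi> B = \<gamma>}" for \<beta> \<gamma>
  proof (rule card_inj_on_le)
    let ?c = "(\<gamma> - \<beta>) / \<phi> B0"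
    show "inj_on (\<lambda>B. B + ?c \<cdot>\<^sub>m B0) {B \<in> S. \<phi> B = \<beta>}"
    proof (rule inj_on_inverseI[where g = "\<lambda>B. B + (- ?c) \<cdot>\<^sub>m B0"])
      fix B assume "B \<in> {B \<in> S. \<phi> B = \<beta>}"
      then have "B \<in> carrier_mat n n" "B0 \<in> carrier_mat n n"
        using S B0 by auto
      then show "B + ?c \<cdot>\<^sub>m B0 + (- ?c) \<cdot>\<^sub>m B0 = B"
        by (intro eq_matI) auto
    qed
    show "(\<lambda>B. B + ?c \<cdot>\<^sub>m B0) ` {B \<in> S. \<phi> B = \<beta>} \<subseteq> {B \<in> S. \<phi> B = \<gamma>}"
      using closed lin B0 by auto
  qed (use fin in simp)
  have "card S = (\<Sum>\<gamma>\<in>UNIV. card {B \<in> S. \<phi> B = \<gamma>})"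
    unfolding card_eq_sum by (rule sum.group[symmetric]) (use fin in auto)
  also have "\<dots> = (\<Sum>\<gamma>\<in>(UNIV :: 'a set). card {B \<in> S. \<phi> B = \<beta>})"
    using le by (intro sum.cong) (auto intro: le_antisym)
  finally show ?thesis
    by simp
qed

section \<open>The trace as an affine function of the symmetric block\<close>

context binary_field
begin

text \<open>The first \<open>s\<close> diagonal entries of \<open>A * B\<close>, summed: the part of
  the trace of \<open>p * sigma n s\<close> that depends on \<open>B\<close>.\<close>

definition corner_pairing :: "nat \<Rightarrow> nat \<Rightarrow> 'a mat \<Rightarrow> 'a mat \<Rightarrow> 'a" where
  "corner_pairing s n A B = (\<Sum>i<s. \<Sum>k<n. A $$ (i, k) * B $$ (k, i))"

lemma corner_pairing_good:
  assumes A: "A \<in> block_lower s t (alternating s)" and B: "B \<in> symmetric (s + t)"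
  shows "corner_pairing s (s + t) A B = 0"
proof -
  have A0: "A $$ (i, s + j) = 0" if "i < s" "j < t" for i j
    using A that by (simp add: block_lower_iff)
  have alt: "mat s s (\<lambda>ij. A $$ ij) \<in> symmetric s" "A $$ (i, i) = 0" if "i < s" for i
    using A that by (auto simp: block_lower_iff alternating_iff)
  have sym: "A $$ (i, j) = A $$ (j, i)" if "i < s" "j < s" for i j
    using symmetric_index[OF alt(1)[OF that(1)] that] that by simp
  have "corner_pairing s (s + t) A B = (\<Sum>i<s. \<Sum>k<s. A $$ (i, k) * B $$ (k, i))"
    unfolding corner_pairing_def
  proof (rule sum.cong[OF refl])
    fix i assume "i \<in> {..<s}"
    then have "A $$ (i, k) = 0" if "k \<in> {..<s + t} - {..<s}" for k
      using A0[of i "k - s"] that less_diff_conv2[of s k t] by (simp add: add.commute)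
    then show "(\<Sum>k<s + t. A $$ (i, k) * B $$ (k, i)) = (\<Sum>k<s. A $$ (i, k) * B $$ (k, i))"
      by (intro sum.mono_neutral_right) auto
  qed
  also have "\<dots> = (\<Sum>i<s. A $$ (i, i) * B $$ (i, i))"
    by (rule char2_sum_symmetric[OF two]) (simp add: sym[of _ _] symmetric_index[OF B])
  also have "\<dots> = 0"
    by (simp add: alt(2))
  finally show ?thesis .
qed

lemma corner_pairing_add:
  assumes "B \<in> carrier_mat (s + t) (s + t)" "B0 \<in> carrier_mat (s + t) (s + t)"
  shows "corner_pairing s (s + t) A (B + c \<cdot>\<^sub>m B0) = corner_pairing s (s + t) A B + c * corner_pairing s (s + t) A B0"
proof -
  have "corner_pairing s (s + t) A (B + c \<cdot>\<^sub>m B0) =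
      (\<Sum>i<s. \<Sum>k<s + t. A $$ (i, k) * B $$ (k, i) + c * (A $$ (i, k) * B0 $$ (k, i)))"
    unfolding corner_pairing_def using assms by (intro sum.cong refl) (simp add: algebra_simps)
  then show ?thesis
    by (simp add: corner_pairing_def sum.distrib sum_distrib_left)
qed

text \<open>Test matrices that read off \<open>A $$ (i, j)\<close> for \<open>j = i\<close> or
  \<open>j \<ge> s\<close>, and \<open>A $$ (i, j) + A $$ (j, i)\<close> otherwise. For
  \<open>j = i\<close> they have a single nonzero entry, hence the condition
  \<open>j \<noteq> i\<close>.\<close>

lemma corner_pairing_elementary:
  assumes "i < s" "j < s + t"
  defines "B \<equiv> mat (s + t) (s + t) (\<lambda>(k, l). if (k, l) = (i, j) \<or> (k, l) = (j, i) then (1 :: 'a) else 0)"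
  shows "B \<in> symmetric (s + t)"
    and "corner_pairing s (s + t) A B = A $$ (i, j) + (if j < s \<and> j \<noteq> i then A $$ (j, i) else 0)"
proof -
  show "B \<in> symmetric (s + t)"
    by (rule symmetricI) (auto simp: B_def)
  have "corner_pairing s (s + t) A B = (\<Sum>l<s. \<Sum>k<s + t. if (k, l) = (i, j) \<or> (k, l) = (j, i) then A $$ (l, k) else 0)"
    unfolding corner_pairing_def by (intro sum.cong refl) (auto simp: B_def)
  also have "\<dots> = (\<Sum>l<s. (if l = i then A $$ (i, j) else 0) + (if l = j \<and> j \<noteq> i then A $$ (j, i) else 0))"
  proof (rule sum.cong[OF refl])
    fix l assume "l \<in> {..<s}"
    have "(\<Sum>k<s + t. if (k, l) = (i, j) \<or> (k, l) = (j, i) then A $$ (l, k) else 0) =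
        (\<Sum>k<s + t. (if k = j then if l = i then A $$ (l, k) else 0 else 0) +
          (if k = i then if l = j \<and> j \<noteq> i then A $$ (l, k) else 0 else 0))"
      by (rule sum.cong[OF refl]) auto
    also have "\<dots> = (if l = i then A $$ (i, j) else 0) + (if l = j \<and> j \<noteq> i then A $$ (j, i) else 0)"
      unfolding sum.distrib using assms(1,2) by auto
    finally show "(\<Sum>k<s + t. if (k, l) = (i, j) \<or> (k, l) = (j, i) then A $$ (l, k) else 0) =
        (if l = i then A $$ (i, j) else 0) + (if l = j \<and> j \<noteq> i then A $$ (j, i) else 0)" .
  qed
  also have "\<dots> = A $$ (i, j) + (if j < s \<and> j \<noteq> i then A $$ (j, i) else 0)"
  proof -
    have "(\<Sum>l<s. if l = j \<and> j \<noteq> i then A $$ (j, i) else 0) = (\<Sum>l<s. if l = j then if j \<noteq> i then A $$ (j, i) else 0 else 0)"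
      by (rule sum.cong) auto
    also have "\<dots> = (if j < s \<and> j \<noteq> i then A $$ (j, i) else 0)"
      by (subst sum.delta) auto
    moreover have "(\<Sum>l<s. if l = i then A $$ (i, j) else 0) = A $$ (i, j)"
      using assms(1) by (subst sum.delta) auto
    ultimately show ?thesis
      by (simp only: sum.distrib)
  qed
  finally show "corner_pairing s (s + t) A B = A $$ (i, j) + (if j < s \<and> j \<noteq> i then A $$ (j, i) else 0)" .
qed

text \<open>If the form vanished on all elementary symmetric matrices, the upper right block of
  \<open>A\<close> would be zero and its upper left block alternating.\<close>

lemma corner_pairing_bad:
  assumes A: "A \<in> GL (s + t)" "A \<notin> block_lower s t (alternating s)"
  shows "\<exists>B\<in>symmetric (s + t). corner_pairing s (s + t) A B \<noteq> 0"
proof (rule ccontr)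
  assume *: "\<not> ?thesis"
  have **: "A $$ (i, j) + (if j < s \<and> j \<noteq> i then A $$ (j, i) else 0) = 0" if "i < s" "j < s + t" for i j
    unfolding corner_pairing_elementary(2)[OF that, of A, symmetric]
    using * corner_pairing_elementary(1)[OF that] by blast
  have "A $$ (i, s + j) = 0" if "i < s" "j < t" for i j
    using **[of i "s + j"] that by simp
  moreover have "mat s s (\<lambda>ij. A $$ ij) \<in> alternating s"
    unfolding alternating_iff
  proof (intro conjI symmetricI allI impI)
    show "mat s s (\<lambda>ij. A $$ ij) $$ (i, j) = mat s s (\<lambda>ij. A $$ ij) $$ (j, i)" if "i < s" "j < s" for i j
      using **[of i j] that by (cases "i = j") (auto simp: add_eq_0)
    show "mat s s (\<lambda>ij. A $$ ij) $$ (i, i) = 0" if "i < s" for i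
      using **[of i i] that by simp
  qed simp
  ultimately show False
    using A by (simp add: block_lower_iff)
qed

lemma card_corner_pairing_bad:
  assumes A: "A \<in> GL (s + t)" "A \<notin> block_lower s t (alternating s)"
  shows "q * card {B \<in> symmetric (s + t). corner_pairing s (s + t) A B + c = \<beta>} = card (symmetric (s + t) :: 'a mat set)"
proof -
  obtain B0 where B0: "B0 \<in> symmetric (s + t)" "corner_pairing s (s + t) A B0 \<noteq> 0"
    using corner_pairing_bad[OF A] by blast
  have c: "B \<in> carrier_mat (s + t) (s + t)" if "B \<in> symmetric (s + t)" for B :: "'a mat"
    using that by (simp add: symmetric_def)
  have "{B \<in> symmetric (s + t). corner_pairing s (s + t) A B + c = \<beta>} =
      {B \<in> symmetric (s + t). corner_pairing s (s + t) A B = \<beta> - c}"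
    by (auto simp: algebra_simps)
  moreover have "card (UNIV :: 'a set) * card {B \<in> symmetric (s + t). corner_pairing s (s + t) A B = \<beta> - c} =
      card (symmetric (s + t) :: 'a mat set)"
  proof (rule card_linear_fibre[where \<phi> = "corner_pairing s (s + t) A", OF finite_symmetric _ B0])
    fix B :: "'a mat" and d assume B: "B \<in> symmetric (s + t)"
    show "B + d \<cdot>\<^sub>m B0 \<in> symmetric (s + t)"
      using c[OF B] c[OF B0(1)] by (intro symmetricI) (auto simp: symmetric_index[OF B] symmetric_index[OF B0(1)])
    show "corner_pairing s (s + t) A (B + d \<cdot>\<^sub>m B0) = corner_pairing s (s + t) A B + d * corner_pairing s (s + t) A B0"
      using c[OF B] c[OF B0(1)] by (rule corner_pairing_add)
  qed (auto dest: c)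
  ultimately show ?thesis
    by (simp add: card_UNIV)
qed

text \<open>Diagonal entries of the product are entries of \<open>p\<close> at
  \<open>(i, sigma_perm n s i)\<close>. The four index ranges meet, in order, the diagonals of
  \<open>A * B\<close> and \<open>A\<close>, the zero block, and the diagonal of the
  inverse.\<close>

lemma mat_tr_parabolic_sigma:
  assumes A: "A \<in> GL (s + t)" and B: "B \<in> symmetric (s + t)"
  shows "mat_tr (parabolic_mat A B * sigma (s + t) s) =
    corner_pairing s (s + t) A B + (\<Sum>i<t. A $$ (s + i, s + i) + GL_inv A $$ (s + i, s + i))"
proof -
  let ?n = "s + t"
  have c: "A \<in> carrier_mat ?n ?n" "B \<in> carrier_mat ?n ?n" "GL_inv A \<in> carrier_mat ?n ?n"
    using A B GL_inv(1) by (auto simp: symmetric_def dest: GL_carrier)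
  have p: "parabolic_mat A B \<in> carrier_mat (?n + ?n) (?n + ?n)"
    using parabolic_mat_carrier[OF A c(2)] .
  have "mat_tr (parabolic_mat A B * sigma ?n s) = (\<Sum>i<?n + ?n. parabolic_mat A B $$ (i, sigma_perm ?n s i))"
    using p by (simp add: mat_tr_def mult_sigma_index del: index_mult_mat(1))
  also have "\<dots> = (\<Sum>i<?n. parabolic_mat A B $$ (i, sigma_perm ?n s i)) +
      (\<Sum>i<?n. parabolic_mat A B $$ (?n + i, sigma_perm ?n s (?n + i)))"
    by (rule sum_lessThan_add)
  also have "(\<Sum>i<?n. parabolic_mat A B $$ (i, sigma_perm ?n s i)) =
      (\<Sum>i<s. parabolic_mat A B $$ (i, sigma_perm ?n s i)) + (\<Sum>i<t. parabolic_mat A B $$ (s + i, sigma_perm ?n s (s + i)))"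
    by (rule sum_lessThan_add)
  also have "(\<Sum>i<s. parabolic_mat A B $$ (i, sigma_perm ?n s i)) = (\<Sum>i<s. (A * B) $$ (i, i))"
    by (rule sum.cong) (use c in \<open>auto simp: parabolic_mat_def sigma_perm_def simp del: index_mult_mat(1)\<close>)
  also have "\<dots> = corner_pairing s ?n A B"
    unfolding corner_pairing_def
    by (rule sum.cong) (use c in \<open>auto simp: mat_mult_index[of _ ?n ?n _ ?n] simp del: index_mult_mat(1)\<close>)
  also have "(\<Sum>i<t. parabolic_mat A B $$ (s + i, sigma_perm ?n s (s + i))) = (\<Sum>i<t. A $$ (s + i, s + i))"
    by (rule sum.cong) (use c in \<open>auto simp: parabolic_mat_def sigma_perm_def\<close>)
  also have "(\<Sum>i<?n. parabolic_mat A B $$ (?n + i, sigma_perm ?n s (?n + i))) =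
      (\<Sum>i<s. parabolic_mat A B $$ (?n + i, sigma_perm ?n s (?n + i))) +
      (\<Sum>i<t. parabolic_mat A B $$ (?n + (s + i), sigma_perm ?n s (?n + (s + i))))"
    by (rule sum_lessThan_add)
  also have "(\<Sum>i<s. parabolic_mat A B $$ (?n + i, sigma_perm ?n s (?n + i))) = 0"
    by (rule sum.neutral) (use c in \<open>auto simp: parabolic_mat_def sigma_perm_def\<close>)
  also have "(\<Sum>i<t. parabolic_mat A B $$ (?n + (s + i), sigma_perm ?n s (?n + (s + i)))) = (\<Sum>i<t. GL_inv A $$ (s + i, s + i))"
    by (rule sum.cong) (use c in \<open>auto simp: parabolic_mat_def sigma_perm_def\<close>)
  finally show ?thesis
    by (simp add: sum.distrib add.assoc)
qed

text \<open>The lower left block of the conjugate collects the \<open>s\<close> by \<open>s\<close>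
  corner of \<open>A * B\<close>, the upper right block of \<open>A\<close>, and entries of the
  upper right block of the inverse. The second makes \<open>A\<close> block lower triangular, the
  third then vanishes too, and the first becomes an invertible block times the corner of
  \<open>B\<close>.\<close>

lemma stabilizer_iff:
  assumes A: "A \<in> GL (s + t)" and B: "B \<in> symmetric (s + t)"
  shows "sigma (s + t) s * parabolic_mat A B * sigma (s + t) s \<in> parabolic (s + t) \<longleftrightarrow>
    A \<in> block_lower s t UNIV \<and> (\<forall>i<s. \<forall>j<s. B $$ (i, j) = (0 :: 'a))"
proof -
  let ?n = "s + t"
  let ?z = "parabolic_mat A B"
  have c: "A \<in> carrier_mat ?n ?n" "B \<in> carrier_mat ?n ?n" "GL_inv A \<in> carrier_mat ?n ?n"
    using A B GL_inv(1) by (auto simp: symmetric_def dest: GL_carrier)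
  have z: "?z \<in> parabolic ?n"
    using A B by (auto simp: parabolic_eq)
  have e: "?z $$ (i, ?n + j) = (A * B) $$ (i, j)" "?z $$ (i, j) = A $$ (i, j)"
      "?z $$ (?n + i, ?n + j) = GL_inv A $$ (j, i)" "?z $$ (?n + i, j) = 0" if "i < ?n" "j < ?n" for i j
    using that c by (auto simp: parabolic_mat_def simp del: index_mult_mat(1))
  let ?entry = "\<lambda>i j. ?z $$ (sigma_perm ?n s (?n + i), sigma_perm ?n s j)"
  have e': "?entry i j = (if i < s then if j < s then (A * B) $$ (i, j) else A $$ (i, j)
      else if j < s then GL_inv A $$ (j, i) else 0)" if "i < ?n" "j < ?n" for i j
    using that by (auto simp: sigma_perm_def e simp del: index_mult_mat(1))
  have iff: "sigma ?n s * ?z * sigma ?n s \<in> parabolic ?n \<longleftrightarrow> (\<forall>i<?n. \<forall>j<?n. ?entry i j = 0)"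
    by (rule sigma_conj_parabolic_iff[OF _ z]) simp
  show ?thesis
  proof
    assume "sigma ?n s * ?z * sigma ?n s \<in> parabolic ?n"
    then have 0: "?entry i j = 0" if "i < ?n" "j < ?n" for i j
      using iff that by blast
    have "A $$ (i, s + j) = 0" if "i < s" "j < t" for i j
      using 0[of i "s + j"] e'[of i "s + j"] that by simp
    then have lower: "A \<in> block_lower s t UNIV"
      using A by (simp add: block_lower_iff)
    then obtain A1 C D where b4: "A = four_block_mat A1 (0\<^sub>m s t) C D" and b: "A1 \<in> GL s" "C \<in> carrier_mat t s" "D \<in> GL t"
      and c1: "A1 \<in> carrier_mat s s" "GL_inv A1 \<in> carrier_mat s s" "D \<in> carrier_mat t t" "GL_inv D \<in> carrier_mat t t"
      by (elim conjE block_lowerE)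
    define B1 where "B1 = mat s s (\<lambda>ij. B $$ ij)"
    have B1: "B1 \<in> carrier_mat s s"
      by (simp add: B1_def)
    have "A1 * B1 = 0\<^sub>m s s"
    proof (rule eq_matI)
      fix i j assume "i < dim_row (0\<^sub>m s s :: 'a mat)" "j < dim_col (0\<^sub>m s s :: 'a mat)"
      then have ij: "i < s" "j < s"
        by auto
      have "(A1 * B1) $$ (i, j) = (\<Sum>k<s. A1 $$ (i, k) * B1 $$ (k, j))"
        using c1 B1 ij by (intro mat_mult_index) auto
      also have "\<dots> = (\<Sum>k<s. A $$ (i, k) * B $$ (k, j))"
        by (rule sum.cong) (use c1 b4 ij in \<open>auto simp: B1_def\<close>)
      also have "\<dots> = (\<Sum>k<?n. A $$ (i, k) * B $$ (k, j))"
        by (rule sum.mono_neutral_left) (use b b4 c1 ij in auto)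
      also have "\<dots> = (A * B) $$ (i, j)"
        using c ij by (intro mat_mult_index[of _ ?n ?n _ ?n, symmetric]) auto
      also have "\<dots> = 0"
        using 0[of i j] e'[of i j] ij by simp
      finally show "(A1 * B1) $$ (i, j) = 0\<^sub>m s s $$ (i, j)"
        using ij by simp
    qed (use c1 B1 in auto)
    then have "GL_inv A1 * (A1 * B1) = 0\<^sub>m s s"
      using c1 by simp
    then have "B1 = 0\<^sub>m s s"
      using c1 B1 GL_inv[OF b(1)] by (simp flip: assoc_mult_mat[of _ s s _ s _ s])
    then have "B1 $$ (i, j) = 0" if "i < s" "j < s" for i j
      using that by simp
    moreover have "B1 $$ (i, j) = B $$ (i, j)" if "i < s" "j < s" for i j
      using that by (simp add: B1_def)
    ultimately have "B $$ (i, j) = 0" if "i < s" "j < s" for i j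
      using that by simp
    with lower show "A \<in> block_lower s t UNIV \<and> (\<forall>i<s. \<forall>j<s. B $$ (i, j) = 0)"
      by blast
  next
    assume *: "A \<in> block_lower s t UNIV \<and> (\<forall>i<s. \<forall>j<s. B $$ (i, j) = 0)"
    then obtain A1 C D where b4: "A = four_block_mat A1 (0\<^sub>m s t) C D" and b: "A1 \<in> GL s" "C \<in> carrier_mat t s" "D \<in> GL t"
      and c1: "A1 \<in> carrier_mat s s" "GL_inv A1 \<in> carrier_mat s s" "D \<in> carrier_mat t t" "GL_inv D \<in> carrier_mat t t"
      by (elim conjE block_lowerE)
    have inv: "GL_inv A $$ (i, j) = 0" if "i < s" "s \<le> j" "j < ?n" for i j
      unfolding b4 GL_inv_block_lower(2)[OF b] using that c1 by simp
    have A0: "A $$ (i, j) = 0" if "i < s" "s \<le> j" "j < ?n" for i j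
      unfolding b4 using that c1 by simp
    have "(A * B) $$ (i, j) = 0" if "i < s" "j < s" for i j
    proof -
      have "(A * B) $$ (i, j) = (\<Sum>k<?n. A $$ (i, k) * B $$ (k, j))"
        using c that by (intro mat_mult_index[of _ ?n ?n _ ?n]) auto
      also have "\<dots> = 0"
        using * that A0[of i] by (intro sum.neutral) (metis lessThan_iff mult_eq_0_iff not_le)
      finally show ?thesis .
    qed
    then have "?entry i j = 0" if "i < ?n" "j < ?n" for i j
      unfolding e'[OF that] using that A0 inv by auto
    then show "sigma ?n s * ?z * sigma ?n s \<in> parabolic ?n"
      using iff by blast
  qed
qed

section \<open>Counting over the parabolic subgroup\<close>

definition trace_count :: "nat \<Rightarrow> 'a \<Rightarrow> nat" where
  "trace_count t \<beta> = card {D \<in> GL t. mat_tr D + mat_tr (GL_inv D) = \<beta>}"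

lemma card_stabilizer:
  "card {z \<in> parabolic (s + t). sigma (s + t) s * z * sigma (s + t) s \<in> (parabolic (s + t) :: 'a mat set)} =
    card (GL s :: 'a mat set) * q ^ (t * s) * card (GL t :: 'a mat set) * q ^ (\<Sum>j = s..<s + t. Suc j)"
proof -
  have sub: "block_lower s t UNIV \<subseteq> (GL (s + t) :: 'a mat set)"
    by (auto simp: block_lower_iff)
  have "card {z \<in> parabolic (s + t). sigma (s + t) s * z * sigma (s + t) s \<in> (parabolic (s + t) :: 'a mat set)} =
    card ((block_lower s t UNIV :: 'a mat set) \<times> {B \<in> symmetric (s + t). \<forall>i<s. \<forall>j<s. B $$ (i, j) = (0 :: 'a)})"
    unfolding card_parabolic_filter by (rule arg_cong[where f = card]) (use sub in \<open>auto simp: stabilizer_iff\<close>)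
  then show ?thesis
    by (simp only: card_cartesian_product card_block_lower card_symmetric_corner le_add1 card_UNIV Int_UNIV_left)
qed

text \<open>A general \<open>A\<close> contributes \<open>1 / q\<close> of all symmetric
  \<open>B\<close>; an exceptional \<open>A\<close> contributes all of them or none. The identity is
  multiplied by \<open>q\<close> and rearranged so that it lives in the naturals without
  subtraction.\<close>

lemma card_trace_parabolic_sigma:
  "q * card {p \<in> parabolic (s + t). mat_tr (p * sigma (s + t) s) = \<beta>} + 
    card (symmetric (s + t) :: 'a mat set) * (card (alternating s \<inter> GL s :: 'a mat set) * q ^ (t * s) * card (GL t :: 'a mat set)) =
    card (symmetric (s + t) :: 'a mat set) * (card (GL (s + t) :: 'a mat set) +
      q * (card (alternating s \<inter> GL s :: 'a mat set) * q ^ (t * s) * trace_count t \<beta>))"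
proof -
  let ?n = "s + t"
  let ?Sym = "symmetric ?n :: 'a mat set"
  let ?G = "block_lower s t (alternating s) :: 'a mat set"
  define c where "c A = (\<Sum>i<t. A $$ (s + i, s + i) + GL_inv A $$ (s + i, s + i))" for A :: "'a mat"
  let ?F = "\<lambda>A. {B \<in> ?Sym. corner_pairing s ?n A B + c A = \<beta>}"
  have sub: "?G \<subseteq> GL ?n"
    by (auto simp: block_lower_iff)
  have finG: "finite ?G"
    using sub finite_GL finite_subset by blast
  have "{(A, B). A \<in> GL ?n \<and> B \<in> ?Sym \<and> mat_tr (parabolic_mat A B * sigma ?n s) = \<beta>} = Sigma (GL ?n) ?F"
    by (auto simp: mat_tr_parabolic_sigma c_def)
  then have "card {p \<in> parabolic ?n. mat_tr (p * sigma ?n s) = \<beta>} = (\<Sum>A\<in>GL ?n. card (?F A))"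
    unfolding card_parabolic_filter by (simp add: card_SigmaI finite_GL finite_symmetric)
  also have "\<dots> = (\<Sum>A\<in>GL ?n - ?G. card (?F A)) + (\<Sum>A\<in>?G. card (?F A))"
    by (rule sum.subset_diff[OF sub finite_GL])
  finally have "q * card {p \<in> parabolic ?n. mat_tr (p * sigma ?n s) = \<beta>} =
      (\<Sum>A\<in>GL ?n - ?G. q * card (?F A)) + q * (\<Sum>A\<in>?G. card (?F A))"
    by (simp add: distrib_left sum_distrib_left)
  also have "(\<Sum>A\<in>GL ?n - ?G. q * card (?F A)) = card (GL ?n - ?G) * card ?Sym"
    by (simp add: card_corner_pairing_bad)
  also have "(\<Sum>A\<in>?G. card (?F A)) = (\<Sum>A\<in>?G. if c A = \<beta> then card ?Sym else 0)"
    by (rule sum.cong) (auto simp: corner_pairing_good cong: conj_cong)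
  also have "\<dots> = card {A \<in> ?G. c A = \<beta>} * card ?Sym"
    using finG by (simp flip: sum.inter_filter)
  also have "{A \<in> ?G. c A = \<beta>} = {A \<in> ?G. (\<lambda>D. mat_tr D + mat_tr (GL_inv D) = \<beta>) (mat t t (\<lambda>(i, j). A $$ (s + i, s + j)))}"
  proof (rule Collect_cong, rule conj_cong[OF refl])
    fix A assume "A \<in> ?G"
    then obtain A1 C D where b4: "A = four_block_mat A1 (0\<^sub>m s t) C D" and b: "A1 \<in> GL s" "C \<in> carrier_mat t s" "D \<in> GL t"
      and c1: "A1 \<in> carrier_mat s s" "GL_inv A1 \<in> carrier_mat s s" "D \<in> carrier_mat t t" "GL_inv D \<in> carrier_mat t t"
      by (elim conjE block_lowerE)
    have D: "mat t t (\<lambda>(i, j). A $$ (s + i, s + j)) = D"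
      using c1 by (intro eq_matI) (auto simp: b4)
    have "c A = (\<Sum>i<t. D $$ (i, i) + GL_inv D $$ (i, i))"
      unfolding c_def b4 GL_inv_block_lower(2)[OF b] by (rule sum.cong) (use c1 in auto)
    also have "\<dots> = mat_tr D + mat_tr (GL_inv D)"
      using c1 by (simp add: mat_tr_def sum.distrib)
    finally show "c A = \<beta> \<longleftrightarrow> (\<lambda>D. mat_tr D + mat_tr (GL_inv D) = \<beta>) (mat t t (\<lambda>(i, j). A $$ (s + i, s + j)))"
      by (simp add: D)
  qed
  also have "card \<dots> = card (alternating s \<inter> GL s :: 'a mat set) * q ^ (t * s) * trace_count t \<beta>"
    using card_block_lower_filter[of s t "alternating s" "\<lambda>D. mat_tr D + mat_tr (GL_inv D) = \<beta>"]
    by (simp add: trace_count_def card_UNIV)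
  finally have 1: "q * card {p \<in> parabolic ?n. mat_tr (p * sigma ?n s) = \<beta>} =
      card (GL ?n - ?G) * card ?Sym + q * (card (alternating s \<inter> GL s :: 'a mat set) * q ^ (t * s) * trace_count t \<beta> * card ?Sym)" .
  have "card (GL ?n :: 'a mat set) = card (GL ?n - ?G) + card ?G"
    using sub finite_GL by (metis card_Diff_subset card_mono finG le_add_diff_inverse2)
  then have 2: "card (GL ?n :: 'a mat set) = card (GL ?n - ?G) + card (alternating s \<inter> GL s :: 'a mat set) * q ^ (t * s) * card (GL t :: 'a mat set)"
    by (simp only: card_block_lower card_UNIV)
  show ?thesis
    unfolding 1 2 by (simp add: algebra_simps)
qed


lemma trace_count_1:
  "int (trace_count 1 \<beta>) = 1 + (if \<beta> = 0 then 0 else add_char r (inverse \<beta>))"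
proof -
  let ?f = "\<lambda>\<alpha> :: 'a. mat 1 1 (\<lambda>_. \<alpha>)"
  let ?S = "{\<alpha>. \<alpha> \<noteq> 0 \<and> \<alpha> + inverse \<alpha> = \<beta>}" and ?T = "{D \<in> GL 1. mat_tr D + mat_tr (GL_inv D) = \<beta>}"
  have GL1: "?f \<alpha> \<in> GL 1 \<longleftrightarrow> \<alpha> \<noteq> 0" for \<alpha>
    by (simp add: GL_iff_det det_single)
  have inv: "GL_inv (?f \<alpha>) = ?f (inverse \<alpha>)" if "\<alpha> \<noteq> 0" for \<alpha>
    using that GL1[of \<alpha>] by (intro GL_inv_eqI[of _ 1]) (auto intro!: eq_matI simp: scalar_prod_def)
  have "bij_betw ?f ?S ?T"
  proof (rule bij_betw_byWitness[where f' = "\<lambda>D. D $$ (0, 0)"])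
    have eq: "?f (D $$ (0, 0)) = D" if "D \<in> GL 1" for D
      using that by (intro eq_matI) (auto dest!: GL_carrier)
    then show "\<forall>D\<in>?T. ?f (D $$ (0, 0)) = D"
      by blast
    show "?f ` ?S \<subseteq> ?T"
      by (rule image_subsetI) (simp add: GL1 inv mat_tr_def del: One_nat_def)
    show "(\<lambda>D. D $$ (0, 0)) ` ?T \<subseteq> ?S"
    proof (rule image_subsetI)
      fix D assume D: "D \<in> ?T"
      define \<alpha> where "\<alpha> = D $$ (0, 0)"
      have "D = ?f \<alpha>"
        using D eq by (simp add: \<alpha>_def)
      then show "D $$ (0, 0) \<in> ?S"
        using D GL1[of \<alpha>] inv[of \<alpha>] by (auto simp: mat_tr_def simp del: One_nat_def)
    qed
  qed auto
  then show ?thesis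
    unfolding trace_count_def by (simp add: bij_betw_same_card[symmetric] card_plus_inverse)
qed

lemma trace_count_2: "int (trace_count 2 \<beta>) = gl2_count \<beta>"
proof -
  let ?U = "{(a, b, c, e). a * e + b * c \<noteq> 0 \<and> (a + e) * (1 + inverse (a * e + b * c)) = \<beta>}" and ?V = "{D \<in> GL 2. mat_tr D + mat_tr (GL_inv D) = \<beta>}"
  let ?e = "\<lambda>D. (D $$ (0, 0), D $$ (0, 1), D $$ (1, 0), D $$ (1, 1))"
  define f where "f a b c e = mat 2 2 (\<lambda>(i, j). if i = 0 then if j = 0 then a else b else if j = 0 then c else (e :: 'a))"
    for a b c e
  have fc: "f a b c e \<in> carrier_mat 2 2" for a b c e
    by (simp add: f_def)
  have ff: "f a b c e * f a' b' c' e' = f (a * a' + b * c') (a * b' + b * e') (c * a' + e * c') (c * b' + e * e')"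
    for a b c e a' b' c' e'
    by (rule eq_matI) (auto simp: f_def scalar_prod_def numeral_2_eq_2)
  have one: "f 1 0 0 1 = 1\<^sub>m 2"
    by (rule eq_matI) (auto simp: f_def)
  have det: "det (f a b c e) = a * e + b * c" for a b c e
  proof -
    let ?m = "\<lambda>x :: 'a. mat 1 1 (\<lambda>_. x)"
    have "f a b c e = four_block_mat (?m a) (?m b) (?m c) (?m e)"
      by (rule eq_matI) (auto simp: f_def)
    also have "det \<dots> = det (?m a * ?m e - ?m b * ?m c)"
      by (rule det_four_block_mat[of _ 1]) (auto intro!: eq_matI simp: scalar_prod_def)
    also have "\<dots> = (?m a * ?m e - ?m b * ?m c) $$ (0, 0)"
      by (rule det_single) auto
    also have "\<dots> = a * e + b * c"
      by (simp add: scalar_prod_def diff_eq)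
    finally show ?thesis .
  qed
  have GL2: "f a b c e \<in> GL 2 \<longleftrightarrow> a * e + b * c \<noteq> 0" for a b c e
    by (simp add: GL_iff_det fc det)
  have inv: "GL_inv (f a b c e) = f (e / (a * e + b * c)) (b / (a * e + b * c)) (c / (a * e + b * c)) (a / (a * e + b * c))"
    if "a * e + b * c \<noteq> 0" for a b c e
  proof (rule GL_inv_eqI[OF _ fc])
    let ?d = "a * e + b * c"
    have "a * (e / ?d) + b * (c / ?d) = 1" "c * (b / ?d) + e * (a / ?d) = 1"
      using that by (simp_all add: ac_simps flip: add_divide_distrib)
    moreover have "a * (b / ?d) + b * (a / ?d) = 0" "c * (e / ?d) + e * (c / ?d) = 0"
      by (simp_all add: mult.commute)
    ultimately show "f a b c e * f (e / ?d) (b / ?d) (c / ?d) (a / ?d) = 1\<^sub>m 2"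
      unfolding ff by (simp add: one)
  qed (use that GL2 in blast)
  have tr: "mat_tr (f a b c e) = a + e" for a b c e
    by (simp add: mat_tr_def f_def numeral_2_eq_2)
  have tr2: "mat_tr (f a b c e) + mat_tr (GL_inv (f a b c e)) = (a + e) * (1 + inverse (a * e + b * c))"
    if "a * e + b * c \<noteq> 0" for a b c e
    unfolding inv[OF that] tr by (simp add: divide_inverse algebra_simps)
  have "bij_betw (\<lambda>(a, b, c, e). f a b c e)
    ?U
    ?V"
  proof (rule bij_betw_byWitness[where f' = ?e])
    have eq: "f (D $$ (0, 0)) (D $$ (0, 1)) (D $$ (1, 0)) (D $$ (1, 1)) = D" if "D \<in> GL 2" for D
      using GL_carrier[OF that] by (intro eq_matI) (auto simp: f_def numeral_2_eq_2 less_Suc_eq)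
    then show "\<forall>D\<in>?V.
        (case ?e D of (a, b, c, e) \<Rightarrow> f a b c e) = D"
      by simp
    show "\<forall>x\<in>?U.
      ?e (case x of (a, b, c, e) \<Rightarrow> f a b c e) = x"
      by (auto simp: f_def)
    show "(\<lambda>(a, b, c, e). f a b c e) ` ?U
      \<subseteq> ?V"
      by (auto simp: GL2 tr2)
    show "?e ` ?V
      \<subseteq> ?U"
    proof (rule image_subsetI)
      fix D assume D: "D \<in> ?V"
      define a b c e where abce: "a = D $$ (0, 0)" "b = D $$ (0, 1)" "c = D $$ (1, 0)" "e = D $$ (1, 1)"
      have fD: "D = f a b c e"
        using D eq by (simp add: abce)
      have "a * e + b * c \<noteq> 0"
        using D GL2 unfolding fD by blast
      moreover from this have "(a + e) * (1 + inverse (a * e + b * c)) = \<beta>"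
        using D tr2[of a e b c] unfolding fD by simp
      ultimately show "?e D \<in>
          ?U"
        by (simp add: abce)
    qed
  qed
  then show ?thesis
    by (simp add: trace_count_def gl2_count_def bij_betw_same_card)
qed

section \<open>Group orders and exponents\<close>

definition gl :: "nat \<Rightarrow> real" where
  "gl n = real (card (GL n :: 'a mat set))"

definition al :: "nat \<Rightarrow> real" where
  "al n = real (card (alternating n \<inter> GL n :: 'a mat set))"

lemma gl_0: "gl 0 = 1"
  by (simp add: gl_def card_GL_0)

lemma gl_Suc: "gl (Suc n) = (real q ^ Suc n - 1) * real q ^ n * gl n"
proof -
  have "q ^ Suc n \<ge> 1"
    using q_ge_2 by simp
  then show ?thesis
    unfolding gl_def card_GL_Suc card_UNIV by (simp add: of_nat_diff del: power_Suc)
qed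

lemma al_0: "al 0 = 1"
  by (simp add: al_def card_alternating_0)

lemma al_Suc_Suc: "al (Suc (Suc n)) = (real q ^ Suc n - 1) * real q ^ n * al n"
proof -
  have "q ^ Suc n \<ge> 1"
    using q_ge_2 by simp
  then show ?thesis
    unfolding al_def card_alternating_Suc_Suc by (simp add: of_nat_diff del: power_Suc)
qed

lemma q_power_gt_1: "n > 0 \<Longrightarrow> real q ^ n > 1"
  using q_ge_2 by (intro one_less_power) auto

lemma gl_pos: "gl n > 0"
proof (induction n)
  case (Suc n)
  then show ?case
    using q_power_gt_1[of "Suc n"] q_ge_2 by (simp add: gl_Suc del: power_Suc)
qed (simp add: gl_0)

lemma al_closed: "al (2 * m) = real q ^ (m * (m - 1)) * (\<Prod>j = 1..m. real q ^ (2 * j - 1) - 1)"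
proof (induction m)
  case (Suc m)
  have "al (2 * Suc m) = (real q ^ (2 * m + 1) - 1) * real q ^ (2 * m) * al (2 * m)"
    using al_Suc_Suc[of "2 * m"] by simp
  moreover have "Suc m * (Suc m - 1) = m * (m - 1) + 2 * m"
    by (cases m) (simp_all add: algebra_simps)
  then have "real q ^ (Suc m * (Suc m - 1)) = real q ^ (m * (m - 1)) * real q ^ (2 * m)"
    by (simp only: power_add)
  moreover have "(\<Prod>j = 1..Suc m. real q ^ (2 * j - 1) - 1) = (\<Prod>j = 1..m. real q ^ (2 * j - 1) - 1) * (real q ^ (2 * m + 1) - 1)"
    by simp
  ultimately show ?case
    by (simp only: Suc) (simp only: ac_simps)
qed (simp add: al_0)

text \<open>Two steps of the recursion for \<open>gl\<close> contain one step of that for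
  \<open>al\<close>; what remains are the factors with even exponents, those of
  \<open>B_minus\<close> and \<open>B_plus\<close>.\<close>

lemma gl_closed: "gl (2 * m) = real q ^ (m ^ 2) * (\<Prod>j = 1..m. real q ^ (2 * j) - 1) * al (2 * m)"
proof (induction m)
  case (Suc m)
  have "gl (2 * Suc m) = (real q ^ (2 * m + 2) - 1) * real q ^ (2 * m + 1) * ((real q ^ (2 * m + 1) - 1) * real q ^ (2 * m) * gl (2 * m))"
    using gl_Suc[of "2 * m"] gl_Suc[of "Suc (2 * m)"] by simp
  moreover have "al (2 * Suc m) = (real q ^ (2 * m + 1) - 1) * real q ^ (2 * m) * al (2 * m)"
    using al_Suc_Suc[of "2 * m"] by simp
  moreover have "Suc m ^ 2 = m ^ 2 + (2 * m + 1)"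
    by (simp add: power2_eq_square)
  then have "real q ^ (Suc m ^ 2) = real q ^ (m ^ 2) * real q ^ (2 * m + 1)"
    by (simp only: power_add)
  moreover have "(\<Prod>j = 1..Suc m. real q ^ (2 * j) - 1) = (\<Prod>j = 1..m. real q ^ (2 * j) - 1) * (real q ^ (2 * m + 2) - 1)"
    by simp
  ultimately show ?case
    by (simp only: Suc) (simp only: ac_simps)
qed (simp add: gl_0 al_0)

lemma sum_Suc_lessThan_double: "(\<Sum>j<2 * m. Suc j) = m * (2 * m + 1)"
  by (induction m) (simp_all add: algebra_simps)

text \<open>The fibre formula for double cosets, with the powers of \<open>q\<close> for symmetric
  matrices split at \<open>s\<close>: the part beyond \<open>s\<close> belongs to the stabilizer as
  well and cancels.\<close>

lemma double_coset_trace_count: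
  "real (card {w \<in> double_coset (s + t) s. mat_tr w = (\<beta> :: 'a)}) * (real q * gl s * real q ^ (t * s) * gl t) =
    gl (s + t) * real q ^ (\<Sum>j<s. Suc j) * real q ^ (\<Sum>j<s + t. Suc j) *
    (gl (s + t) + al s * real q ^ (t * s) * (real q * real (trace_count t \<beta>) - gl t))"
proof -
  define c where "c = real (card {w \<in> double_coset (s + t) s. mat_tr w = \<beta>})"
  define T where "T = real (card {p \<in> parabolic (s + t). mat_tr (p * sigma (s + t) s) = \<beta>})"
  define e1 e2 where "e1 = (\<Sum>j<s. Suc j)" and "e2 = (\<Sum>j = s..<s + t. Suc j)"
  have e: "(\<Sum>j<s + t. Suc j) = e1 + e2"
    unfolding e1_def e2_def lessThan_atLeast0 by (rule sum.atLeastLessThan_concat[symmetric]) auto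
  have sym: "real (card (symmetric (s + t) :: 'a mat set)) = real q ^ (e1 + e2)"
    by (simp only: card_symmetric card_UNIV e of_nat_power)
  have "card (parabolic (s + t) :: 'a mat set) = card ((GL (s + t) :: 'a mat set) \<times> (symmetric (s + t) :: 'a mat set))"
    unfolding parabolic_eq by (rule card_image[OF inj_on_parabolic_mat])
  then have P: "real (card (parabolic (s + t) :: 'a mat set)) = gl (s + t) * real q ^ (e1 + e2)"
    by (simp add: card_cartesian_product gl_def sym)
  have "card {w \<in> {x * sigma (s + t) s * y | x y. x \<in> parabolic (s + t) \<and> y \<in> parabolic (s + t)}. mat_tr w = \<beta>} *
      card {z \<in> parabolic (s + t). sigma (s + t) s * z * sigma (s + t) s \<in> (parabolic (s + t) :: 'a mat set)} =
    card (parabolic (s + t) :: 'a mat set) * card {p \<in> parabolic (s + t). mat_tr (p * sigma (s + t) s) = \<beta>}"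
  proof (rule card_double_coset_fibre[where m = "(s + t) + (s + t)"])
    show "parabolic (s + t) \<subseteq> (carrier_mat (s + t + (s + t)) (s + t + (s + t)) :: 'a mat set)"
      using parabolic_carrier by blast
    show "sigma (s + t) s \<in> (carrier_mat (s + t + (s + t)) (s + t + (s + t)) :: 'a mat set)"
      by (rule sigma_carrier) simp
    show "sigma (s + t) s * sigma (s + t) s = (1\<^sub>m (s + t + (s + t)) :: 'a mat)"
      by (rule sigma_sigma) simp
  qed (fact finite_parabolic parabolic_mult parabolic_inverse mat_tr_comm)+
  then have "card {w \<in> double_coset (s + t) s. mat_tr w = \<beta>} *
      (card (GL s :: 'a mat set) * q ^ (t * s) * card (GL t :: 'a mat set) * q ^ e2) =
    card (parabolic (s + t) :: 'a mat set) * card {p \<in> parabolic (s + t). mat_tr (p * sigma (s + t) s) = \<beta>}"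
    unfolding card_stabilizer double_coset_def[symmetric] e2_def[symmetric] .
  from this[THEN arg_cong[of _ _ real]] have "c * (gl s * real q ^ (t * s) * gl t * real q ^ e2) = gl (s + t) * real q ^ (e1 + e2) * T"
    by (simp only: of_nat_mult of_nat_power P flip: c_def T_def gl_def)
  then have 1: "(c * (gl s * real q ^ (t * s) * gl t)) * real q ^ e2 = (gl (s + t) * real q ^ e1 * T) * real q ^ e2"
    by (simp add: power_add ac_simps)
  have 2: "c * (gl s * real q ^ (t * s) * gl t) = gl (s + t) * real q ^ e1 * T"
    using 1 q_ge_2 by simp
  have "real q * T + real q ^ (e1 + e2) * (al s * real q ^ (t * s) * gl t) =
      real q ^ (e1 + e2) * (gl (s + t) + real q * (al s * real q ^ (t * s) * real (trace_count t \<beta>)))"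
    using card_trace_parabolic_sigma[of s t \<beta>, THEN arg_cong[of _ _ real]]
    by (simp only: of_nat_mult of_nat_power of_nat_add sym flip: T_def gl_def al_def)
  then have 3: "real q * T = real q ^ (e1 + e2) * (gl (s + t) + al s * real q ^ (t * s) * (real q * real (trace_count t \<beta>) - gl t))"
    by (simp add: algebra_simps)
  have "c * (real q * gl s * real q ^ (t * s) * gl t) = real q * (c * (gl s * real q ^ (t * s) * gl t))"
    by (simp only: ac_simps)
  also have "\<dots> = gl (s + t) * real q ^ e1 * (real q * T)"
    unfolding 2 by (simp only: ac_simps)
  finally show ?thesis
    unfolding 3 e c_def e1_def by (simp only: ac_simps)
qed

text \<open>In order, the summands come from \<open>gl (2 * m + 1)\<close>, symmetric matrices of
  sizes \<open>2 * m\<close> and \<open>2 * m + 1\<close>, and \<open>al (2 * m)\<close>. In the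
  next lemma \<open>gl (2 * m + 2)\<close> supplies the first two.\<close>

lemma exponents_minus:
  "2 * m + m * (2 * m + 1) + (\<Sum>j<2 * m + 1. Suc j) + m * (m - 1) = (5 * (2 * m + 1) ^ 2 - 1) div 4"
proof -
  have "(\<Sum>j<2 * m + 1. Suc j) = m * (2 * m + 1) + (2 * m + 1)"
    using sum_Suc_lessThan_double[of m] by simp
  moreover have "(5 * (2 * m + 1) ^ 2 - 1) div 4 = 5 * m * m + 5 * m + 1"
    by (simp add: power2_eq_square algebra_simps)
  ultimately show ?thesis
    by (cases m) (simp_all add: algebra_simps)
qed

lemma exponents_plus:
  "(2 * m + 1) + 2 * m + m * (2 * m + 1) + (\<Sum>j<2 * m + 2. Suc j) + m * (m - 1) = (5 * (2 * m + 2) ^ 2 - 2 * (2 * m + 2)) div 4"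
proof -
  have "(\<Sum>j<2 * m + 2. Suc j) = m * (2 * m + 1) + (2 * m + 1) + (2 * m + 2)"
    using sum_Suc_lessThan_double[of m] by (simp add: numeral_2_eq_2)
  moreover have "5 * (2 * m + 2) ^ 2 - 2 * (2 * m + 2) = 4 * (5 * m * m + 9 * m + 4)"
    by (simp add: power2_eq_square algebra_simps)
  ultimately show ?thesis
    by (cases m) (simp_all add: algebra_simps)
qed

end

section \<open>The weight distribution\<close>

context binary_field
begin

lemma card_DC_minus:
  assumes "odd n"
  shows "real (card {w \<in> DC_minus n. mat_tr w = (\<beta> :: 'a)}) =
    A_minus n q * (B_minus n q + real q * real (trace_count 1 \<beta>) - (real q - 1)) / real q"
proof -
  obtain m where n: "n = 2 * m + 1"
    using assms by (elim oddE)
  define Q where "Q = real q"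
  define c where "c = real (card {w \<in> DC_minus n. mat_tr w = \<beta>})"
  define k where "k = real (trace_count 1 \<beta>)"
  define e1 e where "e1 = m * (2 * m + 1)" and "e = (\<Sum>j<2 * m + 1. Suc j)"
  define P1 where "P1 = (\<Prod>j = 1..m. Q ^ (2 * j - 1) - 1)"
  define P2 where "P2 = (\<Prod>j = 1..m. Q ^ (2 * j) - 1)"
  have Q: "Q > 1"
    using q_power_gt_1[of 1] by (simp add: Q_def)
  have B: "B_minus n q = Q ^ (m ^ 2) * (Q ^ n - 1) * P2"
    by (simp add: B_minus_def n Q_def P2_def power_mult_distrib)
  have a: "al (2 * m) = Q ^ (m * (m - 1)) * P1"
    by (simp add: al_closed Q_def P1_def)
  have A: "A_minus n q * (Q - 1) = (Q ^ n - 1) * Q ^ (2 * m + e1 + e) * al (2 * m)"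
  proof -
    have "(5 * n ^ 2 - 1) div 4 = 2 * m + e1 + e + m * (m - 1)"
      unfolding n e1_def e_def by (rule exponents_minus[symmetric])
    then have "A_minus n q = Q ^ (2 * m + e1 + e) * Q ^ (m * (m - 1)) * ((Q ^ n - 1) / (Q - 1)) * P1"
      by (simp add: A_minus_def q_binom_def n Q_def P1_def flip: power_add)
    then show ?thesis
      using Q by (simp add: a)
  qed
  have gl1: "gl 1 = Q - 1"
    using gl_Suc[of 0] by (simp add: gl_0 Q_def)
  have G: "gl (2 * m) = Q ^ (m ^ 2) * P2 * al (2 * m)"
    by (simp add: gl_closed Q_def P2_def)
  have gln: "gl (2 * m + 1) = (Q ^ n - 1) * Q ^ (2 * m) * gl (2 * m)"
    using gl_Suc[of "2 * m"] by (simp add: n Q_def)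
  \<comment> \<open>The order of \<open>GL n\<close> occurs twice in the count: as a prefactor it
    feeds \<open>A_minus\<close> through \<open>gln\<close>, and inside the bracket it is
    \<open>B_minus\<close> times the factor shared with the trace term.\<close>
  have gln': "gl (2 * m + 1) = B_minus n q * al (2 * m) * Q ^ (2 * m)"
    unfolding gln B G by (simp only: ac_simps)
  have "c * (Q * gl (2 * m) * Q ^ (1 * (2 * m)) * gl 1) =
      gl (2 * m + 1) * Q ^ e1 * Q ^ e * (gl (2 * m + 1) + al (2 * m) * Q ^ (1 * (2 * m)) * (Q * k - gl 1))"
    using double_coset_trace_count[of "2 * m" 1 \<beta>] unfolding sum_Suc_lessThan_double
    by (simp only: c_def Q_def k_def e1_def e_def DC_minus_def n diff_add_inverse2)
  then have "c * (Q * gl (2 * m) * Q ^ (2 * m) * (Q - 1)) =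
      (Q ^ n - 1) * Q ^ (2 * m) * gl (2 * m) * Q ^ e1 * Q ^ e *
      (B_minus n q * al (2 * m) * Q ^ (2 * m) + al (2 * m) * Q ^ (2 * m) * (Q * k - (Q - 1)))"
    by (simp only: mult_1_left gl1 flip: gln') (simp only: gln)
  then have "(gl (2 * m) * Q ^ (2 * m)) * (c * Q * (Q - 1)) = (gl (2 * m) * Q ^ (2 * m)) *
      ((Q ^ n - 1) * Q ^ (2 * m + e1 + e) * al (2 * m) * (B_minus n q + Q * k - (Q - 1)))"
    by (simp add: power_add algebra_simps)
  then have "c * Q * (Q - 1) = A_minus n q * (Q - 1) * (B_minus n q + Q * k - (Q - 1))"
    unfolding A using gl_pos[of "2 * m"] Q by (subst (asm) mult_cancel_left) auto
  then have "(Q - 1) * (c * Q) = (Q - 1) * (A_minus n q * (B_minus n q + Q * k - (Q - 1)))"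
    by (simp only: ac_simps)
  then have "c * Q = A_minus n q * (B_minus n q + Q * k - (Q - 1))"
    using Q by (subst (asm) mult_cancel_left) auto
  then show ?thesis
    using Q by (simp add: c_def Q_def k_def field_simps)
qed

lemma card_DC_plus:
  assumes "even n" "n \<ge> 2"
  shows "real (card {w \<in> DC_plus n. mat_tr w = (\<beta> :: 'a)}) =
    A_plus n q * (B_plus n q + real (trace_count 2 \<beta>) - (real q ^ 2 - 1) * (real q - 1)) / real q"
proof -
  obtain m where n: "n = 2 * m + 2"
    using assms by (metis add_2_eq_Suc' dvd_def even_Suc_Suc_iff le_Suc_ex add.commute)
  define Q where "Q = real q"
  define c where "c = real (card {w \<in> DC_plus n. mat_tr w = \<beta>})"
  define k where "k = real (trace_count 2 \<beta>)"
  define e1 e where "e1 = m * (2 * m + 1)" and "e = (\<Sum>j<2 * m + 2. Suc j)"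
  define P1 where "P1 = (\<Prod>j = 1..m. Q ^ (2 * j - 1) - 1)"
  define P2 where "P2 = (\<Prod>j = 1..m. Q ^ (2 * j) - 1)"
  have Q: "Q > 1" "Q ^ 2 > 1"
    using q_power_gt_1[of 1] q_power_gt_1[of 2] by (simp_all add: Q_def)
  have B: "B_plus n q = Q ^ (m ^ 2) * (Q ^ n - 1) * (Q ^ (n - 1) - 1) * P2"
    by (simp add: B_plus_def n Q_def P2_def power_mult_distrib)
  have a: "al (2 * m) = Q ^ (m * (m - 1)) * P1"
    by (simp add: al_closed Q_def P1_def)
  \<comment> \<open>\<open>A_plus\<close> multiplied by the denominators of
    \<open>q_binom q n 2\<close>, whose product is also \<open>gl 2 / Q\<close>; this keeps
    fractions out of the cancellation.\<close>
  define X where "X = (Q ^ n - 1) * (Q ^ (n - 1) - 1) * Q ^ (2 * m + 1 + 2 * m + e1 + e) * al (2 * m)"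
  have A: "A_plus n q * ((Q ^ 2 - 1) * (Q - 1)) = X"
  proof -
    define d where "d = (Q ^ 2 - 1) * (Q - 1)"
    have "(5 * n ^ 2 - 2 * n) div 4 = 2 * m + 1 + 2 * m + e1 + e + m * (m - 1)"
      unfolding n e1_def e_def by (rule exponents_plus[symmetric])
    then have "A_plus n q = Q ^ (2 * m + 1 + 2 * m + e1 + e) * Q ^ (m * (m - 1)) * q_binom q n 2 * P1"
      by (simp add: A_plus_def n Q_def P1_def flip: power_add)
    moreover have "q_binom q n 2 = (Q ^ n - 1) * (Q ^ (n - 1) - 1) / d"
      by (simp add: q_binom_def numeral_2_eq_2 Q_def d_def)
    moreover have "d > 0"
      unfolding d_def using Q by (intro mult_pos_pos) auto
    ultimately show ?thesis
      unfolding d_def[symmetric] by (simp add: a X_def)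
  qed
  have gl2: "gl 2 = (Q ^ 2 - 1) * (Q - 1) * Q"
    using gl_Suc[of 0] gl_Suc[of 1] by (simp add: gl_0 Q_def numeral_2_eq_2)
  have G: "gl (2 * m) = Q ^ (m ^ 2) * P2 * al (2 * m)"
    by (simp add: gl_closed Q_def P2_def)
  have gln: "gl (2 * m + 2) = (Q ^ n - 1) * Q ^ (2 * m + 1) * ((Q ^ (n - 1) - 1) * Q ^ (2 * m) * gl (2 * m))"
    using gl_Suc[of "2 * m"] gl_Suc[of "Suc (2 * m)"] by (simp add: n Q_def)
  have gln': "gl (2 * m + 2) = B_plus n q * al (2 * m) * Q ^ (2 * (2 * m)) * Q"
  proof -
    have "Q ^ (2 * (2 * m)) = Q ^ (2 * m) * Q ^ (2 * m)" "Q ^ (2 * m + 1) = Q ^ (2 * m) * Q"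
      by (simp_all flip: power_add)
    then show ?thesis
      unfolding gln B G by (simp only: ac_simps)
  qed
  have "c * (Q * gl (2 * m) * Q ^ (2 * (2 * m)) * gl 2) =
      gl (2 * m + 2) * Q ^ e1 * Q ^ e * (gl (2 * m + 2) + al (2 * m) * Q ^ (2 * (2 * m)) * (Q * k - gl 2))"
    using double_coset_trace_count[of "2 * m" 2 \<beta>] unfolding sum_Suc_lessThan_double
    by (simp only: c_def Q_def k_def e1_def e_def DC_plus_def n diff_add_inverse2)
  then have "c * (Q * gl (2 * m) * Q ^ (2 * (2 * m)) * ((Q ^ 2 - 1) * (Q - 1) * Q)) =
      (Q ^ n - 1) * Q ^ (2 * m + 1) * ((Q ^ (n - 1) - 1) * Q ^ (2 * m) * gl (2 * m)) * Q ^ e1 * Q ^ e *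
      (B_plus n q * al (2 * m) * Q ^ (2 * (2 * m)) * Q +
        al (2 * m) * Q ^ (2 * (2 * m)) * (Q * k - (Q ^ 2 - 1) * (Q - 1) * Q))"
    by (simp only: gl2 flip: gln') (simp only: gln)
  also have "\<dots> = (gl (2 * m) * Q ^ (2 * (2 * m)) * Q) * (X * (B_plus n q + k - (Q ^ 2 - 1) * (Q - 1)))"
    unfolding X_def power_add by (simp add: algebra_simps)
  finally have "(gl (2 * m) * Q ^ (2 * (2 * m)) * Q) * (c * Q * ((Q ^ 2 - 1) * (Q - 1))) =
      (gl (2 * m) * Q ^ (2 * (2 * m)) * Q) * (X * (B_plus n q + k - (Q ^ 2 - 1) * (Q - 1)))"
    by (simp only: ac_simps)
  then have "c * Q * ((Q ^ 2 - 1) * (Q - 1)) = X * (B_plus n q + k - (Q ^ 2 - 1) * (Q - 1))"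
    using gl_pos[of "2 * m"] Q by (subst (asm) mult_cancel_left) auto
  then have "((Q ^ 2 - 1) * (Q - 1)) * (c * Q) = ((Q ^ 2 - 1) * (Q - 1)) * (A_plus n q * (B_plus n q + k - (Q ^ 2 - 1) * (Q - 1)))"
    unfolding A[symmetric] by (simp only: ac_simps)
  then have "c * Q = A_plus n q * (B_plus n q + k - (Q ^ 2 - 1) * (Q - 1))"
    using Q by (subst (asm) mult_cancel_left) auto
  then show ?thesis
    using Q by (simp add: c_def Q_def k_def field_simps)
qed

lemma real_num_codewords:
  fixes g :: "nat \<Rightarrow> 'a mat"
  assumes g: "bij_betw g {..<N} D"
  shows "real (num_codewords N g j) =
    (\<Sum>\<nu>\<in>families j. \<Prod>\<beta>\<in>UNIV. binom (real (card {w \<in> D. mat_tr w = \<beta>})) (\<nu> \<beta>))"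
proof -
  have "card {i. i < N \<and> mat_tr (g i) = \<beta>} = card {w \<in> D. mat_tr w = \<beta>}" for \<beta>
  proof (rule bij_betw_same_card)
    have "g ` {i. i < N \<and> mat_tr (g i) = \<beta>} = {w \<in> D. mat_tr w = \<beta>}"
      using g by (auto simp: bij_betw_def)
    then show "bij_betw g {i. i < N \<and> mat_tr (g i) = \<beta>} {w \<in> D. mat_tr w = \<beta>}"
      using g by (auto simp: bij_betw_def inj_on_def)
  qed
  then show ?thesis
    by (simp add: num_codewords_eq binom_of_nat)
qed

lemma prod_UNIV_0: "(\<Prod>\<beta>\<in>UNIV. h \<beta>) = h (0 :: 'a) * (\<Prod>\<beta>\<in>UNIV - {0}. h \<beta> :: real)"
  by (simp add: prod.remove)

lemma kloosterman_range:
  assumes "q \<ge> 4" "(\<beta> :: 'a) \<noteq> 0"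
  shows "\<bar>real_of_int (kloosterman r (inverse \<beta>))\<bar> < 2 * sqrt (real q)"
    "[kloosterman r (inverse \<beta>) = -1] (mod 4)"
proof -
  have "kloosterman r (inverse \<beta>) ^ 2 < 4 * int q"
    using assms by (intro kloosterman_bound) simp
  then have "real_of_int (kloosterman r (inverse \<beta>) ^ 2) < real_of_int (4 * int q)"
    by (simp only: of_int_less_iff)
  then have "sqrt (real_of_int (kloosterman r (inverse \<beta>)) ^ 2) < sqrt (4 * real q)"
    by (intro real_sqrt_less_mono) simp
  then show "\<bar>real_of_int (kloosterman r (inverse \<beta>))\<bar> < 2 * sqrt (real q)"
    by (simp only: real_sqrt_abs real_sqrt_mult real_sqrt_four)
  show "[kloosterman r (inverse \<beta>) = -1] (mod 4)"
    using assms by (intro kloosterman_mod_4) simp_all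
qed

end

theorem theorem19:
  fixes q r :: nat
  assumes q: "q = 2 ^ r"
    and card_field: "card (UNIV :: 'a::{field,finite} set) = q"
  shows
    "(\<forall>n N j. \<forall>g :: nat \<Rightarrow> 'a mat.
        odd n \<and> n \<ge> 1 \<and> N = card (DC_minus n :: 'a mat set) \<and>
        bij_betw g {..<N} (DC_minus n) \<and> j \<le> N \<longrightarrow>
        real (num_codewords N g j) =
          (\<Sum>\<nu> \<in> (families j :: ('a \<Rightarrow> nat) set).
             binom (A_minus n q * (B_minus n q + 1) / real q) (\<nu> 0) *
             (\<Prod>\<beta> \<in> {\<beta>. \<beta> \<noteq> 0 \<and> tr r (inverse \<beta>) = 0}.
                binom (A_minus n q * (B_minus n q + real q + 1) / real q) (\<nu> \<beta>)) *
             (\<Prod>\<beta> \<in> {\<beta>. \<beta> \<noteq> 0 \<and> tr r (inverse \<beta>) = 1}.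
                binom (A_minus n q * (B_minus n q - real q + 1) / real q) (\<nu> \<beta>))))
     \<and>
     (\<forall>n N j. \<forall>g :: nat \<Rightarrow> 'a mat.
        even n \<and> n \<ge> 2 \<and> q \<ge> 4 \<and> N = card (DC_plus n :: 'a mat set) \<and>
        bij_betw g {..<N} (DC_plus n) \<and> j \<le> N \<longrightarrow>
        real (num_codewords N g j) =
          (\<Sum>\<nu> \<in> (families j :: ('a \<Rightarrow> nat) set).
             binom (A_plus n q * (B_plus n q + real q ^ 3 - real q ^ 2 - 1) / real q) (\<nu> 0) *
             (\<Prod>\<tau> \<in> {\<tau> :: int. \<bar>real_of_int \<tau>\<bar> < 2 * sqrt (real q) \<and> [\<tau> = -1] (mod 4)}.
                \<Prod>\<beta> \<in> {\<beta>. \<beta> \<noteq> 0 \<and> kloosterman r (inverse \<beta>) = \<tau>}.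
                  binom (A_plus n q * (B_plus n q + real q * real_of_int \<tau> - real q ^ 2 - 1) / real q)
                    (\<nu> \<beta>))))"
proof -
  interpret binary_field q r "TYPE('a)"
    using q card_field by unfold_locales
  show ?thesis
  proof (intro conjI allI impI; elim conjE)
    fix n N j and g :: "nat \<Rightarrow> 'a mat"
    assume n: "odd n" and g: "bij_betw g {..<N} (DC_minus n)"
    define c where "c \<beta> = real (card {w \<in> DC_minus n. mat_tr w = \<beta>})" for \<beta> :: 'a
    have tc: "real (trace_count 1 \<beta>) = real_of_int (1 + (if \<beta> = 0 then 0 else add_char r (inverse \<beta>)))" for \<beta> :: 'a
      by (simp only: trace_count_1[symmetric] of_int_of_nat_eq)
    \<comment> \<open>\<open>trace_count 1 \<beta>\<close> is 1, 2 or 0 in the three cases, so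
      \<open>q\<close> times it minus \<open>q - 1\<close> is \<open>1\<close>, \<open>q + 1\<close>
      or \<open>- q + 1\<close>.\<close>
    have c: "c 0 = A_minus n q * (B_minus n q + 1) / real q"
      "\<beta> \<noteq> 0 \<Longrightarrow> tr r (inverse \<beta>) = 0 \<Longrightarrow> c \<beta> = A_minus n q * (B_minus n q + real q + 1) / real q"
      "\<beta> \<noteq> 0 \<Longrightarrow> tr r (inverse \<beta>) = 1 \<Longrightarrow> c \<beta> = A_minus n q * (B_minus n q - real q + 1) / real q" for \<beta>
      by (simp_all add: c_def card_DC_minus[OF n] tc add_char_def algebra_simps del: One_nat_def)
    have UN: "UNIV - {0 :: 'a} = {\<beta>. \<beta> \<noteq> 0 \<and> tr r (inverse \<beta>) = 0} \<union> {\<beta>. \<beta> \<noteq> 0 \<and> tr r (inverse \<beta>) = 1}"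
      using tr_cases by auto
    have "(\<Prod>\<beta>\<in>UNIV. binom (c \<beta>) (\<nu> \<beta>)) = binom (c 0) (\<nu> 0) *
        ((\<Prod>\<beta> \<in> {\<beta>. \<beta> \<noteq> 0 \<and> tr r (inverse \<beta>) = 0}. binom (c \<beta>) (\<nu> \<beta>)) *
         (\<Prod>\<beta> \<in> {\<beta>. \<beta> \<noteq> 0 \<and> tr r (inverse \<beta>) = 1}. binom (c \<beta>) (\<nu> \<beta>)))" for \<nu>
      unfolding prod_UNIV_0 UN by (subst prod.union_disjoint) auto
    then show "real (num_codewords N g j) =
          (\<Sum>\<nu> \<in> (families j :: ('a \<Rightarrow> nat) set).
             binom (A_minus n q * (B_minus n q + 1) / real q) (\<nu> 0) *
             (\<Prod>\<beta> \<in> {\<beta>. \<beta> \<noteq> 0 \<and> tr r (inverse \<beta>) = 0}.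
                binom (A_minus n q * (B_minus n q + real q + 1) / real q) (\<nu> \<beta>)) *
             (\<Prod>\<beta> \<in> {\<beta>. \<beta> \<noteq> 0 \<and> tr r (inverse \<beta>) = 1}.
                binom (A_minus n q * (B_minus n q - real q + 1) / real q) (\<nu> \<beta>)))"
      unfolding real_num_codewords[OF g] c_def[symmetric] by (simp add: c mult.assoc)
  next
    fix n N j and g :: "nat \<Rightarrow> 'a mat"
    assume n: "even n" "n \<ge> 2" and q4: "q \<ge> 4" and g: "bij_betw g {..<N} (DC_plus n)"
    define c where "c \<beta> = real (card {w \<in> DC_plus n. mat_tr w = \<beta>})" for \<beta> :: 'a
    define K where "K \<beta> = kloosterman r (inverse \<beta>)" for \<beta> :: 'a
    let ?T = "{\<tau> :: int. \<bar>real_of_int \<tau>\<bar> < 2 * sqrt (real q) \<and> [\<tau> = -1] (mod 4)}"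
    have tc: "real (trace_count 2 \<beta>) = real_of_int (gl2_count \<beta>)" for \<beta> :: 'a
      by (simp only: trace_count_2[symmetric] of_int_of_nat_eq)
    \<comment> \<open>\<open>2 * q ^ 3 - 2 * q ^ 2 - q\<close> minus
      \<open>(q ^ 2 - 1) * (q - 1)\<close> is \<open>q ^ 3 - q ^ 2 - 1\<close>.\<close>
    have c0: "c 0 = A_plus n q * (B_plus n q + real q ^ 3 - real q ^ 2 - 1) / real q"
      unfolding c_def card_DC_plus[OF n] tc gl2_count_0
      by (rule arg_cong[where f = "\<lambda>x. A_plus n q * x / real q"]) (simp add: algebra_simps power2_eq_square power3_eq_cube)
    have c: "c \<beta> = A_plus n q * (B_plus n q + real q * real_of_int (K \<beta>) - real q ^ 2 - 1) / real q" if "\<beta> \<noteq> 0" for \<beta>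
      unfolding c_def card_DC_plus[OF n] tc gl2_count_nonzero[OF that] K_def
      by (rule arg_cong[where f = "\<lambda>x. A_plus n q * x / real q"]) (simp add: algebra_simps power2_eq_square)
    have finT: "finite ?T"
    proof (rule finite_subset)
      show "?T \<subseteq> {- \<lceil>2 * sqrt (real q)\<rceil>..\<lceil>2 * sqrt (real q)\<rceil>}"
      proof
        fix \<tau> assume "\<tau> \<in> ?T"
        then have "\<bar>real_of_int \<tau>\<bar> < real_of_int \<lceil>2 * sqrt (real q)\<rceil>"
          by (auto intro: less_le_trans[OF _ le_of_int_ceiling])
        then show "\<tau> \<in> {- \<lceil>2 * sqrt (real q)\<rceil>..\<lceil>2 * sqrt (real q)\<rceil>}"
          by auto
      qed
    qed simp
    \<comment> \<open>Here the Weil bound and the congruence enter: every nonzero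
      \<open>\<beta>\<close> falls under some \<open>\<tau>\<close> in the index set, and a
      \<open>\<tau>\<close> that is not attained contributes an empty product.\<close>
    have "K ` (UNIV - {0}) \<subseteq> ?T"
      using kloosterman_range[OF q4] by (auto simp: K_def)
    then have "(\<Prod>\<beta>\<in>UNIV - {0}. h \<beta>) = (\<Prod>\<tau>\<in>?T. \<Prod>\<beta> \<in> {\<beta>. \<beta> \<noteq> 0 \<and> K \<beta> = \<tau>}. h \<beta>)" for h :: "'a \<Rightarrow> real"
      using prod.group[of "UNIV - {0}" ?T K h] finT by simp
    then have 1: "(\<Prod>\<beta>\<in>UNIV. binom (c \<beta>) (\<nu> \<beta>)) = binom (c 0) (\<nu> 0) *
        (\<Prod>\<tau>\<in>?T. \<Prod>\<beta> \<in> {\<beta>. \<beta> \<noteq> 0 \<and> K \<beta> = \<tau>}. binom (c \<beta>) (\<nu> \<beta>))" for \<nu>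
      by (simp only: prod_UNIV_0)
    have 2: "(\<Prod>\<tau>\<in>?T. \<Prod>\<beta> \<in> {\<beta>. \<beta> \<noteq> 0 \<and> K \<beta> = \<tau>}. binom (c \<beta>) (\<nu> \<beta>)) =
        (\<Prod>\<tau>\<in>?T. \<Prod>\<beta> \<in> {\<beta>. \<beta> \<noteq> 0 \<and> K \<beta> = \<tau>}.
          binom (A_plus n q * (B_plus n q + real q * real_of_int \<tau> - real q ^ 2 - 1) / real q) (\<nu> \<beta>))" for \<nu>
      by (intro prod.cong refl) (auto simp: c)
    show "real (num_codewords N g j) =
          (\<Sum>\<nu> \<in> (families j :: ('a \<Rightarrow> nat) set).
             binom (A_plus n q * (B_plus n q + real q ^ 3 - real q ^ 2 - 1) / real q) (\<nu> 0) *
             (\<Prod>\<tau> \<in> ?T.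
                \<Prod>\<beta> \<in> {\<beta>. \<beta> \<noteq> 0 \<and> kloosterman r (inverse \<beta>) = \<tau>}.
                  binom (A_plus n q * (B_plus n q + real q * real_of_int \<tau> - real q ^ 2 - 1) / real q)
                    (\<nu> \<beta>)))"
      unfolding real_num_codewords[OF g] c_def[symmetric] 1 2 c0 K_def[symmetric] ..
  qed
qed

end
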